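(* Let $(M,\omega,H)$ be a Hamiltonian system with functionally independent conserved quantities $H=H_1,\dots,H_k$, let $A\in L^1_\beta(M)$ be an observable, let $\{\mathcal N_n\}_{n\in\mathbb N}$, $\mathcal N_n=\{N^n_1,\dots,N^n_{k_n}\}$, be an ergodic decomposition of the system constructed by successive refinement, and let $B_{n,i}$ be the associated averaged functions of $A$. Then for every $n\in\mathbb N$ (and every $d\in\mathbb N$) we have $$\mathcal C(A)\ \ge\ \sum_{i=1}^{k_n}\left(\sum_{|\mathbf l|\le d,\ |\mathbf j|\le d}\langle B_{n,i},H_1^{l_1}H_2^{l_2}\cdots H_k^{l_k}\rangle_\beta\ (\mathbf H^{-1})_{o(\mathbf l),o(\mathbf j)}\ \langle B_{n,i},H_1^{j_1}H_2^{j_2}\cdots H_k^{j_k}\rangle_\beta\right).$$ The inequality also holds for $d=\infty$, that is, with the inner double sum taken over all multi-indices and $\mathbf H^{-1}$ the inverse of the infinite inner product matrix $\mathbf H$ of all the monomials.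
   Context: $(M,\omega,H)$ is a Hamiltonian system: $(M,\omega)$ is a symplectic manifold of finite dimension $2r$, $H:M\to\mathbb R$ is the Hamiltonian, and $\gamma_m:\mathbb R\to M$ is the solution of Hamilton's equations with $\gamma_m(0)=m$. The measure $dm$ on $M$ is given by $\omega^r$ (locally $dq_1\cdots dq_r\,dp_1\cdots dp_r$). The partition function $\mathcal Z(\beta)=\int_M e^{-\beta H(m)}\,dm$ is assumed to exist for all $\beta>0$; fix $\beta>0$. $L^p_\beta(M)$ is the space of measurable $f:M\to\mathbb R$ with $\int_M|f|^p e^{-\beta H}\,dm<\infty$, and $$\langle F,G\rangle_\beta=\frac1{\mathcal Z(\beta)}\int_M F(m)G(m)e^{-\beta H(m)}\,dm .$$ The invariant measure $\mu$ on $M$ is $\mu(N)=\frac1{\mathcal Z(\beta)}\int_N e^{-\beta H}\,dm$. For an observable $A:M\to\mathbb R$ put $A^t(m)=A(\gamma_m(t))$ and $\mathcal C(A)=\lim_{T\to\infty}\frac1T\int_0^T\langle A^0,A^t\rangle_\beta\,dt$. Conserved quantities: $H=H_1,H_2,\dots,H_k:M\to\mathbb R$, $k<2r$, are functionally independent functions constant along the flow (not necessarily in involution). The moment map is $\mathcal H=(H_1,\dots,H_k):M\to D\subset\mathbb R^k$, and $\mathcal L_\alpha=\mathcal H^{-1}(\alpha)$ for $\alpha\in D$. Each $\mathcal L_\alpha$ carries the generalized microcanonical measure $dm_\alpha$ induced by $dm$, so that $\int_M F\,dm=\int_D\left(\int_{\mathcal L_\alpha}F(m_\alpha)\,dm_\alpha\right)d\alpha$;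 $\mathrm{Vol}$ of a subset of $\mathcal L_\alpha$ is its $dm_\alpha$-measure, and $\mathrm{Vol}(\mathcal L_\alpha)$ is assumed finite. Ergodic decomposition: the system is not ergodic if there is an invariant measurable set $N\subset M$ with $0<\mu(N)<1$. One starts with a finite partition $\mathcal N_1=\{N^1_1,\dots,N^1_{k_1}\}$ of $M$ into invariant measurable sets with $0<\mu(N^1_i)<1$, $\mu(N^1_i\cap N^1_j)=0$ for $i\neq j$, and $\bigcup_i N^1_i=M$; then each $N^1_i$ is decomposed into finitely many invariant measurable sets with analogous properties, giving $\mathcal N_2=\{N^2_1,\dots,N^2_{k_2}\}$, and so on. This yields a sequence $\{\mathcal N_n\}_{n\in\mathbb N}$ of successively refined finite partitions $\mathcal N_n=\{N^n_1,\dots,N^n_{k_n}\}$ into invariant measurable sets with $0<\mu(N^n_i)<1$, $\mu(N^n_i\cap N^n_j)=0$ for $i\ne j$, $\bigcup_{i=1}^{k_n}N^n_i=M$. For a sequence $\{a_n\}$ of natural numbers with $1\le a_n\le k_n$, the limit set is $N_{\{a_n\}}=\lim_{n\to\infty}N^n_{a_n}=\bigcap_{n=1}^\infty N^n_{a_n}$. It is asserted, as a consequence of this construction, that each $N_{\{a_n\}}$ is measurable and invariant and that the system is ergodic on every $N_{\{a_n\}}$. Put $N^n_{\alpha,i}=\mathcal L_\alpha\cap N^n_i$. The averaged functions are $$B_{n,i}(m)=\begin{cases}\dfrac1{\mathrm{Vol}(N^n_{\mathcal H(m),i})}\displaystyle\int_{N^n_{\mathcal H(m),i}}A(m_\alpha)\,dm_\alpha,&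 m\in N^n_i,\\[2mm] 0,&\text{otherwise.}\end{cases}$$ Multi-indices $\mathbf l=(l_1,\dots,l_k)$ have nonnegative integer entries and $|\mathbf l|=l_1+\dots+l_k$. They are ordered first by degree $|\mathbf l|$ and, within equal degree, lexicographically; $o(\mathbf l)\in\{0,1,2,\dots\}$ is the position of $\mathbf l$ in this order. The monomials $H_1^{l_1}\cdots H_k^{l_k}$ are regarded as elements of $L^2_\beta(M)$. The inner product matrix $\mathbf H$ has entries $(\mathbf H)_{o(\mathbf l),o(\mathbf j)}=\langle H_1^{l_1}\cdots H_k^{l_k},H_1^{j_1}\cdots H_k^{j_k}\rangle_\beta$ for $|\mathbf l|,|\mathbf j|\le d$ (all multi-indices if $d=\infty$); functional independence of the $H_i$ gives linear independence of the monomials, so $\mathbf H$ is non-singular for finite $d$.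
   Formalization: Integrals of A^0 A^t over [0,T]×M are assumed absolutely convergent (automatic for A in L^2), so C(A) is defined. For d=∞: the limit of the finite-d sums, and any two-sided inverse G of H for which the sums v^T G v and (Gv)^T H (Gv) converge absolutely, v the moments of B_{n,i}. *)

theory Defs
  imports "HOL-Analysis.Analysis"
begin

text \<open>\<open>C_on r S f\<close> is used for open \<open>S\<close> only: \<open>f\<close> is \<open>r\<close> times continuously differentiable on \<open>S\<close>.\<close>

primrec C_on :: "nat \<Rightarrow> 'a::real_normed_vector set \<Rightarrow> ('a \<Rightarrow> 'b::real_normed_vector) \<Rightarrow> bool" where
  "C_on 0 S f \<longleftrightarrow> continuous_on S f"
| "C_on (Suc r) S f \<longleftrightarrow>
     (\<forall>x\<in>S. f differentiable (at x)) \<and> (\<forall>v. C_on r S (\<lambda>x. frechet_derivative f (at x) v))"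

definition smooth_on :: "'a::real_normed_vector set \<Rightarrow> ('a \<Rightarrow> 'b::real_normed_vector) \<Rightarrow> bool" where
  "smooth_on S f \<longleftrightarrow> (\<forall>r. C_on r S f)"

definition partial_deriv :: "'n::finite \<Rightarrow> (real^'n \<Rightarrow> real) \<Rightarrow> real^'n \<Rightarrow> real" where
  "partial_deriv i f x = frechet_derivative f (at x) (axis i 1)"

text \<open>The manifold is the whole type \<open>'m\<close>. A chart is a pair of its domain and its coordinate map;
  the values of the coordinate map outside the domain are irrelevant.\<close>

type_synonym ('m, 'n) chart = "'m set \<times> ('m \<Rightarrow> real^'n)"

definition chart_range :: "('m, 'n::finite) chart \<Rightarrow> (real^'n) set" where
  "chart_range c = snd c ` fst c"

definition chart_inv :: "('m, 'n::finite) chart \<Rightarrow> real^'n \<Rightarrow> 'm" where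
  "chart_inv c = inv_into (fst c) (snd c)"

definition smooth_atlas ::
    "('m::{second_countable_topology, t2_space}, 'n::finite) chart set \<Rightarrow> bool" where
  "smooth_atlas atlas \<longleftrightarrow>
     (\<Union>c\<in>atlas. fst c) = UNIV \<and>
     (\<forall>c\<in>atlas. open (fst c) \<and> open (chart_range c) \<and>
        homeomorphism (fst c) (chart_range c) (snd c) (chart_inv c)) \<and>
     (\<forall>c\<in>atlas. \<forall>c'\<in>atlas. smooth_on (snd c ` (fst c \<inter> fst c')) (snd c' \<circ> chart_inv c))"

definition smooth_map ::
    "('m, 'n::finite) chart set \<Rightarrow> ('m \<Rightarrow> 'b::real_normed_vector) \<Rightarrow> bool" where
  "smooth_map atlas f \<longleftrightarrow> (\<forall>c\<in>atlas. smooth_on (chart_range c) (f \<circ> chart_inv c))"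

text \<open>A 2-form is given by its coefficient matrices \<open>\<omega> c x $ i $ j = \<omega>(\<partial>\<^sub>i, \<partial>\<^sub>j)\<close> at the point with
  coordinates \<open>x\<close> in the chart \<open>c\<close>. The last condition is the transformation law
  \<open>\<Omega> = J\<^sup>T \<Omega>' J\<close>, where \<open>J\<close> is the Jacobian of the coordinate change. Nondegeneracy and skew symmetry
  force the dimension \<open>CARD('n)\<close> to be even.\<close>

definition symplectic_form ::
    "('m, 'n::finite) chart set \<Rightarrow> (('m, 'n) chart \<Rightarrow> real^'n \<Rightarrow> real^'n^'n) \<Rightarrow> bool" where
  "symplectic_form atlas \<omega> \<longleftrightarrow>
     (\<forall>c\<in>atlas. smooth_on (chart_range c) (\<omega> c) \<and>
        (\<forall>x\<in>chart_range c.
           transpose (\<omega> c x) = - \<omega> c x \<and>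
           det (\<omega> c x) \<noteq> 0 \<and>
           (\<forall>i j k. partial_deriv i (\<lambda>y. \<omega> c y $ j $ k) x
                  + partial_deriv j (\<lambda>y. \<omega> c y $ k $ i) x
                  + partial_deriv k (\<lambda>y. \<omega> c y $ i $ j) x = 0))) \<and>
     (\<forall>c\<in>atlas. \<forall>c'\<in>atlas. \<forall>m\<in>fst c \<inter> fst c'.
        let J = matrix (frechet_derivative (snd c' \<circ> chart_inv c) (at (snd c m)))
        in \<omega> c (snd c m) = transpose J ** \<omega> c' (snd c' m) ** J)"

text \<open>Hamilton's equations are \<open>\<omega>(\<gamma>', \<cdot>) = dH\<close>; for \<open>\<omega> = \<Sum> dq\<^sub>i \<and> dp\<^sub>i\<close> they read
  \<open>q' = \<partial>H/\<partial>p\<close>, \<open>p' = -\<partial>H/\<partial>q\<close>.\<close>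

definition hamiltonian_flow ::
    "('m::topological_space, 'n::finite) chart set \<Rightarrow> (('m, 'n) chart \<Rightarrow> real^'n \<Rightarrow> real^'n^'n) \<Rightarrow>
     ('m \<Rightarrow> real) \<Rightarrow> ('m \<Rightarrow> real \<Rightarrow> 'm) \<Rightarrow> bool" where
  "hamiltonian_flow atlas \<omega> H \<gamma> \<longleftrightarrow>
     (\<forall>m. \<gamma> m 0 = m \<and> continuous_on UNIV (\<gamma> m) \<and>
        (\<forall>c\<in>atlas. \<forall>t. \<gamma> m t \<in> fst c \<longrightarrow>
           (\<exists>X. ((\<lambda>s. snd c (\<gamma> m s)) has_vector_derivative X) (at t) \<and>
              (\<forall>j. (\<Sum>i\<in>UNIV. X $ i * \<omega> c (snd c (\<gamma> m t)) $ i $ j)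
                    = partial_deriv j (H \<circ> chart_inv c) (snd c (\<gamma> m t))))))"

definition hamiltonian_system ::
    "('m::{second_countable_topology, t2_space}, 'n::finite) chart set \<Rightarrow>
     (('m, 'n) chart \<Rightarrow> real^'n \<Rightarrow> real^'n^'n) \<Rightarrow> ('m \<Rightarrow> real) \<Rightarrow> ('m \<Rightarrow> real \<Rightarrow> 'm) \<Rightarrow> bool" where
  "hamiltonian_system atlas \<omega> H \<gamma> \<longleftrightarrow>
     smooth_atlas atlas \<and> symplectic_form atlas \<omega> \<and> smooth_map atlas H \<and>
     hamiltonian_flow atlas \<omega> H \<gamma>"

text \<open>In a chart, \<open>\<omega>\<^sup>r/r!\<close> is the Pfaffian of the coefficient matrix times the coordinate volume form,
  and the Pfaffian is a square root of the determinant. In Darboux coordinates the density below is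
  1, so the normalization is \<open>dq\<^sub>1 \<dots> dq\<^sub>r dp\<^sub>1 \<dots> dp\<^sub>r\<close>.\<close>

definition liouville_measure ::
    "('m::topological_space, 'n::finite) chart set \<Rightarrow> (('m, 'n) chart \<Rightarrow> real^'n \<Rightarrow> real^'n^'n) \<Rightarrow>
     'm measure \<Rightarrow> bool" where
  "liouville_measure atlas \<omega> vol \<longleftrightarrow>
     sets vol = sets borel \<and>
     (\<forall>c\<in>atlas. \<forall>E\<in>sets borel. E \<subseteq> fst c \<longrightarrow>
        emeasure vol E = (\<integral>\<^sup>+x\<in>snd c ` E. ennreal (sqrt (det (\<omega> c x))) \<partial>lborel))"

definition partition_function :: "'m measure \<Rightarrow> ('m \<Rightarrow> real) \<Rightarrow> real \<Rightarrow> real" where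
  "partition_function vol H \<beta> = (\<integral>m. exp (- \<beta> * H m) \<partial>vol)"

definition Lp_space :: "real \<Rightarrow> 'm measure \<Rightarrow> ('m \<Rightarrow> real) \<Rightarrow> real \<Rightarrow> ('m \<Rightarrow> real) set" where
  "Lp_space p vol H \<beta> =
     {f \<in> borel_measurable vol. integrable vol (\<lambda>m. \<bar>f m\<bar> powr p * exp (- \<beta> * H m))}"

definition thermal_inner ::
    "'m measure \<Rightarrow> ('m \<Rightarrow> real) \<Rightarrow> real \<Rightarrow> ('m \<Rightarrow> real) \<Rightarrow> ('m \<Rightarrow> real) \<Rightarrow> real" where
  "thermal_inner vol H \<beta> F G =
     1 / partition_function vol H \<beta> * (\<integral>m. F m * G m * exp (- \<beta> * H m) \<partial>vol)"

definition gibbs_measure :: "'m measure \<Rightarrow> ('m \<Rightarrow> real) \<Rightarrow> real \<Rightarrow> 'm measure" where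
  "gibbs_measure vol H \<beta> =
     density vol (\<lambda>m. ennreal (exp (- \<beta> * H m) / partition_function vol H \<beta>))"

definition evolved :: "('m \<Rightarrow> real \<Rightarrow> 'm) \<Rightarrow> ('m \<Rightarrow> real) \<Rightarrow> real \<Rightarrow> 'm \<Rightarrow> real" where
  "evolved \<gamma> A t m = A (\<gamma> m t)"

definition mean_correlation ::
    "'m measure \<Rightarrow> ('m \<Rightarrow> real) \<Rightarrow> real \<Rightarrow> ('m \<Rightarrow> real \<Rightarrow> 'm) \<Rightarrow> ('m \<Rightarrow> real) \<Rightarrow> real \<Rightarrow> real" where
  "mean_correlation vol H \<beta> \<gamma> A T =
     1 / T * (LINT t:{0..T}|lborel. thermal_inner vol H \<beta> (evolved \<gamma> A 0) (evolved \<gamma> A t))"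

definition long_time_correlation ::
    "'m measure \<Rightarrow> ('m \<Rightarrow> real) \<Rightarrow> real \<Rightarrow> ('m \<Rightarrow> real \<Rightarrow> 'm) \<Rightarrow> ('m \<Rightarrow> real) \<Rightarrow> real" where
  "long_time_correlation vol H \<beta> \<gamma> A = Lim at_top (mean_correlation vol H \<beta> \<gamma> A)"

text \<open>The integrals over \<open>[0, T] \<times> M\<close> defining the mean correlations converge absolutely. This is
  automatic for \<open>A\<close> in \<open>L\<^sup>2\<close>. For \<open>A\<close> only in \<open>L\<^sup>1\<close> it has to be required, since the Bochner
  integral is 0 where the integrand is not integrable.\<close>

definition correlation_converges ::
    "'m measure \<Rightarrow> ('m \<Rightarrow> real) \<Rightarrow> real \<Rightarrow> ('m \<Rightarrow> real \<Rightarrow> 'm) \<Rightarrow> ('m \<Rightarrow> real) \<Rightarrow> bool" where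
  "correlation_converges vol H \<beta> \<gamma> A \<longleftrightarrow>
     (\<forall>T>0. set_integrable (lborel \<Otimes>\<^sub>M vol) ({0..T} \<times> UNIV)
        (\<lambda>(t, m). evolved \<gamma> A 0 m * evolved \<gamma> A t m * exp (- \<beta> * H m)))"

text \<open>Functional independence: the differentials are linearly independent on a dense set, which is
  then open by continuity. The components of \<open>Hs\<close> are \<open>H\<^sub>1, \<dots>, H\<^sub>k\<close> with \<open>k = CARD('k)\<close>, in the order
  of \<open>'k\<close>, so \<open>Min UNIV\<close> is the index 1.\<close>

definition differentials_independent ::
    "('m, 'n::finite) chart set \<Rightarrow> ('m \<Rightarrow> real^'k::finite) \<Rightarrow> 'm \<Rightarrow> bool" where
  "differentials_independent atlas Hs m \<longleftrightarrow>
     (\<forall>c\<in>atlas. m \<in> fst c \<longrightarrow>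
        (\<forall>a. (\<forall>v. (\<Sum>i\<in>UNIV. a $ i *
                 frechet_derivative (\<lambda>x. Hs (chart_inv c x) $ i) (at (snd c m)) v) = 0)
             \<longrightarrow> a = 0))"

definition functionally_independent ::
    "('m::topological_space, 'n::finite) chart set \<Rightarrow> ('m \<Rightarrow> real^'k::finite) \<Rightarrow> bool" where
  "functionally_independent atlas Hs \<longleftrightarrow> closure {m. differentials_independent atlas Hs m} = UNIV"

definition conserved_quantities ::
    "('m::topological_space, 'n::finite) chart set \<Rightarrow> ('m \<Rightarrow> real) \<Rightarrow> ('m \<Rightarrow> real \<Rightarrow> 'm) \<Rightarrow>
     ('m \<Rightarrow> real^'k::{finite, linorder}) \<Rightarrow> bool" where
  "conserved_quantities atlas H \<gamma> Hs \<longleftrightarrow>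
     CARD('k) < CARD('n) \<and>
     (\<forall>m. Hs m $ Min UNIV = H m) \<and>
     smooth_map atlas Hs \<and>
     functionally_independent atlas Hs \<and>
     (\<forall>m t. Hs (\<gamma> m t) = Hs m)"

definition level_set :: "('m \<Rightarrow> real^'k) \<Rightarrow> real^'k \<Rightarrow> 'm set" where
  "level_set Hs \<alpha> = Hs -` {\<alpha>}"

text \<open>The disintegration formula is stated for nonnegative Borel functions. Only the restriction of
  \<open>\<nu> \<alpha>\<close> to the level set of \<open>\<alpha> \<in> D\<close> matters.\<close>

definition microcanonical_measures ::
    "'m::topological_space measure \<Rightarrow> ('m \<Rightarrow> real^'k::finite) \<Rightarrow> (real^'k) set \<Rightarrow>
     (real^'k \<Rightarrow> 'm measure) \<Rightarrow> bool" where
  "microcanonical_measures vol Hs D \<nu> \<longleftrightarrow>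
     D \<in> sets borel \<and> range Hs \<subseteq> D \<and>
     (\<forall>\<alpha>\<in>D. sets (\<nu> \<alpha>) = sets borel \<and> emeasure (\<nu> \<alpha>) (level_set Hs \<alpha>) < \<infinity>) \<and>
     (\<forall>E\<in>sets borel. (\<lambda>\<alpha>. emeasure (\<nu> \<alpha>) (level_set Hs \<alpha> \<inter> E))
                        \<in> borel_measurable (restrict_space borel D)) \<and>
     (\<forall>F\<in>borel_measurable borel.
        (\<integral>\<^sup>+m. F m \<partial>vol) = (\<integral>\<^sup>+\<alpha>\<in>D. (\<integral>\<^sup>+m\<in>level_set Hs \<alpha>. F m \<partial>\<nu> \<alpha>) \<partial>lborel))"

definition flow_invariant :: "('m \<Rightarrow> real \<Rightarrow> 'm) \<Rightarrow> 'm set \<Rightarrow> bool" where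
  "flow_invariant \<gamma> E \<longleftrightarrow> (\<forall>m\<in>E. \<forall>t. \<gamma> m t \<in> E)"

definition ergodic_on :: "('m \<Rightarrow> real \<Rightarrow> 'm) \<Rightarrow> 'm measure \<Rightarrow> 'm set \<Rightarrow> bool" where
  "ergodic_on \<gamma> \<mu> S \<longleftrightarrow> S \<in> sets \<mu> \<and> flow_invariant \<gamma> S \<and>
     \<not> (\<exists>E\<in>sets \<mu>. E \<subseteq> S \<and> flow_invariant \<gamma> E \<and> 0 < measure \<mu> E \<and> measure \<mu> E < measure \<mu> S)"

definition invariant_partition ::
    "('m \<Rightarrow> real \<Rightarrow> 'm) \<Rightarrow> 'm measure \<Rightarrow> nat \<Rightarrow> (nat \<Rightarrow> 'm set) \<Rightarrow> bool" where
  "invariant_partition \<gamma> \<mu> k N \<longleftrightarrow>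
     (\<forall>i\<in>{1..k}. N i \<in> sets \<mu> \<and> flow_invariant \<gamma> (N i) \<and> 0 < measure \<mu> (N i) \<and> measure \<mu> (N i) < 1) \<and>
     (\<forall>i\<in>{1..k}. \<forall>j\<in>{1..k}. i \<noteq> j \<longrightarrow> measure \<mu> (N i \<inter> N j) = 0) \<and>
     (\<Union>i\<in>{1..k}. N i) = UNIV"

text \<open>In the refinement condition, \<open>p j\<close> is the index of the cell of level \<open>n\<close> from whose
  decomposition the \<open>j\<close>-th cell of level \<open>n + 1\<close> arises.\<close>

definition ergodic_decomposition ::
    "('m \<Rightarrow> real \<Rightarrow> 'm) \<Rightarrow> 'm measure \<Rightarrow> (nat \<Rightarrow> nat) \<Rightarrow> (nat \<Rightarrow> nat \<Rightarrow> 'm set) \<Rightarrow> bool" where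
  "ergodic_decomposition \<gamma> \<mu> K N \<longleftrightarrow>
     (\<forall>n\<ge>1. invariant_partition \<gamma> \<mu> (K n) (N n)) \<and>
     (\<forall>n\<ge>1. \<exists>p. p ` {1..K (Suc n)} \<subseteq> {1..K n} \<and>
        (\<forall>i\<in>{1..K n}. N n i = (\<Union>j\<in>{j \<in> {1..K (Suc n)}. p j = i}. N (Suc n) j))) \<and>
     (\<forall>a. (\<forall>n\<ge>1. a n \<in> {1..K n}) \<longrightarrow> ergodic_on \<gamma> \<mu> (\<Inter>n\<in>{1..}. N n (a n)))"

definition averaged ::
    "('m \<Rightarrow> real^'k) \<Rightarrow> (real^'k \<Rightarrow> 'm measure) \<Rightarrow> 'm set \<Rightarrow> ('m \<Rightarrow> real) \<Rightarrow> 'm \<Rightarrow> real" where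
  "averaged Hs \<nu> N A m =
     (if m \<in> N
      then 1 / measure (\<nu> (Hs m)) (level_set Hs (Hs m) \<inter> N) *
           (LINT x:(level_set Hs (Hs m) \<inter> N)|\<nu> (Hs m). A x)
      else 0)"

definition degree :: "('k::finite \<Rightarrow> nat) \<Rightarrow> nat" where
  "degree l = (\<Sum>i\<in>UNIV. l i)"

definition multi_index_less ::
    "('k::{finite, linorder} \<Rightarrow> nat) \<Rightarrow> ('k \<Rightarrow> nat) \<Rightarrow> bool" where
  "multi_index_less l j \<longleftrightarrow>
     degree l < degree j \<or>
     degree l = degree j \<and> (\<exists>i. l i < j i \<and> (\<forall>i'<i. l i' = j i'))"

definition position :: "('k::{finite, linorder} \<Rightarrow> nat) \<Rightarrow> nat" where
  "position l = card {j. multi_index_less j l}"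

definition multi_index :: "nat \<Rightarrow> 'k::{finite, linorder} \<Rightarrow> nat" where
  "multi_index = inv position"

definition monomial :: "('m \<Rightarrow> real^'k::finite) \<Rightarrow> ('k \<Rightarrow> nat) \<Rightarrow> 'm \<Rightarrow> real" where
  "monomial Hs l m = (\<Prod>i\<in>UNIV. (Hs m $ i) ^ l i)"

definition gram ::
    "'m measure \<Rightarrow> ('m \<Rightarrow> real) \<Rightarrow> real \<Rightarrow> ('m \<Rightarrow> real^'k::{finite, linorder}) \<Rightarrow>
     nat \<Rightarrow> nat \<Rightarrow> real" where
  "gram vol H \<beta> Hs a b =
     thermal_inner vol H \<beta> (monomial Hs (multi_index a)) (monomial Hs (multi_index b))"

definition moment ::
    "'m measure \<Rightarrow> ('m \<Rightarrow> real) \<Rightarrow> real \<Rightarrow> ('m \<Rightarrow> real^'k::finite) \<Rightarrow> ('m \<Rightarrow> real) \<Rightarrow>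
     ('k \<Rightarrow> nat) \<Rightarrow> real" where
  "moment vol H \<beta> Hs F l = thermal_inner vol H \<beta> F (monomial Hs l)"

text \<open>Two-sided inverse of a matrix with index set \<open>I\<close>. For finite \<open>I\<close> the sums are ordinary ones;
  for infinite \<open>I\<close> they converge absolutely.\<close>

definition inverse_matrix ::
    "'i set \<Rightarrow> ('i \<Rightarrow> 'i \<Rightarrow> real) \<Rightarrow> ('i \<Rightarrow> 'i \<Rightarrow> real) \<Rightarrow> bool" where
  "inverse_matrix I G K \<longleftrightarrow>
     (\<forall>a\<in>I. \<forall>b\<in>I. ((\<lambda>c. G a c * K c b) has_sum (if a = b then 1 else 0)) I \<and>
                  ((\<lambda>c. K a c * G c b) has_sum (if a = b then 1 else 0)) I)"

definition finite_gram_inverse ::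
    "'m measure \<Rightarrow> ('m \<Rightarrow> real) \<Rightarrow> real \<Rightarrow> ('m \<Rightarrow> real^'k::{finite, linorder}) \<Rightarrow> nat \<Rightarrow>
     nat \<Rightarrow> nat \<Rightarrow> real" where
  "finite_gram_inverse vol H \<beta> Hs d =
     (SOME K. inverse_matrix (position ` {l::'k \<Rightarrow> nat. degree l \<le> d}) (gram vol H \<beta> Hs) K)"

definition inverse_gram_form ::
    "'m measure \<Rightarrow> ('m \<Rightarrow> real) \<Rightarrow> real \<Rightarrow> ('m \<Rightarrow> real^'k::{finite, linorder}) \<Rightarrow> nat \<Rightarrow>
     ('m \<Rightarrow> real) \<Rightarrow> real" where
  "inverse_gram_form vol H \<beta> Hs d F =
     (\<Sum>l | degree l \<le> d. \<Sum>j | degree j \<le> d.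
        moment vol H \<beta> Hs F l * finite_gram_inverse vol H \<beta> Hs d (position l) (position j)
          * moment vol H \<beta> Hs F j)"

text \<open>An infinite Gram matrix has in general many inverses, which differ by matrices \<open>E\<close> with
  \<open>G E = E G = 0\<close>, and sums such as \<open>v\<^sup>T (K v)\<close> and \<open>(G K) v\<close> need neither converge nor associate. The inverse
  \<open>K\<close> is applicable to the vector \<open>v\<close> if the sums for \<open>v\<^sup>T K v\<close> and \<open>(K v)\<^sup>T G (K v)\<close> converge
  absolutely; for finite matrices this is no condition.\<close>

definition inverse_applicable ::
    "('i \<Rightarrow> 'i \<Rightarrow> real) \<Rightarrow> ('i \<Rightarrow> 'i \<Rightarrow> real) \<Rightarrow> ('i \<Rightarrow> real) \<Rightarrow> bool" where
  "inverse_applicable G K v \<longleftrightarrow>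
     (\<lambda>(a, b). v a * K a b * v b) summable_on UNIV \<and>
     (\<lambda>(a, b, c, e). (K b a * v a) * G b c * (K c e * v e)) summable_on UNIV"

definition infinite_inverse_gram_form ::
    "'m measure \<Rightarrow> ('m \<Rightarrow> real) \<Rightarrow> real \<Rightarrow> ('m \<Rightarrow> real^'k::{finite, linorder}) \<Rightarrow>
     (nat \<Rightarrow> nat \<Rightarrow> real) \<Rightarrow> ('m \<Rightarrow> real) \<Rightarrow> real" where
  "infinite_inverse_gram_form vol H \<beta> Hs K F =
     (\<Sum>\<^sub>\<infinity>(l, j)\<in>UNIV.
        moment vol H \<beta> Hs F l * K (position l) (position j) * moment vol H \<beta> Hs F j)"

end

theory Submission
  imports Defs "HOL-Computational_Algebra.Polynomial"
begin

text \<open>Liouville's theorem makes the Gibbs measure \<open>\<mu>\<close> invariant under the flow. Only the integral of \<open>A A\<^sup>t\<close>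
  is assumed to exist, but already the time averages \<open>x\<^sub>T = 1/T \<integral>\<^sub>0\<^sup>T A\<^sup>t dt\<close> lie in \<open>L\<^sup>2(\<mu>)\<close>, the mean
  correlation converges, and its limit is \<open>inf\<^sub>T \<parallel>x\<^sub>T\<parallel>\<^sup>2\<close> (von Neumann's ergodic theorem, carried out on the
  level of correlations). On an invariant set \<open>N\<close> the averaged function \<open>B\<close> is the conditional
  expectation of \<open>A\<close>, hence also of \<open>x\<^sub>T\<close>, given the conserved quantities, so that
  \<open>\<parallel>B\<parallel> \<le> \<parallel>x\<^sub>T 1\<^sub>N\<parallel>\<close>; summing over a partition bounds \<open>\<Sum>\<^sub>i \<parallel>B\<^sub>i\<parallel>\<^sup>2\<close> by the limit. Finally, the quadratic
  form of the inverse Gram matrix is the squared norm of the projection of \<open>B\<^sub>i\<close> to a space of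
  polynomials in the conserved quantities, which is at most \<open>\<parallel>B\<^sub>i\<parallel>\<^sup>2\<close> by Bessel's inequality.\<close>

section \<open>Flows depend differentiably on the initial value\<close>

text \<open>The observable need not be square integrable, so the ergodic theorem in L^2 cannot be
  applied to it. All statements about time averages are read off one function \<open>I\<close>, the
  second antiderivative of the correlation: for \<open>P \<le> T\<close> the time integrals satisfy
  \<open>\<langle>S P, S T\<rangle> = I P + I T - I (T - P)\<close>, and Hilbert space arguments
  become inequalities for \<open>I\<close>. Comparing the mean correlation with such products needs
  an a priori bound on the growth of the correlation integral; without a norm of A it comes from the
  process |A|. Nor is the averaged function known to be square integrable beforehand, which is why
  it is truncated. The flow is given as a mere family of solution curves. Uniqueness, the group law,
  continuity and invariance of volume are derived from the C^1 regularity of the vector field,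
  starting from short-time estimates in small coordinate balls. The Gram matrices are invertible
  because a polynomial in the conserved quantities that vanishes almost everywhere vanishes
  everywhere, hence on an open subset of R^k.\<close>

lemma vector_derivative_bound:
  fixes f :: "real \<Rightarrow> 'a::real_normed_vector"
  assumes "\<And>t. t \<in> {0..h} \<Longrightarrow> (f has_vector_derivative f' t) (at t within {0..h})"
    and "\<And>t. t \<in> {0..h} \<Longrightarrow> norm (f' t) \<le> B" and "s \<in> {0..h}" "t \<in> {0..h}"
  shows "norm (f t - f s) \<le> B * \<bar>t - s\<bar>"
proof -
  have "norm (f t - f s) \<le> B * norm (t - s)"
  proof (rule differentiable_bound[where S = "{0..h}" and f' = "\<lambda>u v. v *\<^sub>R f' u"])
    show "(f has_derivative (\<lambda>v. v *\<^sub>R f' x)) (at x within {0..h})" if "x \<in> {0..h}" for x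
      using assms(1)[OF that] by (simp add: has_vector_derivative_def)
    show "onorm (\<lambda>v. v *\<^sub>R f' x) \<le> B" if "x \<in> {0..h}" for x
      using assms(2)[OF that] by (intro onorm_le) (simp add: mult.commute[of B] mult_left_mono)
  qed (use assms in auto)
  then show ?thesis by simp
qed

text \<open>Since \<open>h * L \<le> 1/2\<close>, the supremum of \<open>norm (z t)\<close> can be absorbed; this replaces Gronwall's inequality.\<close>

lemma short_time_bound:
  fixes z :: "real \<Rightarrow> 'a::real_normed_vector"
  assumes z: "\<And>t. t \<in> {0..h} \<Longrightarrow> (z has_vector_derivative z' t) (at t within {0..h})"
    and z': "\<And>t. t \<in> {0..h} \<Longrightarrow> norm (z' t) \<le> L * norm (z t) + c"
    and "h * L \<le> 1/2" "L \<ge> 0" "t \<in> {0..h}"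
  shows "norm (z t) \<le> 2 * (norm (z 0) + h * c)"
proof -
  have "continuous_on {0..h} z"
    using z has_vector_derivative_continuous continuous_on_eq_continuous_within by blast
  then have "continuous_on {0..h} (\<lambda>t. norm (z t))"
    by (intro continuous_intros)
  then obtain m where m: "m \<in> {0..h}" "\<And>t. t \<in> {0..h} \<Longrightarrow> norm (z t) \<le> norm (z m)"
    using continuous_attains_sup[of "{0..h}" "\<lambda>t. norm (z t)"] assms(5) by auto
  have "norm (z m - z 0) \<le> (L * norm (z m) + c) * \<bar>m - 0\<bar>"
  proof (rule vector_derivative_bound[OF z])
    show "norm (z' t) \<le> L * norm (z m) + c" if "t \<in> {0..h}" for t
      using z'[OF that] m(2)[OF that] mult_left_mono[OF _ \<open>L \<ge> 0\<close>, of "norm (z t)" "norm (z m)"] by linarith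
  qed (use m assms(5) in auto)
  also have "\<dots> \<le> (L * norm (z m) + c) * h"
  proof (rule mult_left_mono)
    show "0 \<le> L * norm (z m) + c"
      using z'[OF m(1)] norm_ge_zero[of "z' m"] by linarith
  qed (use m in auto)
  also have "\<dots> = (h * L) * norm (z m) + h * c" by (simp add: algebra_simps)
  also have "\<dots> \<le> 1/2 * norm (z m) + h * c"
    using mult_right_mono[OF assms(3), of "norm (z m)"] by auto
  finally have "norm (z m) \<le> 2 * (norm (z 0) + h * c)"
    using norm_triangle_ineq2[of "z m" "z 0"] by (simp add: algebra_simps)
  then show ?thesis using m(2)[OF assms(5)] by linarith
qed

text \<open>Picard iteration: \<open>\<Phi>\<close> maps \<open>Z\<close> to the right-hand side of
  the integral equation, and \<open>h * L \<le> 1/2\<close> makes it a contraction with constant 1/2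
  in the supremum norm, so that no subdivision of the interval is needed.\<close>

lemma linear_ode_solution:
  fixes a :: "real \<Rightarrow> 'a::banach \<Rightarrow>\<^sub>L 'a"
  assumes a: "continuous_on {0..h} a" and L: "\<And>t. t \<in> {0..h} \<Longrightarrow> norm (a t) \<le> L"
    and hL: "h * L \<le> 1/2" and h: "h \<ge> 0"
  obtains Y where "Y 0 = id_blinfun"
    "\<And>t. t \<in> {0..h} \<Longrightarrow> (Y has_vector_derivative (a t o\<^sub>L Y t)) (at t within {0..h})"
proof -
  have L0: "L \<ge> 0" using order_trans[OF norm_ge_zero L[of 0]] h by simp
  \<comment> \<open>Bounded continuous functions live on the whole real line; clamping the time to
    \<open>{0..h}\<close> yields a map of this complete space into itself.\<close>
  define cl where "cl t = max 0 (min h t)" for t :: real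
  have cl: "cl t \<in> {0..h}" for t using h by (auto simp: cl_def)
  have cont_cl: "continuous_on UNIV cl" unfolding cl_def by (intro continuous_intros)
  define I where "I Z t = id_blinfun + integral {0..t} (\<lambda>s. a s o\<^sub>L Z s)" for Z :: "real \<Rightarrow> 'a \<Rightarrow>\<^sub>L 'a" and t
  have ci: "continuous_on {0..h} (\<lambda>s. a s o\<^sub>L Z s)" if "continuous_on UNIV Z" for Z :: "real \<Rightarrow> 'a \<Rightarrow>\<^sub>L 'a"
    using a continuous_on_subset[OF that subset_UNIV] by (intro continuous_intros)
  have I_deriv: "(I Z has_vector_derivative (a t o\<^sub>L Z t)) (at t within {0..h})"
    if "continuous_on UNIV Z" "t \<in> {0..h}" for Z t
  proof -
    have "((\<lambda>u. integral {0..u} (\<lambda>s. a s o\<^sub>L Z s)) has_vector_derivative (a t o\<^sub>L Z t)) (at t within {0..h})"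
      by (rule integral_has_vector_derivative[OF ci[OF that(1)] that(2)])
    then show ?thesis unfolding I_def by (auto intro!: derivative_eq_intros)
  qed
  have I_cont: "continuous_on {0..h} (I Z)" if "continuous_on UNIV Z" for Z
    using I_deriv[OF that] has_vector_derivative_continuous continuous_on_eq_continuous_within by blast
  have bc: "(\<lambda>t. I (apply_bcontfun Z) (cl t)) \<in> bcontfun" for Z
  proof -
    have cZ: "continuous_on UNIV (apply_bcontfun Z)" by simp
    have "compact (I (apply_bcontfun Z) ` {0..h})"
      using I_cont[OF cZ] by (intro compact_continuous_image) auto
    then have "bounded (I (apply_bcontfun Z) ` {0..h})" by (rule compact_imp_bounded)
    then have "bounded (range (\<lambda>t. I (apply_bcontfun Z) (cl t)))"
      using cl by (rule_tac bounded_subset) auto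
    moreover have "continuous_on UNIV (\<lambda>t. I (apply_bcontfun Z) (cl t))"
      using cl by (intro continuous_on_compose2[OF I_cont[OF cZ] cont_cl]) auto
    ultimately show ?thesis by (auto simp: bcontfun_def)
  qed
  define \<Phi> where "\<Phi> Z = Bcontfun (\<lambda>t. I (apply_bcontfun Z) (cl t))" for Z
  have \<Phi>: "apply_bcontfun (\<Phi> Z) t = I (apply_bcontfun Z) (cl t)" for Z t
    unfolding \<Phi>_def by (simp add: Bcontfun_inverse[OF bc])
  have "dist (\<Phi> Z) (\<Phi> Z') \<le> 1/2 * dist Z Z'" for Z Z'
  proof (rule dist_bound)
    fix t
    let ?f = "\<lambda>s. a s o\<^sub>L Z s" and ?g = "\<lambda>s. a s o\<^sub>L Z' s"
    have sub: "{0..cl t} \<subseteq> {0..h}" using cl[of t] by auto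
    have int: "?f integrable_on {0..cl t}" "?g integrable_on {0..cl t}"
      by (rule integrable_continuous_real, rule continuous_on_subset[OF ci sub], simp)+
    have "norm (integral {0..cl t} ?f - integral {0..cl t} ?g) = norm (integral {0..cl t} (\<lambda>s. ?f s - ?g s))"
      using int by (simp add: integral_diff)
    also have "\<dots> \<le> (L * dist Z Z') * (cl t - 0)"
    proof (rule integral_bound)
      show "continuous_on {0..cl t} (\<lambda>s. ?f s - ?g s)"
        by (intro continuous_intros; rule continuous_on_subset[OF _ sub]) (use a in auto)
      show "norm (?f s - ?g s) \<le> L * dist Z Z'" if "s \<in> {0..cl t}" for s
      proof -
        have "?f s - ?g s = a s o\<^sub>L (Z s - Z' s)"
          by (rule blinfun_eqI) (simp add: blinfun.bilinear_simps)
        then have "norm (?f s - ?g s) \<le> norm (a s) * norm (Z s - Z' s)"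
          using norm_blinfun_compose[of "a s" "Z s - Z' s"] by simp
        also have "\<dots> \<le> L * dist Z Z'"
          using L[of s] sub that dist_bounded[of Z s Z'] L0
          by (intro mult_mono) (auto simp: dist_norm)
        finally show ?thesis .
      qed
    qed (use cl in auto)
    also have "\<dots> \<le> (L * dist Z Z') * h"
      using cl[of t] L0 by (intro mult_left_mono) auto
    also have "\<dots> = (h * L) * dist Z Z'" by simp
    also have "\<dots> \<le> 1/2 * dist Z Z'" using hL by (intro mult_right_mono) auto
    finally show "dist (\<Phi> Z t) (\<Phi> Z' t) \<le> 1/2 * dist Z Z'"
      unfolding \<Phi> I_def by (simp add: dist_norm)
  qed
  then obtain Z where Z: "\<Phi> Z = Z"
    using banach_fix_type[of "1/2" \<Phi>] by auto
  have ZI: "apply_bcontfun Z t = I (apply_bcontfun Z) t" if "t \<in> {0..h}" for t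
    using \<Phi>[of Z t] that unfolding Z by (simp add: cl_def)
  show ?thesis
  proof (rule that[of "apply_bcontfun Z"])
    show "apply_bcontfun Z 0 = id_blinfun" using ZI[of 0] h by (simp add: I_def)
    show "(apply_bcontfun Z has_vector_derivative (a t o\<^sub>L Z t)) (at t within {0..h})" if "t \<in> {0..h}" for t
      using I_deriv[of "apply_bcontfun Z" t] that
      by (rule_tac has_vector_derivative_transform[OF that, of _ "I (apply_bcontfun Z)"]) (use ZI in auto)
  qed
qed

text \<open>The derivative is the solution \<open>Y\<close> of the variational equation along the
  base trajectory. The error \<open>z\<close> of the linear approximation starts at 0 and satisfies
  a linear differential inequality whose inhomogeneity is small compared with
  \<open>norm (x' - x)\<close>: compactness of \<open>Q\<close> makes \<open>J\<close> uniformly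
  continuous, and convexity keeps the segments between trajectories in \<open>Q\<close>.\<close>

lemma flow_differentiable:
  fixes X :: "'a::euclidean_space \<Rightarrow> 'a" and y :: "'a \<Rightarrow> real \<Rightarrow> 'a"
  assumes Q: "compact Q" "convex Q"
    and X: "\<And>p. p \<in> Q \<Longrightarrow> (X has_derivative blinfun_apply (J p)) (at p within Q)"
    and J: "continuous_on Q J" "\<And>p. p \<in> Q \<Longrightarrow> norm (J p) \<le> L"
    and hL: "h * L \<le> 1/2" "h \<ge> 0"
    and U: "open U"
    and y0: "\<And>x. x \<in> U \<Longrightarrow> y x 0 = x"
    and yQ: "\<And>x t. x \<in> U \<Longrightarrow> t \<in> {0..h} \<Longrightarrow> y x t \<in> Q"
    and y': "\<And>x t. x \<in> U \<Longrightarrow> t \<in> {0..h} \<Longrightarrow> (y x has_vector_derivative X (y x t)) (at t within {0..h})"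
    and x: "x \<in> U"
  obtains Y where "Y 0 = id_blinfun"
    "\<And>t. t \<in> {0..h} \<Longrightarrow> (Y has_vector_derivative (J (y x t) o\<^sub>L Y t)) (at t within {0..h})"
    "\<And>t. t \<in> {0..h} \<Longrightarrow> ((\<lambda>x. y x t) has_derivative blinfun_apply (Y t)) (at x)"
proof -
  have L0: "L \<ge> 0" using order_trans[OF norm_ge_zero J(2)[OF yQ[OF x, of 0]]] hL(2) by simp
  have contx: "continuous_on {0..h} (y x)"
    using y'[OF x] has_vector_derivative_continuous continuous_on_eq_continuous_within by blast
  have "continuous_on {0..h} (\<lambda>t. J (y x t))"
    by (rule continuous_on_compose2[OF J(1) contx]) (use yQ x in auto)
  then obtain Y where Y: "Y 0 = id_blinfun"
    "\<And>t. t \<in> {0..h} \<Longrightarrow> (Y has_vector_derivative (J (y x t) o\<^sub>L Y t)) (at t within {0..h})"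
    using linear_ode_solution[of h "\<lambda>t. J (y x t)" L] J(2) yQ x hL by metis
  have lip: "norm (y x2 t - y x1 t) \<le> 2 * norm (x2 - x1)" if "x1 \<in> U" "x2 \<in> U" "t \<in> {0..h}" for x1 x2 t
  proof -
    have "norm (y x2 t - y x1 t) \<le> 2 * (norm (y x2 0 - y x1 0) + h * 0)"
    proof (rule short_time_bound[where L = L and z' = "\<lambda>t. X (y x2 t) - X (y x1 t)"])
      show "((\<lambda>t. y x2 t - y x1 t) has_vector_derivative X (y x2 s) - X (y x1 s)) (at s within {0..h})"
        if "s \<in> {0..h}" for s
        using y'[OF \<open>x1 \<in> U\<close> that] y'[OF \<open>x2 \<in> U\<close> that] by (rule_tac has_vector_derivative_diff)
      show "norm (X (y x2 s) - X (y x1 s)) \<le> L * norm (y x2 s - y x1 s) + 0" if "s \<in> {0..h}" for s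
        using differentiable_bound[OF Q(2) X, of L "y x2 s" "y x1 s"] J(2) yQ that \<open>x1 \<in> U\<close> \<open>x2 \<in> U\<close>
        by (auto simp: norm_blinfun.rep_eq)
    qed (use hL L0 that in auto)
    then show ?thesis using y0 that by simp
  qed
  have "((\<lambda>x. y x t) has_derivative blinfun_apply (Y t)) (at x)" if t: "t \<in> {0..h}" for t
    unfolding has_derivative_within_alt
  proof (intro conjI allI impI)
    show "bounded_linear (blinfun_apply (Y t))" by (rule blinfun.bounded_linear_right)
    fix e :: real assume e: "e > 0"
    \<comment> \<open>\<open>short_time_bound\<close> turns the inhomogeneity
      \<open>2 * norm (x' - x) * e'\<close> into \<open>4 * h * e' * norm (x' - x)\<close>; the
      summand 4 keeps the denominator positive when \<open>h = 0\<close>.\<close>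
    define e' where "e' = e / (4 * h + 4)"
    have e': "e' > 0" "4 * h * e' \<le> e" using e hL(2) by (auto simp: e'_def field_simps)
    have "uniformly_continuous_on Q J" using J(1) Q(1) compact_uniformly_continuous by blast
    then obtain d where d: "d > 0" "\<And>p q. p \<in> Q \<Longrightarrow> q \<in> Q \<Longrightarrow> dist p q < d \<Longrightarrow> dist (J p) (J q) < e'"
      using e'(1) unfolding uniformly_continuous_on_def by metis
    obtain r where r: "r > 0" "ball x r \<subseteq> U" using U x open_contains_ball by blast
    \<comment> \<open>By \<open>lip\<close>, trajectories starting less than \<open>d/2\<close>
      apart stay less than \<open>d\<close> apart, where the modulus of continuity of
      \<open>J\<close> applies.\<close>
    show "\<exists>d>0. \<forall>x'\<in>UNIV. norm (x' - x) < d \<longrightarrow> norm (y x' t - y x t - blinfun_apply (Y t) (x' - x)) \<le> e * norm (x' - x)"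
    proof (intro exI[of _ "min r (d/2)"] conjI ballI impI)
      show "min r (d/2) > 0" using r d by auto
      fix x' assume n: "norm (x' - x) < min r (d/2)"
      then have x': "x' \<in> U" using r by (auto simp: dist_norm norm_minus_commute)
      define z where "z s = y x' s - y x s - blinfun_apply (Y s) (x' - x)" for s
      have "norm (z t) \<le> 2 * (norm (z 0) + h * (2 * norm (x' - x) * e'))"
      proof (rule short_time_bound[where L = L and
            z' = "\<lambda>s. X (y x' s) - X (y x s) - blinfun_apply (J (y x s) o\<^sub>L Y s) (x' - x)"])
        fix s assume s: "s \<in> {0..h}"
        have "((\<lambda>s. blinfun_apply (Y s) (x' - x)) has_vector_derivative blinfun_apply (J (y x s) o\<^sub>L Y s) (x' - x)) (at s within {0..h})"
          by (rule bounded_linear.has_vector_derivative[OF blinfun.bounded_linear_left Y(2)[OF s]])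
        then show "(z has_vector_derivative X (y x' s) - X (y x s) - blinfun_apply (J (y x s) o\<^sub>L Y s) (x' - x)) (at s within {0..h})"
          unfolding z_def using y'[OF x s] y'[OF x' s] by (intro has_vector_derivative_diff)
        let ?p = "y x s" and ?q = "y x' s"
        have near: "norm (?q - ?p) < d" "norm (?q - ?p) \<le> 2 * norm (x' - x)"
          using lip[OF x x' s] n by auto
        have pQ: "?p \<in> Q" "?q \<in> Q" using yQ x x' s by auto
        have "norm (X ?q - X ?p - blinfun_apply (J ?p) (?q - ?p)) \<le> norm (?q - ?p) * e'"
        proof (rule differentiable_bound_linearization[where S = "Q \<inter> ball ?p d"
              and f' = "\<lambda>p. blinfun_apply (J p)" and ?x0.0 = ?p])
          show "?p + u *\<^sub>R (?q - ?p) \<in> Q \<inter> ball ?p d" if "u \<in> {0..1}" for u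
          proof -
            have "norm (u *\<^sub>R (?q - ?p)) \<le> norm (?q - ?p)"
              using that by (auto simp: mult_left_le_one_le)
            moreover have "?p + u *\<^sub>R (?q - ?p) = (1 - u) *\<^sub>R ?p + u *\<^sub>R ?q" by (simp add: algebra_simps)
            moreover have "(1 - u) *\<^sub>R ?p + u *\<^sub>R ?q \<in> Q"
              using pQ that by (intro convexD[OF Q(2)]) auto
            moreover have "dist ?p (?p + u *\<^sub>R (?q - ?p)) = norm (u *\<^sub>R (?q - ?p))" by (simp add: dist_norm)
            ultimately show ?thesis using near(1) by (metis IntI mem_ball order.strict_trans1)
          qed
          show "(X has_derivative blinfun_apply (J p)) (at p within Q \<inter> ball ?p d)" if "p \<in> Q \<inter> ball ?p d" for p
            using has_derivative_subset[OF X] that by blast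
          have Jdiff: "blinfun_apply (J p) - blinfun_apply (J ?p) = blinfun_apply (J p - J ?p)" for p
            by (simp add: fun_eq_iff blinfun.diff_left)
          show "onorm (blinfun_apply (J p) - blinfun_apply (J ?p)) \<le> e'" if "p \<in> Q \<inter> ball ?p d" for p
            using d(2)[of p ?p] that pQ by (subst Jdiff)
              (auto simp: dist_norm norm_blinfun.rep_eq norm_minus_commute less_imp_le)
        qed (use pQ d in auto)
        also have "\<dots> \<le> (2 * norm (x' - x)) * e'" using near(2) e' by (intro mult_right_mono) auto
        finally have A: "norm (X ?q - X ?p - blinfun_apply (J ?p) (?q - ?p)) \<le> 2 * norm (x' - x) * e'" .
        have "X ?q - X ?p - blinfun_apply (J ?p o\<^sub>L Y s) (x' - x)
            = blinfun_apply (J ?p) (z s) + (X ?q - X ?p - blinfun_apply (J ?p) (?q - ?p))"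
          by (simp add: z_def blinfun.bilinear_simps)
        then have "norm (X ?q - X ?p - blinfun_apply (J ?p o\<^sub>L Y s) (x' - x))
            \<le> norm (blinfun_apply (J ?p) (z s)) + norm (X ?q - X ?p - blinfun_apply (J ?p) (?q - ?p))"
          using norm_triangle_ineq by metis
        also have "\<dots> \<le> L * norm (z s) + 2 * norm (x' - x) * e'"
          using A norm_blinfun[of "J ?p" "z s"] J(2)[OF pQ(1)] mult_right_mono[OF J(2)[OF pQ(1)], of "norm (z s)"]
          by (intro add_mono) auto
        finally show "norm (X ?q - X ?p - blinfun_apply (J ?p o\<^sub>L Y s) (x' - x)) \<le> L * norm (z s) + 2 * norm (x' - x) * e'" .
      qed (use hL L0 t in auto)
      also have "z 0 = 0" using y0 x x' Y(1) by (simp add: z_def)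
      also have "2 * (norm (0::'a) + h * (2 * norm (x' - x) * e')) = (4 * h * e') * norm (x' - x)" by simp
      also have "\<dots> \<le> e * norm (x' - x)" using e'(2) by (intro mult_right_mono) auto
      finally show "norm (y x' t - y x t - blinfun_apply (Y t) (x' - x)) \<le> e * norm (x' - x)"
        by (simp add: z_def)
    qed
  qed
  with Y that show ?thesis by blast
qed

section \<open>Hamiltonian vector fields in a chart\<close>

text \<open>An explicit quotient of polynomials in the entries, so that continuity and
  differentiability of the solution are inherited from the data. The Hamiltonian vector field
  obtains its regularity in this way.\<close>

definition cramer_solution :: "real^'n^'n \<Rightarrow> real^'n \<Rightarrow> real^'n" where
  "cramer_solution A b = (\<chi> k. det (\<chi> i j. if j = k then b $ i else A $ i $ j) / det A)"

lemma cramer_solution_iff: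
  "det A \<noteq> 0 \<Longrightarrow> A *v x = b \<longleftrightarrow> x = cramer_solution A b"
  unfolding cramer_solution_def by (rule cramer)

lemma continuous_on_det:
  fixes A :: "'a::topological_space \<Rightarrow> real^'n^'n"
  assumes "\<And>i j. continuous_on S (\<lambda>x. A x $ i $ j)"
  shows "continuous_on S (\<lambda>x. det (A x))"
  unfolding det_def by (intro continuous_intros assms)

lemma continuous_on_cramer_solution:
  fixes A :: "'a::topological_space \<Rightarrow> real^'n^'n"
  assumes "\<And>i j. continuous_on S (\<lambda>x. A x $ i $ j)" "\<And>i. continuous_on S (\<lambda>x. b x $ i)"
    and "\<And>x. x \<in> S \<Longrightarrow> det (A x) \<noteq> 0"
  shows "continuous_on S (\<lambda>x. cramer_solution (A x) (b x))"
proof -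
  have "continuous_on S (\<lambda>x. (\<chi> i j. if j = k then b x $ i else A x $ i $ j) $ i $ j)" for k i j
    by (cases "j = k") (use assms in auto)
  then show ?thesis
    unfolding cramer_solution_def using assms(1,3)
    by (intro continuous_on_vec_lambda continuous_on_divide continuous_on_det) auto
qed

lemma differentiable_det:
  fixes A :: "'a::real_normed_vector \<Rightarrow> real^'n^'n"
  assumes "\<And>i j. (\<lambda>x. A x $ i $ j) differentiable (at x within S)"
  shows "(\<lambda>x. det (A x)) differentiable (at x within S)"
proof -
  have "(\<lambda>x. \<Prod>i\<in>UNIV. A x $ i $ p i) differentiable (at x within S)" for p
  proof -
    from assms have "\<forall>i. \<exists>D. ((\<lambda>x. A x $ i $ p i) has_derivative D) (at x within S)"
      by (auto simp: differentiable_def)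
    then obtain D where D: "\<And>i. ((\<lambda>x. A x $ i $ p i) has_derivative D i) (at x within S)" by metis
    from has_derivative_prod[where I = UNIV and f = "\<lambda>i x. A x $ i $ p i", OF D] show ?thesis by (auto simp: differentiable_def)
  qed
  then show ?thesis unfolding det_def
    by (intro differentiable_sum differentiable_mult differentiable_const) auto
qed

lemma differentiable_vecI:
  fixes f :: "'a::real_normed_vector \<Rightarrow> real^'n"
  assumes "\<And>i. (\<lambda>x. f x $ i) differentiable (at x within S)"
  shows "f differentiable (at x within S)"
proof -
  have "\<forall>i\<in>Basis. (\<lambda>x. f x \<bullet> i) differentiable (at x within S)"
    using assms by (auto simp: Basis_vec_def inner_axis)
  then show ?thesis by (subst differentiable_componentwise_within)
qed

lemma differentiable_cramer_solution:
  fixes A :: "'a::real_normed_vector \<Rightarrow> real^'n^'n"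
  assumes "\<And>i j. (\<lambda>x. A x $ i $ j) differentiable (at x within S)"
    "\<And>i. (\<lambda>x. b x $ i) differentiable (at x within S)" "det (A x) \<noteq> 0"
  shows "(\<lambda>x. cramer_solution (A x) (b x)) differentiable (at x within S)"
proof -
  have "(\<lambda>x. (\<chi> i j. if j = k then b x $ i else A x $ i $ j) $ i $ j) differentiable (at x within S)" for k i j
    by (cases "j = k") (simp_all add: assms)
  then have "(\<lambda>x. det (\<chi> i j. if j = k then b x $ i else A x $ i $ j) / det (A x)) differentiable (at x within S)" for k
    using assms(1,3) by (intro differentiable_divide differentiable_det)
  then have "(\<lambda>x. cramer_solution (A x) (b x) $ k) differentiable (at x within S)" for k
    unfolding cramer_solution_def by simp
  then show ?thesis by (rule differentiable_vecI)
qed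

lemma skew_inner_zero:
  fixes W :: "real^'n^'n"
  assumes "transpose W = - W" shows "x \<bullet> (W *v x) = 0"
proof -
  have "x \<bullet> (W *v x) = (x v* W) \<bullet> x" by (simp add: dot_lmul_matrix)
  also have "x v* W = transpose W *v x" by simp
  also have "\<dots> = - (W *v x)" using matrix_vector_mult_diff_rdistrib[of 0 W x] by (simp add: assms)
  finally show ?thesis by (simp add: inner_commute)
qed

text \<open>\<open>s W + (1 - s) I\<close> is injective for \<open>0 \<le> s < 1\<close>, so its determinant cannot change its sign.\<close>

lemma skew_det_pos:
  fixes W :: "real^'n^'n"
  assumes skew: "transpose W = - W" and nz: "det W \<noteq> 0"
  shows "det W > 0"
proof (rule ccontr)
  assume "\<not> det W > 0"
  then have neg: "det W < 0" using nz by simp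
  define f where "f s = det (s *\<^sub>R W + (1 - s) *\<^sub>R mat 1)" for s :: real
  have "continuous_on {0..1} f"
    unfolding f_def by (rule continuous_on_det) (auto intro!: continuous_intros)
  moreover have "f 1 < 0" "f 0 = 1" using neg by (auto simp: f_def)
  ultimately obtain s where s: "0 \<le> s" "s \<le> 1" "f s = 0"
    using IVT2'[of f 1 0 0] by auto
  then have s1: "s < 1" using \<open>f 1 < 0\<close> by (cases "s = 1") auto
  have "\<not> invertible (s *\<^sub>R W + (1 - s) *\<^sub>R mat 1)"
    using s(3) by (simp add: f_def invertible_det_nz)
  then obtain x where x: "x \<noteq> 0" "(s *\<^sub>R W + (1 - s) *\<^sub>R mat 1) *v x = 0"
    unfolding invertible_left_inverse matrix_left_invertible_ker by auto
  have "0 = x \<bullet> ((s *\<^sub>R W + (1 - s) *\<^sub>R mat 1) *v x)" using x by simp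
  also have "\<dots> = s * (x \<bullet> (W *v x)) + (1 - s) * (x \<bullet> x)"
    by (simp add: matrix_vector_mult_add_rdistrib inner_add_right flip: scaleR_matrix_vector_assoc)
  finally have "(1 - s) * (x \<bullet> x) = 0" by (simp add: skew_inner_zero[OF skew])
  then show False using s1 x by simp
qed

section \<open>Symmetry of mixed second derivatives\<close>

abbreviation fd :: "('a::real_normed_vector \<Rightarrow> 'b::real_normed_vector) \<Rightarrow> 'a \<Rightarrow> 'a \<Rightarrow> 'b"
  where "fd f x v \<equiv> frechet_derivative f (at x) v"

text \<open>The mean value theorem in direction \<open>u\<close>, applied to the difference
  \<open>g\<close> of \<open>f\<close> along two parallel segments, and once more in direction
  \<open>v\<close>. The point \<open>p\<close> is uncontrolled within the ball, but the left-hand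
  side is symmetric in \<open>u\<close> and \<open>v\<close>.\<close>

lemma second_difference_mvt:
  fixes f :: "'a::real_normed_vector \<Rightarrow> real"
  assumes f: "\<And>p. p \<in> ball x r \<Longrightarrow> f differentiable (at p)"
    and fu: "\<And>p. p \<in> ball x r \<Longrightarrow> (\<lambda>q. fd f q u) differentiable (at p)"
    and s: "s > 0" "s * (norm u + norm v) < r"
  obtains p where "p \<in> ball x r"
    "f (x + s *\<^sub>R u + s *\<^sub>R v) - f (x + s *\<^sub>R u) - f (x + s *\<^sub>R v) + f x = s\<^sup>2 * fd (\<lambda>q. fd f q u) p v"
proof -
  have in_ball: "x + a *\<^sub>R u + b *\<^sub>R v \<in> ball x r" if "0 \<le> a" "a \<le> s" "0 \<le> b" "b \<le> s" for a b
  proof -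
    have "norm (a *\<^sub>R u + b *\<^sub>R v) \<le> a * norm u + b * norm v"
      using norm_triangle_ineq[of "a *\<^sub>R u" "b *\<^sub>R v"] that by simp
    also have "\<dots> \<le> s * (norm u + norm v)"
      using that by (auto simp: distrib_left intro!: add_mono mult_right_mono)
    finally have "norm (a *\<^sub>R u + b *\<^sub>R v) < r" using s(2) by simp
    moreover have "dist x (x + a *\<^sub>R u + b *\<^sub>R v) = norm (a *\<^sub>R u + b *\<^sub>R v)"
      by (metis add.assoc add_diff_cancel_left' dist_commute dist_norm)
    ultimately show ?thesis by simp
  qed
  have D: "((\<lambda>a. f (c + a *\<^sub>R w)) has_derivative (\<lambda>d. fd f (c + a *\<^sub>R w) (d *\<^sub>R w))) (at a within T)"
    if "f differentiable (at (c + a *\<^sub>R w))" for f :: "'a \<Rightarrow> real" and c a w T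
    using frechet_derivative_works[THEN iffD1, OF that]
    by (rule has_derivative_compose[rotated]) (auto intro!: derivative_eq_intros)
  have lin: "fd f p (d *\<^sub>R w) = d * fd f p w" if "f differentiable (at p)" for f :: "'a \<Rightarrow> real" and p d w
    using linear_scale[OF linear_frechet_derivative[OF that]] by simp
  have in_a: "x + a *\<^sub>R u \<in> ball x r" if "0 \<le> a" "a \<le> s" for a
    using in_ball[OF that, of 0] s by simp
  have in_b: "x + s *\<^sub>R v + a *\<^sub>R u \<in> ball x r" if "0 \<le> a" "a \<le> s" for a
    using in_ball[OF that, of s] s by (simp add: algebra_simps)
  define g where "g a = f (x + s *\<^sub>R v + a *\<^sub>R u) - f (x + a *\<^sub>R u)" for a
  have "\<exists>\<xi>\<in>{0..s}. g s - g 0 = fd f (x + s *\<^sub>R v + \<xi> *\<^sub>R u) ((s - 0) *\<^sub>R u) - fd f (x + \<xi> *\<^sub>R u) ((s - 0) *\<^sub>R u)"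
  proof (rule mvt_very_simple)
    show "(g has_derivative (\<lambda>d. fd f (x + s *\<^sub>R v + a *\<^sub>R u) (d *\<^sub>R u) - fd f (x + a *\<^sub>R u) (d *\<^sub>R u))) (at a within {0..s})"
      if "0 \<le> a" "a \<le> s" for a
      unfolding g_def using in_a[OF that] in_b[OF that] f by (intro has_derivative_diff D) auto
  qed (use s in auto)
  then obtain \<xi> where \<xi>: "0 \<le> \<xi>" "\<xi> \<le> s"
    "g s - g 0 = s * (fd f (x + \<xi> *\<^sub>R u + s *\<^sub>R v) u - fd f (x + \<xi> *\<^sub>R u) u)"
    using in_a in_b f by (auto simp: lin right_diff_distrib add.commute add.left_commute)
  let ?k = "\<lambda>q. fd f q u"
  have "\<exists>\<eta>\<in>{0..s}. ?k (x + \<xi> *\<^sub>R u + s *\<^sub>R v) - ?k (x + \<xi> *\<^sub>R u + 0 *\<^sub>R v) = fd ?k (x + \<xi> *\<^sub>R u + \<eta> *\<^sub>R v) ((s - 0) *\<^sub>R v)"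
  proof (rule mvt_very_simple)
    show "((\<lambda>b. ?k (x + \<xi> *\<^sub>R u + b *\<^sub>R v)) has_derivative (\<lambda>d. fd ?k (x + \<xi> *\<^sub>R u + b *\<^sub>R v) (d *\<^sub>R v))) (at b within {0..s})"
      if "0 \<le> b" "b \<le> s" for b
      using in_ball[of \<xi> b] that \<xi> fu by (intro D) auto
  qed (use s in auto)
  then obtain \<eta> where \<eta>: "0 \<le> \<eta>" "\<eta> \<le> s"
    "?k (x + \<xi> *\<^sub>R u + s *\<^sub>R v) - ?k (x + \<xi> *\<^sub>R u) = s * fd ?k (x + \<xi> *\<^sub>R u + \<eta> *\<^sub>R v) v"
    using in_ball[OF \<xi>(1,2)] fu by (auto simp: lin)
  show ?thesis
  proof (rule that[of "x + \<xi> *\<^sub>R u + \<eta> *\<^sub>R v"])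
    show "x + \<xi> *\<^sub>R u + \<eta> *\<^sub>R v \<in> ball x r" using in_ball \<xi> \<eta> by auto
    show "f (x + s *\<^sub>R u + s *\<^sub>R v) - f (x + s *\<^sub>R u) - f (x + s *\<^sub>R v) + f x
        = s\<^sup>2 * fd ?k (x + \<xi> *\<^sub>R u + \<eta> *\<^sub>R v) v"
      using \<xi>(3) \<eta>(3) by (simp add: g_def power2_eq_square algebra_simps)
  qed
qed

text \<open>Divided by \<open>s\<^sup>2\<close>, the same second difference is a value of either
  mixed derivative somewhere in a small ball. By continuity these values are within \<open>e\<close>
  of those at the centre, and \<open>e\<close> is half of the supposed discrepancy.\<close>

lemma second_derivative_symmetric:
  fixes f :: "'a::real_normed_vector \<Rightarrow> real"
  assumes W: "open W" "x \<in> W" and f: "C_on (Suc (Suc 0)) W f"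
  shows "fd (\<lambda>q. fd f q u) x v = fd (\<lambda>q. fd f q v) x u"
proof (rule ccontr)
  assume ne: "\<not> ?thesis"
  define e where "e = \<bar>fd (\<lambda>q. fd f q u) x v - fd (\<lambda>q. fd f q v) x u\<bar> / 2"
  have e: "e > 0" using ne by (simp add: e_def)
  have cont: "continuous_on W (\<lambda>p. fd (\<lambda>q. fd f q u) p v)" for u v using f by simp
  obtain r1 where r1: "r1 > 0" "\<And>p. dist p x < r1 \<Longrightarrow> p \<in> W" using W unfolding open_dist by metis
  obtain r2 where r2: "r2 > 0" "\<And>p. p \<in> W \<Longrightarrow> dist p x < r2 \<Longrightarrow>
      dist (fd (\<lambda>q. fd f q u) p v) (fd (\<lambda>q. fd f q u) x v) < e"
    using cont[of u v] W(2) e unfolding continuous_on_iff by metis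
  obtain r3 where r3: "r3 > 0" "\<And>p. p \<in> W \<Longrightarrow> dist p x < r3 \<Longrightarrow>
      dist (fd (\<lambda>q. fd f q v) p u) (fd (\<lambda>q. fd f q v) x u) < e"
    using cont[of v u] W(2) e unfolding continuous_on_iff by metis
  define r where "r = min r1 (min r2 r3)"
  have r: "r > 0" using r1 r2 r3 by (auto simp: r_def)
  have sub: "p \<in> W" if "p \<in> ball x r" for p using that r1(2)[of p] by (auto simp: r_def dist_commute)
  define s where "s = r / (2 * (norm u + norm v + 1))"
  have s: "s > 0" using r by (auto simp: s_def intro!: divide_pos_pos add_nonneg_pos)
  have "s * (norm u + norm v + 1) = r / 2"
    using add_nonneg_pos[of "norm u + norm v" 1] by (simp add: s_def field_simps)
  then have "s * (norm u + norm v) < r" using s r by (simp add: distrib_left)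
  then have s2: "s * (norm u + norm v) < r" "s * (norm v + norm u) < r" by (auto simp: add.commute)
  obtain p where p: "p \<in> ball x r"
    "f (x + s *\<^sub>R u + s *\<^sub>R v) - f (x + s *\<^sub>R u) - f (x + s *\<^sub>R v) + f x = s\<^sup>2 * fd (\<lambda>q. fd f q u) p v"
    by (rule second_difference_mvt[OF _ _ s s2(1), of x f]) (use f sub in auto)
  obtain p' where p': "p' \<in> ball x r"
    "f (x + s *\<^sub>R v + s *\<^sub>R u) - f (x + s *\<^sub>R v) - f (x + s *\<^sub>R u) + f x = s\<^sup>2 * fd (\<lambda>q. fd f q v) p' u"
    by (rule second_difference_mvt[OF _ _ s s2(2), of x f]) (use f sub in auto)
  have "s\<^sup>2 * fd (\<lambda>q. fd f q u) p v = s\<^sup>2 * fd (\<lambda>q. fd f q v) p' u"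
    using p(2) p'(2) by (simp add: algebra_simps)
  then have "fd (\<lambda>q. fd f q u) p v = fd (\<lambda>q. fd f q v) p' u" using s by simp
  moreover have "dist (fd (\<lambda>q. fd f q u) p v) (fd (\<lambda>q. fd f q u) x v) < e"
    using r2(2)[OF sub[OF p(1)]] p(1) by (auto simp: r_def dist_commute)
  moreover have "dist (fd (\<lambda>q. fd f q v) p' u) (fd (\<lambda>q. fd f q v) x u) < e"
    using r3(2)[OF sub[OF p'(1)]] p'(1) by (auto simp: r_def dist_commute)
  ultimately show False unfolding e_def dist_real_def by (auto simp: field_simps abs_if split: if_splits)
qed


lemma linear_axis_expansion:
  fixes f :: "real^'n \<Rightarrow> 'b::real_vector"
  assumes "linear f" shows "f v = (\<Sum>i\<in>UNIV. v $ i *\<^sub>R f (axis i 1))"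
proof -
  have "v = (\<Sum>i\<in>UNIV. v $ i *\<^sub>R axis i 1)"
    using basis_expansion[of v] by (simp add: scalar_mult_eq_scaleR)
  then have "f v = f (\<Sum>i\<in>UNIV. v $ i *\<^sub>R axis i 1)" by simp
  then show ?thesis using assms by (simp add: linear_sum linear_scale)
qed

lemma bounded_bilinear_matrix_vector_mult:
  "bounded_bilinear ((*v) :: real^'n^'m \<Rightarrow> real^'n \<Rightarrow> real^'m)"
  unfolding bilinear_conv_bounded_bilinear[symmetric] bilinear_def
  by (auto intro!: linearI simp: matrix_vector_mult_add_rdistrib matrix_vector_right_distrib
      matrix_vector_mult_scaleR scaleR_matrix_vector_assoc)

lemma inner_transpose_left:
  fixes A :: "real^'n^'m" shows "x \<bullet> (transpose A *v y) = (A *v x) \<bullet> y"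
  by (metis dot_lmul_matrix transpose_transpose vector_transpose_matrix)

section \<open>The Hamiltonian vector field in coordinates and the invariance of the symplectic
  form\<close>

locale hamiltonian_domain =
  fixes W :: "(real^'n) set" and w :: "real^'n \<Rightarrow> real^'n^'n" and h :: "real^'n \<Rightarrow> real"
  assumes open_W: "open W" and smooth_w: "smooth_on W w" and smooth_h: "smooth_on W h"
    and skew: "x \<in> W \<Longrightarrow> transpose (w x) = - w x"
    and nondegenerate: "x \<in> W \<Longrightarrow> det (w x) \<noteq> 0"
    and closed_form: "x \<in> W \<Longrightarrow> partial_deriv i (\<lambda>y. w y $ j $ k) x
                  + partial_deriv j (\<lambda>y. w y $ k $ i) x + partial_deriv k (\<lambda>y. w y $ i $ j) x = 0"
begin

definition X :: "real^'n \<Rightarrow> real^'n" where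
  "X x = cramer_solution (transpose (w x)) (\<chi> j. partial_deriv j h x)"

text \<open>The derivative as an element of the normed space of bounded linear maps, the form in
  which the variational equation is posed. It is meaningful on \<open>W\<close> only.\<close>

definition J :: "real^'n \<Rightarrow> ((real^'n) \<Rightarrow>\<^sub>L (real^'n))" where "J x = Blinfun (fd X x)"

lemma w_differentiable: "x \<in> W \<Longrightarrow> w differentiable (at x)"
  using smooth_w unfolding smooth_on_def by (metis C_on.simps(2))

lemma w_continuous: "continuous_on W w"
  using smooth_w unfolding smooth_on_def by (metis C_on.simps(1))

lemma fd_w_continuous: "continuous_on W (\<lambda>x. fd w x v)"
  using smooth_w unfolding smooth_on_def by (metis C_on.simps)

lemma h_C2: "C_on (Suc (Suc 0)) W h"
  using smooth_h unfolding smooth_on_def by blast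

lemma has_derivative_w_nth:
  assumes "x \<in> W" shows "((\<lambda>y. w y $ j $ k) has_derivative (\<lambda>v. fd w x v $ j $ k)) (at x)"
  using frechet_derivative_works[THEN iffD1, OF w_differentiable[OF assms]]
  by (intro bounded_linear.has_derivative[OF bounded_linear_vec_nth])

lemma fd_w_nth: "x \<in> W \<Longrightarrow> fd (\<lambda>y. w y $ j $ k) x v = fd w x v $ j $ k"
  using frechet_derivative_at[OF has_derivative_w_nth] by metis

lemma fd_w_skew:
  assumes "x \<in> W" shows "fd w x v $ k $ j = - fd w x v $ j $ k"
proof -
  have eq: "- w y $ j $ k = w y $ k $ j" if "y \<in> W" for y
    using arg_cong[OF skew[OF that], of "\<lambda>A. A $ j $ k"] by (simp add: transpose_def)
  have "((\<lambda>y. - w y $ j $ k) has_derivative (\<lambda>v. - fd w x v $ j $ k)) (at x)"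
    by (rule has_derivative_minus[OF has_derivative_w_nth[OF assms]])
  then have "((\<lambda>y. w y $ k $ j) has_derivative (\<lambda>v. - fd w x v $ j $ k)) (at x)"
    by (rule has_derivative_transform_within_open[OF _ open_W assms]) (use eq in auto)
  from has_derivative_unique[OF this has_derivative_w_nth[OF assms]] show ?thesis by metis
qed

lemma det_transpose_w: "x \<in> W \<Longrightarrow> det (transpose (w x)) \<noteq> 0"
  using nondegenerate by (simp add: det_transpose)

lemma transpose_mult_nth: "(u v* w x) $ j = (\<Sum>i\<in>UNIV. u $ i * w x $ i $ j)"
  by (simp add: vector_matrix_mult_def)

lemma X_unique:
  assumes "x \<in> W" "\<And>j. (\<Sum>i\<in>UNIV. u $ i * w x $ i $ j) = partial_deriv j h x"
  shows "u = X x"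
  unfolding X_def using assms
  by (subst cramer_solution_iff[symmetric, OF det_transpose_w]) (auto simp: vec_eq_iff transpose_mult_nth)

lemma X_eq:
  assumes "x \<in> W" shows "(\<Sum>i\<in>UNIV. X x $ i * w x $ i $ j) = partial_deriv j h x"
proof -
  have "transpose (w x) *v X x = (\<chi> j. partial_deriv j h x)"
    unfolding cramer_solution_iff[OF det_transpose_w[OF assms]] X_def ..
  from arg_cong[OF this, of "\<lambda>v. v $ j"] show ?thesis by (simp add: transpose_mult_nth)
qed

lemma partial_h_differentiable: "x \<in> W \<Longrightarrow> partial_deriv j h differentiable (at x)"
  using h_C2 unfolding partial_deriv_def[abs_def] by simp

lemma X_differentiable: "x \<in> W \<Longrightarrow> X differentiable (at x)"
  unfolding X_def[abs_def] using has_derivative_w_nth partial_h_differentiable det_transpose_w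
  by (intro differentiable_cramer_solution) (auto simp: transpose_def differentiable_def)

lemma X_has_derivative: "x \<in> W \<Longrightarrow> (X has_derivative fd X x) (at x)"
  using X_differentiable frechet_derivative_works by blast

text \<open>Differentiating \<open>X_eq\<close> shows that \<open>fd X x v\<close> solves a linear
  system with the same matrix as \<open>X\<close>. Cramer's formula therefore gives its continuity
  as well, without differentiating a quotient of determinants.\<close>

lemma fd_X_eq:
  assumes "x \<in> W"
  shows "(\<Sum>i\<in>UNIV. fd X x v $ i * w x $ i $ j) = fd (partial_deriv j h) x v - (\<Sum>i\<in>UNIV. X x $ i * fd w x v $ i $ j)"
proof -
  have "((\<lambda>x. X x $ i) has_derivative (\<lambda>v. fd X x v $ i)) (at x)" for i
    by (rule bounded_linear.has_derivative[OF bounded_linear_vec_nth X_has_derivative[OF assms]])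
  then have "((\<lambda>x. \<Sum>i\<in>UNIV. X x $ i * w x $ i $ j) has_derivative
      (\<lambda>v. \<Sum>i\<in>UNIV. X x $ i * fd w x v $ i $ j + fd X x v $ i * w x $ i $ j)) (at x)"
    by (intro has_derivative_sum has_derivative_mult has_derivative_w_nth assms)
  then have "(partial_deriv j h has_derivative
      (\<lambda>v. \<Sum>i\<in>UNIV. X x $ i * fd w x v $ i $ j + fd X x v $ i * w x $ i $ j)) (at x)"
    by (rule has_derivative_transform_within_open[OF _ open_W assms]) (use X_eq in auto)
  from fun_cong[OF frechet_derivative_at[OF this], of v] show ?thesis unfolding sum.distrib by linarith
qed

lemma X_continuous: "continuous_on W X"
  using X_has_derivative has_derivative_continuous continuous_at_imp_continuous_on by blast

lemma fd_X_continuous: "continuous_on W (\<lambda>x. fd X x v)"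
proof -
  let ?b = "\<lambda>x. \<chi> j. fd (partial_deriv j h) x v - (\<Sum>i\<in>UNIV. X x $ i * fd w x v $ i $ j)"
  have "fd X x v = cramer_solution (transpose (w x)) (?b x)" if "x \<in> W" for x
    by (subst cramer_solution_iff[symmetric, OF det_transpose_w[OF that]])
       (use fd_X_eq[OF that] in \<open>simp add: vec_eq_iff transpose_mult_nth\<close>)
  moreover have "continuous_on W (\<lambda>x. cramer_solution (transpose (w x)) (?b x))"
  proof (rule continuous_on_cramer_solution)
    show "continuous_on W (\<lambda>x. transpose (w x) $ i $ j)" for i j
      using w_continuous by (auto simp: transpose_def intro!: continuous_intros)
    have "continuous_on W (\<lambda>x. fd (partial_deriv j h) x v)" for j
      using h_C2 unfolding partial_deriv_def[abs_def] by simp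
    then show "continuous_on W (\<lambda>x. ?b x $ j)" for j
      using X_continuous fd_w_continuous by (auto intro!: continuous_intros)
  qed (use det_transpose_w in auto)
  ultimately show ?thesis by (metis (no_types, lifting) continuous_on_cong)
qed

lemma J_apply: "x \<in> W \<Longrightarrow> blinfun_apply (J x) = fd X x"
  unfolding J_def using X_has_derivative has_derivative_bounded_linear bounded_linear_Blinfun_apply by blast

lemma J_continuous: "continuous_on W J"
  by (rule continuous_on_blinfun_componentwise)
     (use fd_X_continuous J_apply in \<open>simp cong: continuous_on_cong\<close>)

text \<open>The Lie derivative of the form \<open>w\<close> along \<open>X\<close>, in coordinates.\<close>

lemma lie_derivative_zero:
  assumes "x \<in> W"
  shows "(\<Sum>i\<in>UNIV. X x $ i * fd w x (axis i 1) $ j $ k) + (\<Sum>i\<in>UNIV. fd X x (axis j 1) $ i * w x $ i $ k)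
    + (\<Sum>i\<in>UNIV. w x $ j $ i * fd X x (axis k 1) $ i) = 0"
proof -
  \<comment> \<open>Cartan's formula in coordinates: the part coming from \<open>d (dh)\<close>
    vanishes because the Hessian of \<open>h\<close> is symmetric, and what remains is the cyclic
    sum of \<open>closed_form\<close> contracted with \<open>X\<close>.\<close>
  have sym: "fd (partial_deriv k h) x (axis j 1) = fd (partial_deriv j h) x (axis k 1)"
    unfolding partial_deriv_def[abs_def] by (rule second_derivative_symmetric[OF open_W assms h_C2])
  have "w x $ j $ i = - w x $ i $ j" for i
    using arg_cong[OF skew[OF assms], of "\<lambda>A. A $ i $ j"] by (simp add: transpose_def)
  then have "(\<Sum>i\<in>UNIV. w x $ j $ i * fd X x (axis k 1) $ i) = - (\<Sum>i\<in>UNIV. fd X x (axis k 1) $ i * w x $ i $ j)"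
    by (simp add: sum_negf mult.commute)
  then have "?thesis \<longleftrightarrow> (\<Sum>i\<in>UNIV. X x $ i * fd w x (axis i 1) $ j $ k)
      - (\<Sum>i\<in>UNIV. X x $ i * fd w x (axis j 1) $ i $ k) + (\<Sum>i\<in>UNIV. X x $ i * fd w x (axis k 1) $ i $ j) = 0"
    using fd_X_eq[OF assms, of "axis j 1" k] fd_X_eq[OF assms, of "axis k 1" j] sym by linarith
  also have "\<dots> \<longleftrightarrow> (\<Sum>i\<in>UNIV. X x $ i * (fd w x (axis i 1) $ j $ k + fd w x (axis j 1) $ k $ i + fd w x (axis k 1) $ i $ j)) = 0"
    unfolding fd_w_skew[OF assms, of _ k] by (simp add: sum.distrib sum_subtractf distrib_left right_diff_distrib)
  also have "\<dots>"
    using closed_form[OF assms] by (simp add: partial_deriv_def fd_w_nth[OF assms])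
  finally show ?thesis by simp
qed

lemma lie_derivative_form_zero:
  assumes "x \<in> W"
  shows "fd X x u \<bullet> (w x *v v) + u \<bullet> (fd w x (X x) *v v) + u \<bullet> (w x *v fd X x v) = 0"
proof -
  define M where "M = matrix (fd X x)"
  have lin: "linear (fd X x)" "linear (fd w x)"
    using X_differentiable w_differentiable assms linear_frechet_derivative by blast+
  have M: "fd X x u = M *v u" for u unfolding M_def using lin by simp
  have "transpose M ** w x + fd w x (X x) + w x ** M = 0"
    using lie_derivative_zero[OF assms]
    by (simp add: vec_eq_iff matrix_matrix_mult_def transpose_def M_def matrix_def
        linear_axis_expansion[OF lin(2), of "X x"] add_ac)
  then have "u \<bullet> ((transpose M ** w x + fd w x (X x) + w x ** M) *v v) = 0" by simp
  moreover have "(M *v u) \<bullet> (w x *v v) = u \<bullet> (transpose M *v (w x *v v))"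
    by (rule inner_transpose_left[symmetric])
  ultimately show ?thesis unfolding M matrix_vector_mult_add_rdistrib inner_add_right matrix_vector_mul_assoc
    by (simp only:)
qed

text \<open>The linearized flow is symplectic: pairing two solutions of the variational equation by
  \<open>w\<close> has derivative zero along the trajectory. Hence
  \<open>P\<^sup>T w(y t) P = w(y 0)\<close> for the matrix \<open>P\<close> of \<open>Y t\<close>,
  and the claim is the square root of the determinants.\<close>

lemma jacobian_density:
  assumes Y0: "Y 0 = id_blinfun"
    and yW: "\<And>t. t \<in> {0..h'} \<Longrightarrow> y t \<in> W"
    and y: "\<And>t. t \<in> {0..h'} \<Longrightarrow> (y has_vector_derivative X (y t)) (at t within {0..h'})"
    and Y: "\<And>t. t \<in> {0..h'} \<Longrightarrow> (Y has_vector_derivative (J (y t) o\<^sub>L Y t)) (at t within {0..h'})"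
    and t: "t \<in> {0..h'}"
  shows "\<bar>det (matrix (blinfun_apply (Y t)))\<bar> * sqrt (det (w (y t))) = sqrt (det (w (y 0)))"
proof -
  have Yu: "((\<lambda>t. blinfun_apply (Y t) u) has_vector_derivative fd X (y t) (blinfun_apply (Y t) u)) (at t within {0..h'})"
    if "t \<in> {0..h'}" for t u
    using bounded_linear.has_vector_derivative[OF blinfun.bounded_linear_left Y[OF that], of u]
    by (simp add: J_apply[OF yW[OF that]])
  have wy: "((\<lambda>t. w (y t)) has_vector_derivative fd w (y t) (X (y t))) (at t within {0..h'})"
    if "t \<in> {0..h'}" for t
    using vector_derivative_diff_chain_within[OF y[OF that], of w "fd w (y t)"]
      frechet_derivative_works[THEN iffD1, OF w_differentiable[OF yW[OF that]]]
    by (auto simp: o_def intro: has_derivative_at_withinI)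
  have const: "(blinfun_apply (Y t) u) \<bullet> (w (y t) *v blinfun_apply (Y t) v) = u \<bullet> (w (y 0) *v v)" for u v
  proof -
    let ?q = "\<lambda>t. (blinfun_apply (Y t) u) \<bullet> (w (y t) *v blinfun_apply (Y t) v)"
    have "norm (?q t - ?q 0) \<le> 0 * \<bar>t - 0\<bar>"
    proof (rule vector_derivative_bound)
      fix s assume s: "s \<in> {0..h'}"
      let ?a = "blinfun_apply (Y s) u" and ?b = "blinfun_apply (Y s) v" and ?p = "y s"
      have "((\<lambda>t. w (y t) *v blinfun_apply (Y t) v) has_vector_derivative (w ?p *v fd X ?p ?b + fd w ?p (X ?p) *v ?b)) (at s within {0..h'})"
        by (rule bounded_bilinear.has_vector_derivative[OF bounded_bilinear_matrix_vector_mult wy[OF s] Yu[OF s]])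
      from bounded_bilinear.has_vector_derivative[OF bounded_bilinear_inner Yu[OF s, of u] this]
      show "(?q has_vector_derivative 0) (at s within {0..h'})"
        using lie_derivative_form_zero[OF yW[OF s], of ?a ?b] by (simp add: inner_add_right algebra_simps)
    qed (use t in auto)
    then show ?thesis by (simp add: Y0)
  qed
  define P where "P = matrix (blinfun_apply (Y t))"
  have P: "blinfun_apply (Y t) u = P *v u" for u
    unfolding P_def using blinfun.bounded_linear_right[of "Y t"] by simp
  have "transpose P ** w (y t) ** P = w (y 0)"
  proof (rule matrix_eq[THEN iffD2], rule allI, rule vector_eq_ldot[THEN iffD1], rule allI)
    fix v u
    show "u \<bullet> ((transpose P ** w (y t) ** P) *v v) = u \<bullet> (w (y 0) *v v)"
      using const[of u v] unfolding P
      by (simp only: matrix_vector_mul_assoc[symmetric] inner_transpose_left)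
  qed
  then have "det (w (y 0)) = det P * det (w (y t)) * det P"
    by (metis det_mul det_transpose)
  then have "det (w (y 0)) = (det P)\<^sup>2 * det (w (y t))"
    by (simp only: power2_eq_square ac_simps)
  then show ?thesis unfolding P_def[symmetric] by (simp only: real_sqrt_mult real_sqrt_abs)
qed

end

section \<open>Change of variables\<close>

text \<open>The change of variables theorem of the library requires a well-ordered index type.\<close>

typedef ('a::finite) ordered_index = "{..<CARD('a)}"
  morphisms nat_of_index index_of_nat
  by (rule exI[of _ 0]) auto

instance ordered_index :: (finite) finite
proof
  have "(UNIV :: 'a ordered_index set) = index_of_nat ` {..<CARD('a)}"
    by (rule type_definition.Abs_image[OF type_definition_ordered_index, symmetric])
  then show "finite (UNIV :: 'a ordered_index set)" by (metis finite_imageI finite_lessThan)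
qed

instantiation ordered_index :: (finite) wellorder
begin
definition less_eq_ordered_index where "(i :: 'a ordered_index) \<le> j \<longleftrightarrow> nat_of_index i \<le> nat_of_index j"
definition less_ordered_index where "(i :: 'a ordered_index) < j \<longleftrightarrow> nat_of_index i < nat_of_index j"
instance
proof
  fix P :: "'a ordered_index \<Rightarrow> bool" and a :: "'a ordered_index"
  assume *: "\<And>x. (\<And>y. y < x \<Longrightarrow> P y) \<Longrightarrow> P x"
  show "P a"
    by (induction a rule: measure_induct_rule[of nat_of_index]) (use * less_ordered_index_def in blast)
qed (auto simp: less_eq_ordered_index_def less_ordered_index_def nat_of_index_inject)
end

lemma ex_bij_ordered_index: "\<exists>f :: 'a::finite ordered_index \<Rightarrow> 'a. bij f"
proof -
  have "card (UNIV :: 'a ordered_index set) = CARD('a)"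
    by (simp add: type_definition.card[OF type_definition_ordered_index])
  then show ?thesis using finite_same_card_bij[of "UNIV :: 'a ordered_index set" "UNIV :: 'a set"] by auto
qed

text \<open>Conjugation with \<open>f\<close> is a sign-preserving bijection between the
  permutations of the two index types.\<close>

lemma det_reindex:
  fixes A :: "real^'n^'n" and f :: "'m::finite \<Rightarrow> 'n"
  assumes f: "bij f"
  shows "det (\<chi> i j. A $ f i $ f j) = det A"
proof -
  have inj: "inj f" using f bij_is_inj by blast
  have bf: "bij_betw f UNIV UNIV" and bi: "bij_betw (inv f) UNIV UNIV"
    using f bij_imp_bij_inv by auto
  let ?F = "map_permutation UNIV f" and ?G = "map_permutation UNIV (inv f)"
  show ?thesis unfolding det_def
  proof (rule sum.reindex_bij_witness[of _ ?G ?F])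
    fix p assume "p \<in> {p. p permutes (UNIV :: 'm set)}"
    then have p: "p permutes UNIV" by simp
    show "?G (?F p) = p" using map_permutation_compose_inv[OF bf p] inj by simp
    show "?F p \<in> {p. p permutes UNIV}" using map_permutation_permutes[OF bf p] by simp
    have "(\<Prod>i\<in>UNIV. A $ i $ ?F p i) = (\<Prod>i\<in>UNIV. A $ f i $ ?F p (f i))"
      using prod.reindex_bij_betw[OF bf, of "\<lambda>i. A $ i $ ?F p i"] by simp
    then show "of_int (sign (?F p)) * (\<Prod>i\<in>UNIV. A $ i $ ?F p i)
      = of_int (sign p) * (\<Prod>i\<in>UNIV. (\<chi> i j. A $ f i $ f j) $ i $ p i)"
      using sign_map_permutation[OF inj p] by (simp add: map_permutation_apply[OF inj])
  next
    fix p assume "p \<in> {p. p permutes (UNIV :: 'n set)}"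
    then have p: "p permutes UNIV" by simp
    show "?F (?G p) = p" using map_permutation_compose_inv[OF bi p] f by (simp add: bij_is_surj surj_f_inv_f)
    show "?G p \<in> {p. p permutes UNIV}" using map_permutation_permutes[OF bi p] by simp
  qed
qed

definition reindex :: "('m \<Rightarrow> 'n) \<Rightarrow> real^'n \<Rightarrow> real^'m" where
  "reindex f x = (\<chi> i. x $ f i)"

lemma reindex_nth [simp]: "reindex f x $ i = x $ f i"
  by (simp add: reindex_def)

lemma linear_reindex: "linear (reindex f)"
  by (rule linearI) (auto simp: vec_eq_iff)

lemma bounded_linear_reindex: "bounded_linear (reindex f)"
  using linear_reindex linear_conv_bounded_linear by blast

lemma reindex_measurable [measurable]: "reindex f \<in> borel_measurable borel"
  by (intro borel_measurable_continuous_onI linear_continuous_on bounded_linear_reindex)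

lemma reindex_inverse:
  assumes "bij f"
  shows "reindex f (reindex (inv f) x) = x" "reindex (inv f) (reindex f y) = y"
  using assms by (auto simp: vec_eq_iff bij_is_inj bij_is_surj surj_f_inv_f)

lemma prod_Basis_vec:
  fixes x :: "real^'n" shows "(\<Prod>b\<in>Basis. x \<bullet> b) = (\<Prod>i\<in>UNIV. x $ i)"
proof -
  have B: "(Basis :: (real^'n) set) = range (\<lambda>i. axis i 1)" by (auto simp: Basis_vec_def)
  have inj: "inj (\<lambda>i::'n. axis i (1::real))" by (auto simp: inj_on_def axis_eq_axis)
  show ?thesis unfolding B prod.reindex[OF inj] by (simp add: inner_axis)
qed

lemma distr_lborel_reindex:
  fixes f :: "'m::finite \<Rightarrow> 'n::finite"
  assumes f: "bij f"
  shows "distr lborel borel (reindex f) = lborel"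
proof (rule lborel_eqI[symmetric])
  fix l u :: "real^'m"
  assume lu: "\<And>b. b \<in> Basis \<Longrightarrow> l \<bullet> b \<le> u \<bullet> b"
  let ?l = "reindex (inv f) l" and ?u = "reindex (inv f) u"
  have le: "l $ i \<le> u $ i" for i
    using lu[of "axis i 1"] by (simp add: inner_axis)
  have "(\<forall>i. l $ i < x $ f i \<and> x $ f i < u $ i) \<longleftrightarrow> (\<forall>i. ?l $ i < x $ i \<and> x $ i < ?u $ i)" for x :: "real^'n"
    using f by (metis bij_inv_eq_iff reindex_nth)
  then have "reindex f -` box l u = box ?l ?u"
    by (auto simp: mem_box_cart)
  then have "emeasure (distr lborel borel (reindex f)) (box l u) = emeasure lborel (box ?l ?u)"
    by (subst emeasure_distr) auto
  also have "\<dots> = ennreal (\<Prod>b\<in>Basis. (?u - ?l) \<bullet> b)"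
    by (rule emeasure_lborel_box) (use le in \<open>auto simp: Basis_vec_def inner_axis\<close>)
  also have "(\<Prod>b\<in>Basis. (?u - ?l) \<bullet> b) = (\<Prod>i\<in>UNIV. (u - l) $ (inv f i))"
    unfolding prod_Basis_vec by simp
  also have "\<dots> = (\<Prod>i\<in>UNIV. (u - l) $ i)"
    using prod.reindex_bij_betw[of "inv f" UNIV UNIV "\<lambda>i. (u - l) $ i"] f bij_imp_bij_inv by auto
  also have "\<dots> = (\<Prod>b\<in>Basis. (u - l) \<bullet> b)" unfolding prod_Basis_vec ..
  finally show "emeasure (distr lborel borel (reindex f)) (box l u) = ennreal (\<Prod>b\<in>Basis. (u - l) \<bullet> b)" .
qed simp

lemma nn_integral_reindex:
  fixes f :: "'m::finite \<Rightarrow> 'n::finite" and F :: "real^'n \<Rightarrow> ennreal"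
  assumes "bij f" and F[measurable]: "F \<in> borel_measurable borel"
  shows "(\<integral>\<^sup>+y. F (reindex (inv f) y) \<partial>lborel) = (\<integral>\<^sup>+x. F x \<partial>lborel)"
proof -
  have "(\<integral>\<^sup>+y. F (reindex (inv f) y) \<partial>distr lborel borel (reindex f)) = (\<integral>\<^sup>+x. F (reindex (inv f) (reindex f x)) \<partial>lborel)"
    by (rule nn_integral_distr) auto
  then show ?thesis using assms by (simp add: distr_lborel_reindex reindex_inverse)
qed

lemma nn_integral_change_of_variables_wellorder:
  fixes g :: "real^'m::{finite,wellorder} \<Rightarrow> real^'m::_" and \<rho> :: "real^'m::_ \<Rightarrow> real"
  assumes S: "S \<in> sets borel"
    and der: "\<And>x. x \<in> S \<Longrightarrow> (g has_derivative g' x) (at x within S)" and inj: "inj_on g S"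
    and nonneg: "\<And>x. x \<in> g ` S \<Longrightarrow> 0 \<le> \<rho> x"
    and meas: "(\<lambda>x. indicator S x * (\<bar>det (matrix (g' x))\<bar> * \<rho> (g x))) \<in> borel_measurable borel"
    and fin: "(\<integral>\<^sup>+x. ennreal (indicator S x * (\<bar>det (matrix (g' x))\<bar> * \<rho> (g x))) \<partial>lborel) < \<infinity>"
  shows "(\<integral>\<^sup>+x. ennreal (indicator (g ` S) x * \<rho> x) \<partial>lborel)
    = (\<integral>\<^sup>+x. ennreal (indicator S x * (\<bar>det (matrix (g' x))\<bar> * \<rho> (g x))) \<partial>lborel)"
proof -
  let ?F = "\<lambda>x. \<bar>det (matrix (g' x))\<bar> * \<rho> (g x)"
  \<comment> \<open>The change of variables theorem applied below concerns vector-valued integrands,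
    so the density is regarded as a map into \<open>real^1\<close>.\<close>
  define V :: "real^'m::_ \<Rightarrow> real^1" where "V x = vec (\<rho> x)" for x
  have "integrable lborel (\<lambda>x. indicator S x * ?F x)"
  proof (rule integrableI_nonneg)
    show "AE x in lborel. 0 \<le> indicator S x * ?F x"
      by (rule AE_I2) (use nonneg in \<open>auto simp: indicator_def\<close>)
  qed (use meas fin in auto)
  then have "integrable lebesgue (\<lambda>x. indicator S x * ?F x)"
    using meas by (simp add: integrable_completion)
  then have ai: "?F absolutely_integrable_on S" by (simp add: set_integrable_def)
  have eqV: "(\<lambda>x. \<bar>det (matrix (g' x))\<bar> *\<^sub>R V (g x)) = (\<lambda>x. vec (?F x))"
    by (auto simp: V_def vec_eq_iff)
  have bl: "bounded_linear (vec :: real \<Rightarrow> real^1)"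
    unfolding linear_conv_bounded_linear[symmetric] by (rule linearI) (auto simp: vec_eq_iff)
  have bl1: "bounded_linear (\<lambda>v::real^1. v $ 1)" by (rule bounded_linear_vec_nth)
  have aiV: "(\<lambda>x. vec (?F x) :: real^1) absolutely_integrable_on S"
    using absolutely_integrable_linear[OF ai bl] by (simp add: o_def)
  from has_absolute_integral_change_of_variables[OF _ der inj, of V "integral S (\<lambda>x. vec (?F x))"]
  have "V absolutely_integrable_on g ` S" "integral (g ` S) V = integral S (\<lambda>x. vec (?F x))"
    using aiV S unfolding eqV by auto
  then have "(V has_integral integral S (\<lambda>x. vec (?F x))) (g ` S)"
    using integrable_integral[OF set_lebesgue_integral_eq_integral(1)] by metis
  from has_integral_linear[OF this bl1]
  have 1: "(\<rho> has_integral (integral S (\<lambda>x. vec (?F x) :: real^1)) $ 1) (g ` S)"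
    by (simp add: o_def V_def)
  have "((\<lambda>x. vec (?F x) :: real^1) has_integral integral S (\<lambda>x. vec (?F x))) S"
    by (rule integrable_integral[OF set_lebesgue_integral_eq_integral(1)[OF aiV]])
  from has_integral_linear[OF this bl1]
  have 2: "(?F has_integral (integral S (\<lambda>x. vec (?F x) :: real^1)) $ 1) S"
    by (simp add: o_def)
  show ?thesis
    using nn_integral_has_integral_lebesgue[OF _ 1] nn_integral_has_integral_lebesgue[OF _ 2] nonneg
    by auto
qed

text \<open>Conjugation with the renaming \<open>reindex f\<close> of coordinates carries
  \<open>g\<close> to a map over an index type with a well-order. Renaming preserves Lebesgue
  measure, Borel sets and the Jacobian determinant.\<close>

lemma nn_integral_change_of_variables:
  fixes g :: "real^'n \<Rightarrow> real^'n" and \<rho> :: "real^'n \<Rightarrow> real"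
  assumes S: "S \<in> sets borel"
    and der: "\<And>x. x \<in> S \<Longrightarrow> (g has_derivative g' x) (at x within S)" and inj: "inj_on g S"
    and nonneg: "\<And>x. x \<in> g ` S \<Longrightarrow> 0 \<le> \<rho> x"
    and meas': "(\<lambda>x. indicator (g ` S) x * \<rho> x) \<in> borel_measurable borel"
    and meas: "(\<lambda>x. indicator S x * (\<bar>det (matrix (g' x))\<bar> * \<rho> (g x))) \<in> borel_measurable borel"
    and fin: "(\<integral>\<^sup>+x. ennreal (indicator S x * (\<bar>det (matrix (g' x))\<bar> * \<rho> (g x))) \<partial>lborel) < \<infinity>"
  shows "(\<integral>\<^sup>+x. ennreal (indicator (g ` S) x * \<rho> x) \<partial>lborel)
    = (\<integral>\<^sup>+x. ennreal (indicator S x * (\<bar>det (matrix (g' x))\<bar> * \<rho> (g x))) \<partial>lborel)"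
proof -
  obtain f :: "'n ordered_index \<Rightarrow> 'n" where f: "bij f" using ex_bij_ordered_index by blast
  let ?R = "reindex f" and ?I = "reindex (inv f)"
  note RI = reindex_inverse[OF f]
  define S' where "S' = ?R ` S"
  define G where "G y = ?R (g (?I y))" for y
  define G' where "G' y = (\<lambda>v. ?R (g' (?I y) (?I v)))" for y
  have mem: "y \<in> S' \<longleftrightarrow> ?I y \<in> S" for y unfolding S'_def
    by (auto simp: RI intro!: image_eqI[of y ?R "?I y"])
  then have S'_eq: "S' = ?I -` S" by auto
  have memG: "y \<in> G ` S' \<longleftrightarrow> ?I y \<in> g ` S" for y
  proof -
    have "G ` S' = ?R ` (g ` S)" by (simp add: S'_def G_def image_image RI)
    show ?thesis
    proof
      assume "y \<in> G ` S'"
      then obtain x where "x \<in> S" "y = ?R (g x)" using \<open>G ` S' = _\<close> by auto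
      then show "?I y \<in> g ` S" by (simp add: RI(2))
    next
      assume "?I y \<in> g ` S"
      then have "?R (?I y) \<in> ?R ` (g ` S)" by (rule imageI)
      then show "y \<in> G ` S'" using \<open>G ` S' = _\<close> by (simp add: RI(1))
    qed
  qed
  have S'_sets: "S' \<in> sets borel"
    using measurable_sets[OF reindex_measurable[of "inv f"], of S] S by (simp add: S'_eq)
  have der': "(G has_derivative G' y) (at y within S')" if "y \<in> S'" for y
  proof -
    have *: "(g has_derivative g' (?I y)) (at (?I y) within ?I ` S')"
      using der[of "?I y"] that has_derivative_subset[of g _ _ S "?I ` S'"] mem by auto
    have "((\<lambda>y. g (?I y)) has_derivative (\<lambda>v. g' (?I y) (?I v))) (at y within S')"
      using diff_chain_within[OF bounded_linear_imp_has_derivative[OF bounded_linear_reindex] *]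
      by (simp add: o_def)
    then show ?thesis unfolding G_def G'_def
      by (rule bounded_linear.has_derivative[OF bounded_linear_reindex])
  qed
  have inj': "inj_on G S'"
    unfolding G_def using inj mem by (auto simp: inj_on_def) (metis RI)
  have det_eq: "det (matrix (G' y)) = det (matrix (g' (?I y)))" for y
  proof -
    have ax: "?I (axis j 1) = axis (f j) 1" for j
      by (simp add: vec_eq_iff axis_def) (metis f bij_inv_eq_iff)
    then have "matrix (G' y) = (\<chi> i j. matrix (g' (?I y)) $ f i $ f j)"
      by (simp add: matrix_def G'_def vec_eq_iff ax)
    then show ?thesis by (simp add: det_reindex[OF f])
  qed
  let ?F = "\<lambda>x. indicator S x * (\<bar>det (matrix (g' x))\<bar> * \<rho> (g x))"
  have Feq: "indicator S' y * (\<bar>det (matrix (G' y))\<bar> * \<rho> (?I (G y))) = ?F (?I y)" for y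
    by (simp add: det_eq G_def RI indicator_def mem)
  have "(\<integral>\<^sup>+x. ennreal (indicator (g ` S) x * \<rho> x) \<partial>lborel)
      = (\<integral>\<^sup>+y. ennreal (indicator (g ` S) (?I y) * \<rho> (?I y)) \<partial>lborel)"
    using meas' by (subst nn_integral_reindex[OF f]) auto
  also have "\<dots> = (\<integral>\<^sup>+y. ennreal (indicator (G ` S') y * \<rho> (?I y)) \<partial>lborel)"
    by (simp add: indicator_def memG)
  also have "\<dots> = (\<integral>\<^sup>+y. ennreal (indicator S' y * (\<bar>det (matrix (G' y))\<bar> * \<rho> (?I (G y)))) \<partial>lborel)"
  proof (rule nn_integral_change_of_variables_wellorder[OF S'_sets der' inj'])
    show "0 \<le> \<rho> (?I y)" if "y \<in> G ` S'" for y using that memG nonneg by blast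
    show "(\<lambda>y. indicator S' y * (\<bar>det (matrix (G' y))\<bar> * \<rho> (?I (G y)))) \<in> borel_measurable borel"
      unfolding Feq using measurable_compose[OF reindex_measurable meas] .
    show "(\<integral>\<^sup>+y. ennreal (indicator S' y * (\<bar>det (matrix (G' y))\<bar> * \<rho> (?I (G y)))) \<partial>lborel) < \<infinity>"
      unfolding Feq using meas fin by (subst nn_integral_reindex[OF f, of "\<lambda>x. ennreal (?F x)"]) auto
  qed
  also have "\<dots> = (\<integral>\<^sup>+x. ennreal (?F x) \<partial>lborel)"
    unfolding Feq using meas by (subst nn_integral_reindex[OF f, of "\<lambda>x. ennreal (?F x)"]) auto
  finally show ?thesis .
qed

section \<open>Flows on manifolds and conservation of volume\<close>

lemma borel_preimage_continuous_on:
  assumes "continuous_on S f" "S \<in> sets borel" "E \<in> sets borel"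
  shows "S \<inter> f -` E \<in> sets borel"
proof -
  have "f \<in> borel_measurable (restrict_space borel S)"
    using assms(1) by (rule borel_measurable_continuous_on_restrict)
  from measurable_sets[OF this assms(3)] show ?thesis
    using assms(2) by (simp add: sets_restrict_space_iff space_restrict_space Int_commute)
qed

text \<open>Nothing but individual solution curves of a C^1 vector field is given; uniqueness, the
  group law and continuity in the initial point are proved. The locale does not refer to a
  Hamiltonian, so that the negated vector field with reversed time is again an instance.\<close>

locale chart_flow =
  fixes atlas :: "('m::{second_countable_topology, t2_space}, 'n::finite) chart set"
    and X :: "('m, 'n) chart \<Rightarrow> real^'n \<Rightarrow> real^'n"
    and J :: "('m, 'n) chart \<Rightarrow> real^'n \<Rightarrow> (real^'n) \<Rightarrow>\<^sub>L (real^'n)"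
    and \<gamma> :: "'m \<Rightarrow> real \<Rightarrow> 'm"
  assumes atlas: "smooth_atlas atlas"
    and X_derivative: "c \<in> atlas \<Longrightarrow> x \<in> chart_range c \<Longrightarrow> (X c has_derivative blinfun_apply (J c x)) (at x)"
    and J_continuous: "c \<in> atlas \<Longrightarrow> continuous_on (chart_range c) (J c)"
    and \<gamma>_0 [simp]: "\<gamma> m 0 = m"
    and \<gamma>_path: "continuous_on UNIV (\<gamma> m)"
    and \<gamma>_derivative: "c \<in> atlas \<Longrightarrow> \<gamma> m t \<in> fst c \<Longrightarrow>
      ((\<lambda>s. snd c (\<gamma> m s)) has_vector_derivative X c (snd c (\<gamma> m t))) (at t)"
begin

lemma chart_exists: obtains c where "c \<in> atlas" "m \<in> fst c"
  using atlas unfolding smooth_atlas_def by blast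

lemma chart:
  assumes "c \<in> atlas"
  shows "open (fst c)" "open (chart_range c)" "homeomorphism (fst c) (chart_range c) (snd c) (chart_inv c)"
  using atlas assms unfolding smooth_atlas_def by blast+

lemma chart_simps:
  assumes "c \<in> atlas"
  shows "m \<in> fst c \<Longrightarrow> chart_inv c (snd c m) = m" "m \<in> fst c \<Longrightarrow> snd c m \<in> chart_range c"
    "x \<in> chart_range c \<Longrightarrow> snd c (chart_inv c x) = x" "x \<in> chart_range c \<Longrightarrow> chart_inv c x \<in> fst c"
    "continuous_on (fst c) (snd c)" "continuous_on (chart_range c) (chart_inv c)"
  using chart(3)[OF assms] unfolding homeomorphism_def by auto

lemma chart_image_borel:
  assumes "c \<in> atlas" "E \<in> sets borel" "E \<subseteq> fst c" shows "snd c ` E \<in> sets borel"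
proof -
  have "snd c ` E = chart_range c \<inter> chart_inv c -` E"
    using chart_simps[OF assms(1)] assms(3) by (auto intro!: image_eqI[of _ "snd c"])
  then show ?thesis
    using borel_preimage_continuous_on[OF chart_simps(6)[OF assms(1)] _ assms(2)] chart(2)[OF assms(1)] by simp
qed

text \<open>Before the group law is known, time shifts of \<open>\<gamma> m\<close> are not known to
  belong to the family \<open>\<gamma>\<close>; hence a notion for arbitrary solution
  curves.\<close>

definition integral_curve :: "(real \<Rightarrow> 'm) \<Rightarrow> bool" where
  "integral_curve g \<longleftrightarrow> continuous_on UNIV g \<and> (\<forall>c\<in>atlas. \<forall>t. g t \<in> fst c \<longrightarrow>
     ((\<lambda>s. snd c (g s)) has_vector_derivative X c (snd c (g t))) (at t))"

lemma integral_curve_\<gamma>: "integral_curve (\<gamma> m)"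
  unfolding integral_curve_def using \<gamma>_path \<gamma>_derivative by blast

lemma integral_curve_shift:
  assumes "integral_curve g" shows "integral_curve (\<lambda>t. g (a + t))"
  unfolding integral_curve_def
proof (intro conjI ballI allI impI)
  show "continuous_on UNIV (\<lambda>t. g (a + t))"
    using assms unfolding integral_curve_def
    by (intro continuous_on_compose2[of UNIV g UNIV "\<lambda>t. a + t"] continuous_intros) auto
  fix c t assume "c \<in> atlas" "g (a + t) \<in> fst c"
  then have "((\<lambda>s. snd c (g s)) has_vector_derivative X c (snd c (g (a + t)))) (at (a + t))"
    using assms unfolding integral_curve_def by blast
  moreover have "((\<lambda>t. a + t) has_vector_derivative 1) (at t)"
    by (auto intro!: derivative_eq_intros)
  ultimately show "((\<lambda>s. snd c (g (a + s))) has_vector_derivative X c (snd c (g (a + t)))) (at t)"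
    using vector_diff_chain_at[of "\<lambda>t. a + t" 1 t "\<lambda>s. snd c (g s)"] by (simp add: o_def)
qed

text \<open>No integral curve starting in \<open>ball x0 r\<close> leaves \<open>ball x0 (2 * r)\<close> within time \<open>h\<close>.\<close>

definition flow_box :: "('m, 'n) chart \<Rightarrow> real^'n \<Rightarrow> real \<Rightarrow> real \<Rightarrow> real \<Rightarrow> real \<Rightarrow> bool" where
  "flow_box c x0 r h L B \<longleftrightarrow> c \<in> atlas \<and> r > 0 \<and> h > 0 \<and> L \<ge> 0 \<and> B \<ge> 0 \<and> h * L \<le> 1/2 \<and> h * B \<le> r / 2 \<and>
     cball x0 (2 * r) \<subseteq> chart_range c \<and> (\<forall>p\<in>cball x0 (2 * r). norm (J c p) \<le> L \<and> norm (X c p) \<le> B)"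

definition chart_ball :: "('m, 'n) chart \<Rightarrow> real^'n \<Rightarrow> real \<Rightarrow> 'm set" where
  "chart_ball c x0 r = {m \<in> fst c. snd c m \<in> ball x0 r}"

lemma open_chart_ball:
  assumes "c \<in> atlas" shows "open (chart_ball c x0 r)"
proof -
  have "open (fst c \<inter> snd c -` ball x0 r)"
    using chart_simps(5)[OF assms] chart(1)[OF assms] by (simp add: continuous_on_open_vimage[THEN iffD1] continuous_open_preimage)
  moreover have "chart_ball c x0 r = fst c \<inter> snd c -` ball x0 r" by (auto simp: chart_ball_def)
  ultimately show ?thesis by simp
qed

section \<open>Short-time estimates in flow boxes, uniqueness and the group law\<close>

lemma flow_box_exists:
  obtains c r h L B where "flow_box c (snd c m) r h L B" "m \<in> chart_ball c (snd c m) r"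
proof -
  obtain c where c: "c \<in> atlas" "m \<in> fst c" using chart_exists by blast
  let ?x = "snd c m"
  have "?x \<in> chart_range c" using chart_simps(2)[OF c] .
  then obtain e where e: "e > 0" "cball ?x e \<subseteq> chart_range c"
    using chart(2)[OF c(1)] open_contains_cball by blast
  define r where "r = e / 2"
  have r: "r > 0" "cball ?x (2 * r) \<subseteq> chart_range c" using e by (auto simp: r_def)
  let ?Q = "cball ?x (2 * r)"
  have "continuous_on (chart_range c) (X c)"
    using X_derivative[OF c(1)] has_derivative_continuous continuous_at_imp_continuous_on by blast
  then have "bounded (X c ` ?Q)" "bounded (J c ` ?Q)"
    using J_continuous[OF c(1)] continuous_on_subset[OF _ r(2)]
    by (auto intro!: compact_imp_bounded compact_continuous_image)
  then obtain B L where BL: "B > 0" "L > 0" "\<And>p. p \<in> ?Q \<Longrightarrow> norm (X c p) \<le> B" "\<And>p. p \<in> ?Q \<Longrightarrow> norm (J c p) \<le> L"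
    unfolding bounded_pos by auto
  \<comment> \<open>The two terms are the largest times allowed by \<open>h * L \<le> 1/2\<close>
    (Lipschitz estimates) and \<open>h * B \<le> r / 2\<close> (confinement).\<close>
  define h where "h = min (1 / (2 * L)) (r / (2 * B))"
  have "h > 0" using BL r by (simp add: h_def)
  moreover have "h * L \<le> 1 / (2 * L) * L" "h * B \<le> r / (2 * B) * B"
    using BL unfolding h_def by (intro mult_right_mono; simp)+
  then have "h * L \<le> 1 / 2" "h * B \<le> r / 2" using BL by simp_all
  ultimately have "flow_box c ?x r h L B"
    unfolding flow_box_def using c r BL by (auto simp: less_imp_le)
  then show ?thesis using that c r by (auto simp: chart_ball_def)
qed

text \<open>A first exit time \<open>t1\<close> is impossible: until then the speed is at most
  \<open>B\<close>, so the curve moves by at most \<open>r / 2\<close> and stays in the preimage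
  \<open>?Q\<close> of the closed ball of radius \<open>3/2 * r\<close>. As a compact set in a
  Hausdorff space, \<open>?Q\<close> is closed and contains the exit point too. The argument takes
  place in the manifold, because a curve leaving the chart domain is invisible in
  coordinates.\<close>

lemma flow_box_invariant:
  assumes box: "flow_box c x0 r h L B" and g: "integral_curve g" and g0: "g 0 \<in> chart_ball c x0 r"
    and t: "t \<in> {0..h}"
  shows "g t \<in> chart_ball c x0 (2 * r)"
proof (rule ccontr)
  assume neg: "g t \<notin> chart_ball c x0 (2 * r)"
  have c: "c \<in> atlas" and r: "r > 0" and B: "B \<ge> 0" "h * B \<le> r / 2" and sub: "cball x0 (2 * r) \<subseteq> chart_range c"
    and XB: "\<And>p. p \<in> cball x0 (2 * r) \<Longrightarrow> norm (X c p) \<le> B"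
    using box by (auto simp: flow_box_def)
  let ?V = "chart_ball c x0 (2 * r)"
  let ?Q = "chart_inv c ` cball x0 (3/2 * r)"
  have sub': "cball x0 (3/2 * r) \<subseteq> chart_range c" using sub r by (auto intro: order_trans)
  have contg: "continuous_on UNIV g" using g by (simp add: integral_curve_def)
  have "closed ?Q"
    by (intro compact_imp_closed compact_continuous_image continuous_on_subset[OF chart_simps(6)[OF c] sub']) simp
  have Q_sub: "?Q \<subseteq> ?V"
    using chart_simps[OF c] sub' r by (auto simp: chart_ball_def dist_commute subset_iff)
  have Z_eq: "{s \<in> {0..h}. g s \<notin> ?V} = {0..h} \<inter> g -` (- ?V)" by auto
  have "compact {s \<in> {0..h}. g s \<notin> ?V}" unfolding Z_eq
    by (rule compact_Int_closed[OF compact_Icc])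
       (use continuous_closed_preimage[OF contg] open_chart_ball[OF c] in \<open>auto simp: closed_Compl\<close>)
  moreover have "{s \<in> {0..h}. g s \<notin> ?V} \<noteq> {}" using neg t by blast
  ultimately obtain t1 where t1: "t1 \<in> {0..h}" "g t1 \<notin> ?V"
    and min: "\<And>s. s \<in> {0..h} \<Longrightarrow> g s \<notin> ?V \<Longrightarrow> t1 \<le> s"
    using compact_attains_inf[of "{s \<in> {0..h}. g s \<notin> ?V}"] by auto
  have before: "g s \<in> ?V" if "0 \<le> s" "s < t1" for s using min[of s] that t1 by force
  have "chart_ball c x0 r \<subseteq> ?V" using r by (auto simp: chart_ball_def)
  then have "t1 > 0" using t1 g0 by (cases "t1 = 0") auto
  have "g s \<in> ?Q" if s: "0 \<le> s" "s < t1" for s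
  proof -
    let ?y = "\<lambda>s. snd c (g s)"
    have "norm (?y s - ?y 0) \<le> B * \<bar>s - 0\<bar>"
    proof (rule vector_derivative_bound)
      fix u assume u: "u \<in> {0..s}"
      then have gu: "g u \<in> ?V" using before s by auto
      then show "(?y has_vector_derivative X c (?y u)) (at u within {0..s})"
        using g c unfolding integral_curve_def chart_ball_def by (auto intro: has_vector_derivative_at_within)
      show "norm (X c (?y u)) \<le> B" using gu by (auto intro: XB simp: chart_ball_def)
    qed (use s in auto)
    also have "B * \<bar>s - 0\<bar> \<le> h * B" using s t1 B by (auto simp: mult.commute intro!: mult_left_mono)
    also have "\<dots> \<le> r / 2" by (rule B)
    finally have "dist (?y s) (?y 0) \<le> r / 2" by (simp add: dist_norm)
    moreover have "dist x0 (?y 0) < r" using g0 by (simp add: chart_ball_def)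
    ultimately have "?y s \<in> cball x0 (3/2 * r)"
      using dist_triangle[of x0 "?y s" "?y 0"] by (auto simp: dist_commute)
    moreover have "g s \<in> fst c" using before[OF s] by (simp add: chart_ball_def)
    ultimately show ?thesis using chart_simps(1)[OF c] by (metis image_eqI)
  qed
  then have "{0..<t1} \<subseteq> g -` ?Q" by auto
  moreover have "closed (g -` ?Q)"
    using continuous_closed_preimage[OF contg closed_UNIV \<open>closed ?Q\<close>] by simp
  ultimately have "closure {0..<t1} \<subseteq> g -` ?Q" by (simp add: closure_minimal)
  moreover have "t1 \<in> closure {0..<t1}" using \<open>t1 > 0\<close> by simp
  ultimately have "g t1 \<in> ?Q" by blast
  then show False using Q_sub t1 by auto
qed

lemma flow_box_coordinates:
  assumes box: "flow_box c x0 r h L B" and g: "integral_curve g" and g0: "g 0 \<in> chart_ball c x0 r"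
    and t: "t \<in> {0..h}"
  shows "((\<lambda>s. snd c (g s)) has_vector_derivative X c (snd c (g t))) (at t within {0..h})"
    "snd c (g t) \<in> cball x0 (2 * r)" "g t \<in> fst c"
  using flow_box_invariant[OF assms] g box unfolding integral_curve_def flow_box_def chart_ball_def
  by (auto intro: has_vector_derivative_at_within)

lemma flow_box_lipschitz:
  assumes box: "flow_box c x0 r h L B" and g: "integral_curve g1" "integral_curve g2"
    and g0: "g1 0 \<in> chart_ball c x0 r" "g2 0 \<in> chart_ball c x0 r" and t: "t \<in> {0..h}"
  shows "norm (snd c (g2 t) - snd c (g1 t)) \<le> 2 * norm (snd c (g2 0) - snd c (g1 0))"
proof -
  let ?z = "\<lambda>t. snd c (g2 t) - snd c (g1 t)"
  have "norm (?z t) \<le> 2 * (norm (?z 0) + h * 0)"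
  proof (rule short_time_bound[where L = L and z' = "\<lambda>t. X c (snd c (g2 t)) - X c (snd c (g1 t))"])
    fix s assume s: "s \<in> {0..h}"
    note 1 = flow_box_coordinates[OF box g(1) g0(1) s] and 2 = flow_box_coordinates[OF box g(2) g0(2) s]
    show "(?z has_vector_derivative X c (snd c (g2 s)) - X c (snd c (g1 s))) (at s within {0..h})"
      by (intro has_vector_derivative_diff 1 2)
    have c: "c \<in> atlas" and sub: "cball x0 (2 * r) \<subseteq> chart_range c" using box by (auto simp: flow_box_def)
    have "norm (X c (snd c (g2 s)) - X c (snd c (g1 s))) \<le> L * norm (snd c (g2 s) - snd c (g1 s))"
    proof (rule differentiable_bound[where S = "cball x0 (2 * r)" and f' = "\<lambda>p. blinfun_apply (J c p)"])
      show "(X c has_derivative blinfun_apply (J c p)) (at p within cball x0 (2 * r))" if "p \<in> cball x0 (2 * r)" for p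
        using X_derivative[OF c subsetD[OF sub that]] by (rule has_derivative_at_withinI)
      show "onorm (blinfun_apply (J c p)) \<le> L" if "p \<in> cball x0 (2 * r)" for p
        using that box by (auto simp: flow_box_def norm_blinfun.rep_eq)
    qed (use 1 2 in auto)
    then show "norm (X c (snd c (g2 s)) - X c (snd c (g1 s))) \<le> L * norm (?z s) + 0" by simp
  qed (use box t in \<open>auto simp: flow_box_def\<close>)
  then show ?thesis by simp
qed

lemma curve_near:
  fixes g :: "real \<Rightarrow> 'm"
  assumes "continuous_on UNIV g" "open U" "g x \<in> U"
  obtains d where "d > 0" "\<And>a. \<bar>a - x\<bar> < d \<Longrightarrow> g a \<in> U"
proof -
  have "open (g -` U)" using assms by (simp add: open_vimage)
  then obtain d where "d > 0" "\<And>a. dist a x < d \<Longrightarrow> a \<in> g -` U"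
    using assms(3) unfolding open_dist by auto
  then show ?thesis using that by (auto simp: dist_real_def)
qed

text \<open>Bisection reduces the claim to short intervals around each time. On such an interval
  both curves start at the same point of one flow box, and the Lipschitz estimate bounds their
  distance by twice zero.\<close>

lemma integral_curve_unique:
  assumes g: "integral_curve g1" "integral_curve g2" and "g1 0 = g2 0" and t: "t \<ge> (0::real)"
  shows "g1 t = g2 t"
proof -
  have "g1 0 = g2 0 \<longrightarrow> g1 t = g2 t"
  proof (rule Bolzano[OF t, of "\<lambda>a b. g1 a = g2 a \<longrightarrow> g1 b = g2 b"])
    fix x assume "0 \<le> x" "x \<le> t"
    obtain c r h L B where box: "flow_box c (snd c (g1 x)) r h L B" "g1 x \<in> chart_ball c (snd c (g1 x)) r"
      using flow_box_exists by blast
    let ?U = "chart_ball c (snd c (g1 x)) r"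
    have c: "c \<in> atlas" and "h > 0" using box by (auto simp: flow_box_def)
    have "continuous_on UNIV g1" using g by (simp add: integral_curve_def)
    then obtain d where d: "d > 0" "\<And>a. \<bar>a - x\<bar> < d \<Longrightarrow> g1 a \<in> ?U"
      using curve_near[where g = g1 and x = x, OF _ open_chart_ball[OF c] box(2)] by metis
    show "\<exists>d>0. \<forall>a b. a \<le> x \<and> x \<le> b \<and> b - a < d \<longrightarrow> g1 a = g2 a \<longrightarrow> g1 b = g2 b"
    proof (intro exI[of _ "min d h"] conjI allI impI)
      fix a b assume ab: "a \<le> x \<and> x \<le> b \<and> b - a < min d h" and eq: "g1 a = g2 a"
      have inU: "g1 a \<in> ?U" using d(2)[of a] ab by auto
      have t: "b - a \<in> {0..h}" using ab by auto
      note s = integral_curve_shift[OF g(1), of a] integral_curve_shift[OF g(2), of a]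
      have "norm (snd c (g2 (a + (b - a))) - snd c (g1 (a + (b - a)))) \<le> 2 * norm (snd c (g2 (a + 0)) - snd c (g1 (a + 0)))"
        by (rule flow_box_lipschitz[OF box(1) s _ _ t]) (use inU eq in auto)
      then have "snd c (g2 b) = snd c (g1 b)" using eq by simp
      moreover have "g1 b \<in> fst c" using flow_box_coordinates(3)[OF box(1) s(1) _ t] inU by simp
      moreover have "g2 b \<in> fst c" using flow_box_coordinates(3)[OF box(1) s(2) _ t] inU eq by simp
      ultimately show "g1 b = g2 b" using chart_simps(1)[OF c] by metis
    qed (use d \<open>h > 0\<close> in auto)
  qed auto
  then show ?thesis using assms by blast
qed

lemma flow_add_nonneg: "t \<ge> 0 \<Longrightarrow> \<gamma> (\<gamma> m s) t = \<gamma> m (s + t)"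
  by (rule integral_curve_unique[OF integral_curve_\<gamma> integral_curve_shift[OF integral_curve_\<gamma>]]) auto

text \<open>Flow boxes run forward in time only. Through this instance, statements about
  \<open>t \<ge> 0\<close> yield those about negative times.\<close>

lemma reversed: "chart_flow atlas (\<lambda>c x. - X c x) (\<lambda>c x. - J c x) (\<lambda>m t. \<gamma> m (- t))"
proof
  show "smooth_atlas atlas" by (rule atlas)
  show "((\<lambda>x. - X c x) has_derivative blinfun_apply (- J c x)) (at x)" if "c \<in> atlas" "x \<in> chart_range c" for c x
  proof -
    have "blinfun_apply (- J c x) = (\<lambda>v. - blinfun_apply (J c x) v)" by (simp add: fun_eq_iff blinfun.minus_left)
    then show ?thesis using has_derivative_minus[OF X_derivative[OF that]] by simp
  qed
  show "continuous_on (chart_range c) (\<lambda>x. - J c x)" if "c \<in> atlas" for c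
    by (intro continuous_intros J_continuous that)
  show "continuous_on UNIV (\<lambda>t. \<gamma> m (- t))" for m
    by (intro continuous_on_compose2[OF \<gamma>_path] continuous_intros) auto
  show "((\<lambda>s. snd c (\<gamma> m (- s))) has_vector_derivative - X c (snd c (\<gamma> m (- t)))) (at t)"
    if "c \<in> atlas" "\<gamma> m (- t) \<in> fst c" for c m t
  proof -
    have "((\<lambda>x. - x) has_vector_derivative - 1) (at t)"
      by (rule has_vector_derivative_minus[OF has_vector_derivative_id])
    from vector_diff_chain_at[OF this \<gamma>_derivative[OF that]] show ?thesis by (simp add: o_def)
  qed
qed simp

lemma flow_add: "\<gamma> (\<gamma> m s) t = \<gamma> m (s + t)"
proof (cases "t \<ge> 0")
  case False
  interpret r: chart_flow atlas "\<lambda>c x. - X c x" "\<lambda>c x. - J c x" "\<lambda>m t. \<gamma> m (- t)" by (rule reversed)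
  show ?thesis using r.flow_add_nonneg[of "- t" m "- s"] False by (simp add: add.commute)
qed (rule flow_add_nonneg)

lemma flow_inverse [simp]: "\<gamma> (\<gamma> m t) (- t) = m" "\<gamma> (\<gamma> m (- t)) t = m"
  by (simp_all add: flow_add)

lemma flow_box_continuous:
  assumes box: "flow_box c x0 r h L B"
  shows "continuous_on (chart_ball c x0 r \<times> {0..h}) (\<lambda>(m, s). \<gamma> m s)"
proof -
  let ?U = "chart_ball c x0 r" let ?Y = "\<lambda>(m, s). snd c (\<gamma> m s)"
  have c: "c \<in> atlas" and sub: "cball x0 (2 * r) \<subseteq> chart_range c" and B: "B \<ge> 0"
    and XB: "\<And>p. p \<in> cball x0 (2 * r) \<Longrightarrow> norm (X c p) \<le> B"
    using box by (auto simp: flow_box_def)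
  have est: "norm (?Y q - ?Y p) \<le> 2 * norm (snd c (fst q) - snd c (fst p)) + B * \<bar>snd q - snd p\<bar>"
    if "p \<in> ?U \<times> {0..h}" "q \<in> ?U \<times> {0..h}" for p q
  proof -
    obtain m s m' s' where pq: "p = (m, s)" "q = (m', s')" by (cases p; cases q)
    have ms: "m \<in> ?U" "m' \<in> ?U" "s \<in> {0..h}" "s' \<in> {0..h}" using that pq by auto
    have "norm (snd c (\<gamma> m' s') - snd c (\<gamma> m s')) \<le> 2 * norm (snd c (\<gamma> m' 0) - snd c (\<gamma> m 0))"
      by (rule flow_box_lipschitz[OF box integral_curve_\<gamma> integral_curve_\<gamma>]) (use ms in auto)
    moreover have "norm (snd c (\<gamma> m s') - snd c (\<gamma> m s)) \<le> B * \<bar>s' - s\<bar>"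
      by (rule vector_derivative_bound[OF flow_box_coordinates(1)[OF box integral_curve_\<gamma>]])
         (use ms flow_box_coordinates(2)[OF box integral_curve_\<gamma>] XB in auto)
    ultimately show ?thesis unfolding pq
      using norm_triangle_ineq[of "snd c (\<gamma> m' s') - snd c (\<gamma> m s')" "snd c (\<gamma> m s') - snd c (\<gamma> m s)"] by simp
  qed
  have "continuous_on (?U \<times> {0..h}) ?Y"
    unfolding continuous_on_def
  proof
    fix p assume p: "p \<in> ?U \<times> {0..h}"
    have cf: "continuous_on (?U \<times> {0..h}) (\<lambda>q. snd c (fst q))"
      by (rule continuous_on_compose2[OF chart_simps(5)[OF c] continuous_on_fst[OF continuous_on_id]])
         (auto simp: chart_ball_def)
    have "continuous_on (?U \<times> {0..h}) (\<lambda>q. 2 * norm (snd c (fst q) - snd c (fst p)) + B * \<bar>snd q - snd p\<bar>)"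
      by (intro continuous_intros cf)
    then have "((\<lambda>q. 2 * norm (snd c (fst q) - snd c (fst p)) + B * \<bar>snd q - snd p\<bar>) \<longlongrightarrow> 0) (at p within ?U \<times> {0..h})"
      unfolding continuous_on_def by (drule_tac bspec[OF _ p]) simp
    then have "((\<lambda>q. ?Y q - ?Y p) \<longlongrightarrow> 0) (at p within ?U \<times> {0..h})"
      by (rule Lim_null_comparison[rotated])
         (use est[OF p] in \<open>auto simp: eventually_at_filter split: prod.splits intro!: always_eventually\<close>)
    then show "(?Y \<longlongrightarrow> ?Y p) (at p within ?U \<times> {0..h})" by (rule LIM_zero_cancel)
  qed
  then have "continuous_on (?U \<times> {0..h}) (\<lambda>q. chart_inv c (?Y q))"
    by (rule continuous_on_compose2[OF chart_simps(6)[OF c]])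
       (use flow_box_coordinates(2)[OF box integral_curve_\<gamma>] sub in auto)
  moreover have "chart_inv c (?Y q) = (\<lambda>(m, s). \<gamma> m s) q" if "q \<in> ?U \<times> {0..h}" for q
    using that flow_box_coordinates(3)[OF box integral_curve_\<gamma>] chart_simps(1)[OF c] by auto
  ultimately show ?thesis by (metis (no_types, lifting) continuous_on_cong)
qed

lemma flow_box_continuous_fixed_time:
  assumes box: "flow_box c x0 r h L B" and s: "s \<in> {0..h}"
  shows "continuous_on (chart_ball c x0 r) (\<lambda>m. \<gamma> m s)"
proof -
  have "continuous_on (chart_ball c x0 r) (\<lambda>m. (\<lambda>(m, s). \<gamma> m s) (m, s))"
    by (rule continuous_on_compose2[OF flow_box_continuous[OF box]]) (use s in \<open>auto intro!: continuous_intros\<close>)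
  then show ?thesis by simp
qed

text \<open>Bisection along the orbit of \<open>m\<close>. In the applications \<open>P a b\<close>
  is a property of the map from time \<open>a\<close> to time \<open>b\<close> near the point
  \<open>\<gamma> m a\<close>, and transitivity is stability under composition of maps.\<close>

lemma local_to_global:
  assumes t: "t \<ge> (0::real)"
    and trans: "\<And>a b c. P a b \<Longrightarrow> P b c \<Longrightarrow> a \<le> b \<Longrightarrow> b \<le> c \<Longrightarrow> P a c"
    and local: "\<And>c x0 r h L B a b. flow_box c x0 r h L B \<Longrightarrow> \<gamma> m a \<in> chart_ball c x0 r \<Longrightarrow> b - a \<in> {0..h} \<Longrightarrow> P a b"
  shows "P 0 t"
proof (rule Bolzano[OF t, of P])
  fix x assume "0 \<le> x" "x \<le> t"
  obtain c r h L B where box: "flow_box c (snd c (\<gamma> m x)) r h L B" "\<gamma> m x \<in> chart_ball c (snd c (\<gamma> m x)) r"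
    using flow_box_exists by blast
  let ?U = "chart_ball c (snd c (\<gamma> m x)) r"
  have c: "c \<in> atlas" and "h > 0" using box by (auto simp: flow_box_def)
  obtain d where d: "d > 0" "\<And>a. \<bar>a - x\<bar> < d \<Longrightarrow> \<gamma> m a \<in> ?U"
    using curve_near[where g = "\<gamma> m" and x = x, OF \<gamma>_path open_chart_ball[OF c] box(2)] by metis
  show "\<exists>d>0. \<forall>a b. a \<le> x \<and> x \<le> b \<and> b - a < d \<longrightarrow> P a b"
    by (intro exI[of _ "min d h"] conjI allI impI local[OF box(1)]) (use d \<open>h > 0\<close> in auto)
qed (rule trans)

lemma flow_isCont_nonneg:
  assumes "t \<ge> 0" shows "isCont (\<lambda>m. \<gamma> m t) m"
proof -
  have "isCont (\<lambda>m'. \<gamma> m' (t - 0)) (\<gamma> m 0)"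
  proof (rule local_to_global[OF assms, where P = "\<lambda>a b. isCont (\<lambda>m'. \<gamma> m' (b - a)) (\<gamma> m a)"])
    fix a b c assume ab: "isCont (\<lambda>m'. \<gamma> m' (b - a)) (\<gamma> m a)" and "isCont (\<lambda>m'. \<gamma> m' (c - b)) (\<gamma> m b)"
    then have "isCont (\<lambda>m'. \<gamma> m' (c - b)) (\<gamma> (\<gamma> m a) (b - a))" by (simp add: flow_add)
    from isCont_o2[OF ab this] show "isCont (\<lambda>m'. \<gamma> m' (c - a)) (\<gamma> m a)" by (simp add: flow_add)
  next
    fix c x0 r h L B a b
    assume box: "flow_box c x0 r h L B" "\<gamma> m a \<in> chart_ball c x0 r" "b - a \<in> {0..h}"
    then have "open (chart_ball c x0 r)" using open_chart_ball by (auto simp: flow_box_def)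
    then show "isCont (\<lambda>m'. \<gamma> m' (b - a)) (\<gamma> m a)"
      using flow_box_continuous_fixed_time[OF box(1,3)] box(2) by (simp add: continuous_on_eq_continuous_at)
  qed
  then show ?thesis by simp
qed

lemma flow_continuous: "continuous_on UNIV (\<lambda>m. \<gamma> m t)"
proof (cases "t \<ge> 0")
  case True
  then show ?thesis using flow_isCont_nonneg by (simp add: continuous_on_eq_continuous_at)
next
  case False
  interpret r: chart_flow atlas "\<lambda>c x. - X c x" "\<lambda>c x. - J c x" "\<lambda>m t. \<gamma> m (- t)" by (rule reversed)
  show ?thesis using r.flow_isCont_nonneg[of "- t"] False by (simp add: continuous_on_eq_continuous_at)
qed

lemma flow_jointly_continuous: "continuous_on UNIV (\<lambda>(t, m). \<gamma> m t)"
proof -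
  have "isCont (\<lambda>p. \<gamma> (snd p) (fst p)) (t0, m0)" for t0 m0
  proof -
    obtain c r h L B where box: "flow_box c (snd c (\<gamma> m0 t0)) r h L B" "\<gamma> m0 t0 \<in> chart_ball c (snd c (\<gamma> m0 t0)) r"
      using flow_box_exists by blast
    let ?U = "chart_ball c (snd c (\<gamma> m0 t0)) r"
    have c: "c \<in> atlas" and h: "h > 0" using box by (auto simp: flow_box_def)
    obtain d where d: "d > 0" "\<And>a. \<bar>a - t0\<bar> < d \<Longrightarrow> \<gamma> m0 a \<in> ?U"
      using curve_near[where g = "\<gamma> m0" and x = t0, OF \<gamma>_path open_chart_ball[OF c] box(2)] by metis
    \<comment> \<open>Since boxes run forward, the clock starts at \<open>t0 - \<delta>\<close>:
      \<open>\<delta> < d\<close> puts the starting point into the box, and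
      \<open>2 * \<delta> \<le> h\<close> lets the box reach beyond \<open>t0\<close> on both
      sides.\<close>
    define \<delta> where "\<delta> = min (d / 2) (h / 2)"
    have \<delta>: "\<delta> > 0" "\<delta> < d" "2 * \<delta> \<le> h" using d h by (auto simp: \<delta>_def)
    let ?S = "{t0 - \<delta> <..< t0 + \<delta>} \<times> ((\<lambda>m. \<gamma> m (t0 - \<delta>)) -` ?U)"
    have "open ?S"
      by (intro open_Times open_vimage open_chart_ball[OF c] flow_continuous) auto
    have cU: "continuous_on ?S (\<lambda>p. \<gamma> (snd p) (t0 - \<delta>))"
      by (rule continuous_on_compose2[OF flow_continuous continuous_on_snd[OF continuous_on_id]]) auto
    have "continuous_on ?S (\<lambda>p. (\<lambda>(m, s). \<gamma> m s) (\<gamma> (snd p) (t0 - \<delta>), fst p - (t0 - \<delta>)))"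
      by (rule continuous_on_compose2[OF flow_box_continuous[OF box(1)]])
         (use \<delta> in \<open>auto intro!: continuous_intros cU\<close>)
    then have "continuous_on ?S (\<lambda>p. \<gamma> (snd p) (fst p))" by (simp add: flow_add)
    moreover have "(t0, m0) \<in> ?S" using d(2)[of "t0 - \<delta>"] \<delta> by auto
    ultimately show ?thesis using continuous_on_eq_continuous_at[OF \<open>open ?S\<close>] by blast
  qed
  then show ?thesis by (simp add: continuous_on_eq_continuous_at split_def)
qed

end

section \<open>Invariance of volume under the flow\<close>

locale liouville_flow = chart_flow +
  fixes vol :: "'a measure" and \<rho> :: "('a, 'b) chart \<Rightarrow> real^'b \<Rightarrow> real"
  assumes sets_vol: "sets vol = sets borel"
    and emeasure_vol: "c \<in> atlas \<Longrightarrow> E \<in> sets borel \<Longrightarrow> E \<subseteq> fst c \<Longrightarrow>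
      emeasure vol E = (\<integral>\<^sup>+x\<in>snd c ` E. ennreal (\<rho> c x) \<partial>lborel)"
    and \<rho>_continuous: "c \<in> atlas \<Longrightarrow> continuous_on (chart_range c) (\<rho> c)"
    and \<rho>_nonneg: "c \<in> atlas \<Longrightarrow> x \<in> chart_range c \<Longrightarrow> \<rho> c x \<ge> 0"
    and jacobian: "c \<in> atlas \<Longrightarrow> Y 0 = id_blinfun \<Longrightarrow> (\<And>t. t \<in> {0..h} \<Longrightarrow> y t \<in> chart_range c) \<Longrightarrow>
      (\<And>t. t \<in> {0..h} \<Longrightarrow> (y has_vector_derivative X c (y t)) (at t within {0..h})) \<Longrightarrow>
      (\<And>t. t \<in> {0..h} \<Longrightarrow> (Y has_vector_derivative (J c (y t) o\<^sub>L Y t)) (at t within {0..h})) \<Longrightarrow>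
      t \<in> {0..h} \<Longrightarrow> \<bar>det (matrix (blinfun_apply (Y t)))\<bar> * \<rho> c (y t) = \<rho> c (y 0)"
begin

lemma flow_image_borel:
  assumes "E \<in> sets borel" shows "(\<lambda>m. \<gamma> m t) ` E \<in> sets borel"
proof -
  have "(\<lambda>m. \<gamma> m t) ` E = (\<lambda>m. \<gamma> m (- t)) -` E"
    by (auto intro!: image_eqI[of _ "\<lambda>m. \<gamma> m t" "\<gamma> _ (- t)"])
  then show ?thesis
    using borel_preimage_continuous_on[OF flow_continuous _ assms, of "- t"] by simp
qed

text \<open>Change of variables for the time-\<open>s\<close> map in coordinates: by
  \<open>jacobian\<close> the transformed density is the original one, so both volumes are the
  integral of \<open>\<rho> c\<close> over \<open>S\<close>.\<close>

lemma emeasure_flow_box_image: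
  assumes box: "flow_box c x0 r h L B" and E: "E \<in> sets borel" "E \<subseteq> chart_ball c x0 r" and s: "s \<in> {0..h}"
  shows "emeasure vol ((\<lambda>m. \<gamma> m s) ` E) = emeasure vol E"
proof -
  have c: "c \<in> atlas" and r: "r > 0" and h: "h > 0" "h * L \<le> 1/2" and sub: "cball x0 (2 * r) \<subseteq> chart_range c"
    and JL: "\<And>p. p \<in> cball x0 (2 * r) \<Longrightarrow> norm (J c p) \<le> L"
    using box by (auto simp: flow_box_def)
  have subr: "ball x0 r \<subseteq> cball x0 (2 * r)" using r by auto
  define y where "y x t = snd c (\<gamma> (chart_inv c x) t)" for x t
  have start: "\<gamma> (chart_inv c x) 0 \<in> chart_ball c x0 r" if "x \<in> ball x0 r" for x
    using that subr sub chart_simps[OF c] by (auto simp: chart_ball_def subset_iff)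
  note coord = flow_box_coordinates[OF box integral_curve_\<gamma> start]
  have y0: "y x 0 = x" if "x \<in> ball x0 r" for x
    using that subr sub chart_simps[OF c] by (auto simp: y_def subset_iff)
  have "\<exists>Y. Y 0 = id_blinfun \<and>
    (\<forall>t\<in>{0..h}. (Y has_vector_derivative (J c (y x t) o\<^sub>L Y t)) (at t within {0..h})) \<and>
    (\<forall>t\<in>{0..h}. ((\<lambda>x. y x t) has_derivative blinfun_apply (Y t)) (at x))" if x: "x \<in> ball x0 r" for x
  proof (rule flow_differentiable[of "cball x0 (2 * r)" "X c" "J c" L h "ball x0 r" y x])
    show "(X c has_derivative blinfun_apply (J c p)) (at p within cball x0 (2 * r))" if "p \<in> cball x0 (2 * r)" for p
      using X_derivative[OF c subsetD[OF sub that]] by (rule has_derivative_at_withinI)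
    show "continuous_on (cball x0 (2 * r)) (J c)" using J_continuous[OF c] sub continuous_on_subset by blast
    show "(y x has_vector_derivative X c (y x t)) (at t within {0..h})" if "x \<in> ball x0 r" "t \<in> {0..h}" for x t
      unfolding y_def using coord(1)[OF that] .
    show "y x t \<in> cball x0 (2 * r)" if "x \<in> ball x0 r" "t \<in> {0..h}" for x t
      unfolding y_def using coord(2)[OF that] .
  qed (use h JL y0 x in auto)
  then obtain Y where Y: "\<And>x. x \<in> ball x0 r \<Longrightarrow> Y x 0 = id_blinfun"
    "\<And>x t. x \<in> ball x0 r \<Longrightarrow> t \<in> {0..h} \<Longrightarrow> (Y x has_vector_derivative (J c (y x t) o\<^sub>L Y x t)) (at t within {0..h})"
    "\<And>x t. x \<in> ball x0 r \<Longrightarrow> t \<in> {0..h} \<Longrightarrow> ((\<lambda>x. y x t) has_derivative blinfun_apply (Y x t)) (at x)"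
    by metis
  have jac: "\<bar>det (matrix (blinfun_apply (Y x s)))\<bar> * \<rho> c (y x s) = \<rho> c x" if x: "x \<in> ball x0 r" for x
  proof -
    have "\<bar>det (matrix (blinfun_apply (Y x s)))\<bar> * \<rho> c (y x s) = \<rho> c (y x 0)"
    proof (rule jacobian[OF c Y(1)[OF x] _ _ Y(2)[OF x] s])
      show "y x t \<in> chart_range c" "(y x has_vector_derivative X c (y x t)) (at t within {0..h})"
        if "t \<in> {0..h}" for t
        unfolding y_def using coord(1,2)[OF x that] sub by auto
    qed auto
    then show ?thesis by (simp add: y0[OF x])
  qed
  define S where "S = snd c ` E"
  let ?E' = "(\<lambda>m. \<gamma> m s) ` E"
  have Ec: "E \<subseteq> fst c" using E by (auto simp: chart_ball_def)
  have E'c: "?E' \<subseteq> fst c"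
    using E flow_box_coordinates(3)[OF box integral_curve_\<gamma> _ s] by auto
  have S_sets: "S \<in> sets borel" unfolding S_def by (rule chart_image_borel[OF c E(1) Ec])
  have S_ball: "S \<subseteq> ball x0 r" using E by (auto simp: S_def chart_ball_def)
  have gS: "(\<lambda>x. y x s) ` S = snd c ` ?E'"
    unfolding S_def image_image y_def using chart_simps(1)[OF c] Ec by (auto intro!: image_cong)
  have gS_sets: "(\<lambda>x. y x s) ` S \<in> sets borel"
    unfolding gS by (rule chart_image_borel[OF c flow_image_borel[OF E(1)] E'c])
  have gS_range: "(\<lambda>x. y x s) ` S \<subseteq> chart_range c"
    unfolding gS using E'c chart_simps(2)[OF c] by auto
  have S_range: "S \<subseteq> chart_range c" using S_ball subr sub by auto
  have inj: "inj_on (\<lambda>x. y x s) S"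
  proof (rule inj_onI)
    fix x x' assume xx: "x \<in> S" "x' \<in> S" "y x s = y x' s"
    then have "\<gamma> (chart_inv c x) s = \<gamma> (chart_inv c x') s"
      using coord(3)[OF _ s] S_ball chart_simps(1)[OF c] unfolding y_def by (metis subsetD)
    then have "chart_inv c x = chart_inv c x'" by (metis flow_inverse(1))
    then show "x = x'" using xx S_range chart_simps(3)[OF c] by (metis subsetD)
  qed
  let ?F = "\<lambda>x. indicator S x * (\<bar>det (matrix (blinfun_apply (Y x s)))\<bar> * \<rho> c (y x s))"
  have Feq: "?F x = indicator S x * \<rho> c x" for x
    using jac S_ball by (auto simp: indicator_def)
  have bm: "(\<lambda>x. indicator T x * \<rho> c x) \<in> borel_measurable borel" if "T \<in> sets borel" "T \<subseteq> chart_range c" for T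
    using borel_measurable_continuous_on_indicator[OF that(1) continuous_on_subset[OF \<rho>_continuous[OF c] that(2)]] by simp
  \<comment> \<open>Finiteness is a hypothesis of the change of variables; \<open>\<rho> c\<close>
    is bounded on the compact ball of radius \<open>2 * r\<close>, and \<open>S\<close> lies in the
    ball of radius \<open>r\<close>.\<close>
  have fin: "(\<integral>\<^sup>+x. ennreal (?F x) \<partial>lborel) < \<infinity>"
  proof -
    have "compact (\<rho> c ` cball x0 (2 * r))"
      by (intro compact_continuous_image continuous_on_subset[OF \<rho>_continuous[OF c] sub]) auto
    then obtain b where b: "b > 0" "\<And>x. x \<in> cball x0 (2 * r) \<Longrightarrow> norm (\<rho> c x) \<le> b"
      using compact_imp_bounded[OF \<open>compact (\<rho> c ` _)\<close>] unfolding bounded_pos by auto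
    have "(\<integral>\<^sup>+x. ennreal (?F x) \<partial>lborel) \<le> (\<integral>\<^sup>+x. ennreal b * indicator (ball x0 r) x \<partial>lborel)"
    proof (rule nn_integral_mono)
      fix x
      show "ennreal (?F x) \<le> ennreal b * indicator (ball x0 r) x"
      proof (cases "x \<in> S")
        case True
        then have "x \<in> ball x0 r" using S_ball by auto
        then have "\<rho> c x \<le> b" using b(2)[of x] subr by auto
        then show ?thesis unfolding Feq using True \<open>x \<in> ball x0 r\<close> by (simp add: ennreal_leI)
      qed (simp add: Feq)
    qed
    also have "\<dots> = ennreal b * emeasure lborel (ball x0 r)" by (simp add: nn_integral_cmult_indicator)
    also have "\<dots> < \<infinity>" using emeasure_lborel_ball_finite[of x0 r] by (simp add: ennreal_mult_less_top)
    finally show ?thesis .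
  qed
  have cv: "(\<integral>\<^sup>+x. ennreal (indicator ((\<lambda>x. y x s) ` S) x * \<rho> c x) \<partial>lborel) = (\<integral>\<^sup>+x. ennreal (?F x) \<partial>lborel)"
  proof (rule nn_integral_change_of_variables[OF S_sets _ inj])
    show "((\<lambda>x. y x s) has_derivative blinfun_apply (Y x s)) (at x within S)" if "x \<in> S" for x
      using Y(3)[OF subsetD[OF S_ball that] s] by (rule has_derivative_at_withinI)
    show "0 \<le> \<rho> c x" if "x \<in> (\<lambda>x. y x s) ` S" for x using \<rho>_nonneg[OF c] that gS_range by auto
    show "?F \<in> borel_measurable borel" unfolding Feq using bm[OF S_sets S_range] .
  qed (use bm[OF gS_sets gS_range] fin in auto)
  have conv: "(\<integral>\<^sup>+x\<in>T. ennreal (\<rho> c x) \<partial>lborel) = (\<integral>\<^sup>+x. ennreal (indicator T x * \<rho> c x) \<partial>lborel)" for T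
    by (intro nn_integral_cong) (simp add: indicator_def)
  have "emeasure vol ?E' = (\<integral>\<^sup>+x\<in>(\<lambda>x. y x s) ` S. ennreal (\<rho> c x) \<partial>lborel)"
    unfolding gS by (rule emeasure_vol[OF c flow_image_borel[OF E(1)] E'c])
  also have "\<dots> = (\<integral>\<^sup>+x\<in>S. ennreal (\<rho> c x) \<partial>lborel)" unfolding conv cv Feq ..
  also have "\<dots> = emeasure vol E" unfolding S_def by (rule emeasure_vol[OF c E(1) Ec, symmetric])
  finally show ?thesis .
qed

text \<open>Equality for a single set would not survive composition. What is passed along the orbit
  is a neighbourhood of \<open>\<gamma> m a\<close> all of whose Borel subsets keep their volume
  from time \<open>a\<close> to time \<open>b\<close>; composition cuts it down by the preimage of
  the next neighbourhood.\<close>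

lemma flow_locally_preserves_volume:
  assumes "t \<ge> 0"
  obtains U where "open U" "m \<in> U"
    "\<And>E. E \<in> sets borel \<Longrightarrow> E \<subseteq> U \<Longrightarrow> emeasure vol ((\<lambda>m. \<gamma> m t) ` E) = emeasure vol E"
proof -
  let ?P = "\<lambda>a b. \<exists>U. open U \<and> \<gamma> m a \<in> U \<and>
    (\<forall>E\<in>sets borel. E \<subseteq> U \<longrightarrow> emeasure vol ((\<lambda>m. \<gamma> m (b - a)) ` E) = emeasure vol E)"
  have "?P 0 t"
  proof (rule local_to_global[OF assms, where P = ?P and m = m])
    fix a b c assume ab: "?P a b" and bc: "?P b c"
    from ab obtain U where U: "open U" "\<gamma> m a \<in> U"
      "\<forall>E\<in>sets borel. E \<subseteq> U \<longrightarrow> emeasure vol ((\<lambda>m. \<gamma> m (b - a)) ` E) = emeasure vol E"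
      by (elim exE conjE)
    from bc obtain V where V: "open V" "\<gamma> m b \<in> V"
      "\<forall>E\<in>sets borel. E \<subseteq> V \<longrightarrow> emeasure vol ((\<lambda>m. \<gamma> m (c - b)) ` E) = emeasure vol E"
      by (elim exE conjE)
    let ?W = "U \<inter> (\<lambda>m. \<gamma> m (b - a)) -` V"
    show "?P a c"
    proof (intro exI[of _ ?W] conjI ballI impI)
      show "open ?W" by (intro open_Int open_vimage flow_continuous U V)
      show "\<gamma> m a \<in> ?W" using U V by (simp add: flow_add)
      fix E :: "'a set" assume E: "E \<in> sets borel" "E \<subseteq> ?W"
      have "(\<lambda>m. \<gamma> m (c - a)) ` E = (\<lambda>m. \<gamma> m (c - b)) ` (\<lambda>m. \<gamma> m (b - a)) ` E"
        by (simp add: image_image flow_add)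
      moreover have "emeasure vol ((\<lambda>m. \<gamma> m (c - b)) ` (\<lambda>m. \<gamma> m (b - a)) ` E) = emeasure vol ((\<lambda>m. \<gamma> m (b - a)) ` E)"
        by (rule V(3)[rule_format]) (use E flow_image_borel[OF E(1)] in auto)
      moreover have "emeasure vol ((\<lambda>m. \<gamma> m (b - a)) ` E) = emeasure vol E"
        by (rule U(3)[rule_format]) (use E in auto)
      ultimately show "emeasure vol ((\<lambda>m. \<gamma> m (c - a)) ` E) = emeasure vol E" by simp
    qed
  next
    fix c x0 r h L B a b
    assume box: "flow_box c x0 r h L B" "\<gamma> m a \<in> chart_ball c x0 r" "b - a \<in> {0..h}"
    then have "open (chart_ball c x0 r)" using open_chart_ball by (auto simp: flow_box_def)
    then show "?P a b" using emeasure_flow_box_image[OF box(1) _ _ box(3)] box(2) by blast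
  qed
  then show ?thesis using that by auto
qed

text \<open>By Lindelof's theorem countably many of the local neighbourhoods cover the manifold.
  They cut \<open>E\<close> into disjoint pieces with disjoint images, and countable additivity
  applies on both sides.\<close>

lemma emeasure_flow_image:
  assumes t: "t \<ge> 0" and E: "E \<in> sets borel"
  shows "emeasure vol ((\<lambda>m. \<gamma> m t) ` E) = emeasure vol E"
proof -
  let ?pres = "\<lambda>U. open U \<and> (\<forall>E\<in>sets borel. E \<subseteq> U \<longrightarrow> emeasure vol ((\<lambda>m. \<gamma> m t) ` E) = emeasure vol E)"
  obtain \<F> where \<F>: "\<F> \<subseteq> {U. ?pres U}" "countable \<F>" "\<Union>\<F> = \<Union>{U. ?pres U}"
    by (rule Lindelof[of "{U. ?pres U}"]) auto
  have cover: "\<Union>\<F> = UNIV"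
  proof -
    have "m \<in> \<Union>{U. ?pres U}" for m
    proof -
      obtain U where "open U" "m \<in> U"
        "\<And>E. E \<in> sets borel \<Longrightarrow> E \<subseteq> U \<Longrightarrow> emeasure vol ((\<lambda>m. \<gamma> m t) ` E) = emeasure vol E"
        using flow_locally_preserves_volume[OF t] by blast
      then have "U \<in> {U. ?pres U}" by blast
      then show ?thesis using \<open>m \<in> U\<close> by (rule UnionI)
    qed
    then show ?thesis unfolding \<F>(3) by blast
  qed
  then have "\<F> \<noteq> {}" by auto
  define V where "V = from_nat_into \<F>"
  have V: "?pres (V n)" for n using from_nat_into[OF \<open>\<F> \<noteq> {}\<close>, of n] \<F>(1) unfolding V_def by blast
  have "range V = \<F>" unfolding V_def by (rule range_from_nat_into[OF \<open>\<F> \<noteq> {}\<close> \<F>(2)])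
  then have UV: "(\<Union>n. V n) = UNIV" using cover by simp
  define D where "D n = E \<inter> disjointed V n" for n
  have V_sets: "range V \<subseteq> sets borel" using V by auto
  have D_sets: "D n \<in> sets borel" for n
    unfolding D_def using E sets.range_disjointed_sets[OF V_sets] by auto
  have D_disj: "disjoint_family D"
    using disjoint_family_disjointed[of V] unfolding D_def disjoint_family_on_def by blast
  have D_UN: "(\<Union>n. D n) = E" unfolding D_def using UN_disjointed_eq[of V] UV by auto
  have inj: "inj (\<lambda>m. \<gamma> m t)" by (rule inj_on_inverseI[where g = "\<lambda>m. \<gamma> m (- t)"]) simp
  have im: "emeasure vol ((\<lambda>m. \<gamma> m t) ` D n) = emeasure vol (D n)" for n
  proof -
    have "D n \<subseteq> V n" unfolding D_def using disjointed_subset[of V n] by blast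
    then show ?thesis using V[of n] D_sets by blast
  qed
  have "(\<lambda>m. \<gamma> m t) ` E = (\<Union>n. (\<lambda>m. \<gamma> m t) ` D n)" using D_UN by blast
  also have "emeasure vol \<dots> = (\<Sum>n. emeasure vol ((\<lambda>m. \<gamma> m t) ` D n))"
  proof (rule suminf_emeasure[symmetric])
    show "range (\<lambda>n. (\<lambda>m. \<gamma> m t) ` D n) \<subseteq> sets vol" using flow_image_borel[OF D_sets] by (auto simp: sets_vol)
    show "disjoint_family (\<lambda>n. (\<lambda>m. \<gamma> m t) ` D n)"
      unfolding disjoint_family_on_def
    proof (intro ballI impI)
      fix i j :: nat assume "i \<noteq> j"
      then have "D i \<inter> D j = {}" using D_disj unfolding disjoint_family_on_def by simp
      then show "(\<lambda>m. \<gamma> m t) ` D i \<inter> (\<lambda>m. \<gamma> m t) ` D j = {}" by (simp only: image_Int[OF inj, symmetric] image_empty)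
    qed
  qed
  also have "\<dots> = (\<Sum>n. emeasure vol (D n))" unfolding im ..
  also have "\<dots> = emeasure vol (\<Union>n. D n)"
    using D_sets by (intro suminf_emeasure D_disj) (auto simp: sets_vol)
  finally show ?thesis unfolding D_UN .
qed

theorem emeasure_flow_vimage:
  assumes "t \<ge> 0" "E \<in> sets borel"
  shows "emeasure vol ((\<lambda>m. \<gamma> m t) -` E) = emeasure vol E"
proof -
  have "(\<lambda>m. \<gamma> m t) -` E \<in> sets borel"
    using borel_preimage_continuous_on[OF flow_continuous _ assms(2), of t] by simp
  from emeasure_flow_image[OF assms(1) this]
  have "emeasure vol ((\<lambda>m. \<gamma> m t) ` ((\<lambda>m. \<gamma> m t) -` E)) = emeasure vol ((\<lambda>m. \<gamma> m t) -` E)" .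
  moreover have "(\<lambda>m. \<gamma> m t) ` ((\<lambda>m. \<gamma> m t) -` E) = E"
    by (auto intro!: image_eqI[of _ "\<lambda>m. \<gamma> m t" "\<gamma> _ (- t)"])
  ultimately show ?thesis by simp
qed

end

lemma frechet_derivative_component:
  assumes "f differentiable (at x)" shows "fd (\<lambda>y. f y $ i) x v = fd f x v $ i"
  using frechet_derivative_at[OF bounded_linear.has_derivative[OF bounded_linear_vec_nth
      frechet_derivative_works[THEN iffD1, OF assms]], of i] by metis

context liouville_flow
begin

text \<open>This is what turns the vanishing almost everywhere of a continuous function into
  vanishing everywhere. In a chart, the set becomes a nonempty open set, which is not negligible,
  and the density is positive there.\<close>

lemma open_positive_volume:
  assumes pos: "\<And>c x. c \<in> atlas \<Longrightarrow> x \<in> chart_range c \<Longrightarrow> \<rho> c x > 0" and V: "open V" "V \<noteq> {}"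
  shows "emeasure vol V > 0"
proof -
  obtain m where m: "m \<in> V" using V by blast
  obtain c where c: "c \<in> atlas" "m \<in> fst c" using chart_exists by blast
  let ?E = "V \<inter> fst c"
  have E: "open ?E" "?E \<subseteq> fst c" "m \<in> ?E" using V m c chart(1)[OF c(1)] by auto
  have im: "snd c ` ?E = chart_range c \<inter> chart_inv c -` ?E"
    using chart_simps[OF c(1)] by (auto intro!: image_eqI[of _ "snd c"])
  have op: "open (snd c ` ?E)" unfolding im
    by (rule continuous_open_preimage[OF chart_simps(6)[OF c(1)] chart(2)[OF c(1)] E(1)])
  have sub: "snd c ` ?E \<subseteq> chart_range c" using im by blast
  have "emeasure vol ?E \<noteq> 0"
  proof
    assume "emeasure vol ?E = 0"
    then have 0: "(\<integral>\<^sup>+x. ennreal (\<rho> c x) * indicator (snd c ` ?E) x \<partial>lborel) = 0"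
      using emeasure_vol[OF c(1) _ E(2)] E(1) by simp
    have "(\<lambda>x. indicator (snd c ` ?E) x *\<^sub>R \<rho> c x) \<in> borel_measurable borel"
      by (rule borel_measurable_continuous_on_indicator)
         (use op continuous_on_subset[OF \<rho>_continuous[OF c(1)] sub] in auto)
    then have "(\<lambda>x. ennreal (indicator (snd c ` ?E) x *\<^sub>R \<rho> c x)) \<in> borel_measurable borel" by measurable
    moreover have "ennreal (indicator (snd c ` ?E) x *\<^sub>R \<rho> c x) = ennreal (\<rho> c x) * indicator (snd c ` ?E) x" for x
      by (simp add: indicator_def)
    ultimately have "(\<lambda>x. ennreal (\<rho> c x) * indicator (snd c ` ?E) x) \<in> borel_measurable lborel" by simp
    from nn_integral_0_iff_AE[OF this] 0
    have "AE x in lborel. ennreal (\<rho> c x) * indicator (snd c ` ?E) x = 0" by simp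
    then have "AE x in lborel. x \<notin> snd c ` ?E"
      by eventually_elim (use pos[OF c(1)] sub in \<open>force simp: indicator_def ennreal_eq_0_iff split: if_splits\<close>)
    then have "snd c ` ?E \<in> null_sets lborel" using op by (subst AE_iff_null_sets) auto
    then have "negligible (snd c ` ?E)"
      by (simp add: negligible_iff_null_sets null_sets_completionI)
    then show False using open_not_negligible[OF op] E(3) by blast
  qed
  moreover have "emeasure vol ?E \<le> emeasure vol V"
    by (rule emeasure_mono) (use V sets_vol in auto)
  ultimately show ?thesis by (metis le_zero_eq not_gr_zero)
qed

end

section \<open>Hamiltonian systems as volume-preserving flows\<close>

lemma hamiltonian_chart:
  assumes H: "hamiltonian_system atlas \<omega> H \<gamma>" and c: "c \<in> atlas"
  shows "hamiltonian_domain (chart_range c) (\<omega> c) (H \<circ> chart_inv c)"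
proof
  show "open (chart_range c)" using H c by (auto simp: hamiltonian_system_def smooth_atlas_def)
  show "smooth_on (chart_range c) (\<omega> c)" using H c by (auto simp: hamiltonian_system_def symplectic_form_def)
  show "smooth_on (chart_range c) (H \<circ> chart_inv c)" using H c by (auto simp: hamiltonian_system_def smooth_map_def)
  have s: "\<forall>x\<in>chart_range c. transpose (\<omega> c x) = - \<omega> c x \<and> det (\<omega> c x) \<noteq> 0 \<and>
           (\<forall>i j k. partial_deriv i (\<lambda>y. \<omega> c y $ j $ k) x
                  + partial_deriv j (\<lambda>y. \<omega> c y $ k $ i) x
                  + partial_deriv k (\<lambda>y. \<omega> c y $ i $ j) x = 0)"
    using H c unfolding hamiltonian_system_def symplectic_form_def by blast
  fix x assume x: "x \<in> chart_range c"
  show "transpose (\<omega> c x) = - \<omega> c x" "det (\<omega> c x) \<noteq> 0" using s x by blast+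
  fix i j k
  show "partial_deriv i (\<lambda>y. \<omega> c y $ j $ k) x + partial_deriv j (\<lambda>y. \<omega> c y $ k $ i) x
      + partial_deriv k (\<lambda>y. \<omega> c y $ i $ j) x = 0" using s x by blast
qed

theorem hamiltonian_liouville_flow:
  fixes atlas :: "('m::{second_countable_topology, t2_space}, 'n::finite) chart set"
  assumes H: "hamiltonian_system atlas \<omega> H \<gamma>" and vol: "liouville_measure atlas \<omega> vol"
  shows "liouville_flow atlas (\<lambda>c. hamiltonian_domain.X (\<omega> c) (H \<circ> chart_inv c))
     (\<lambda>c. hamiltonian_domain.J (\<omega> c) (H \<circ> chart_inv c)) \<gamma> vol (\<lambda>c x. sqrt (det (\<omega> c x)))"
    "\<And>c x. c \<in> atlas \<Longrightarrow> x \<in> chart_range c \<Longrightarrow> sqrt (det (\<omega> c x)) > 0"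
proof -
  have det_pos: "det (\<omega> c x) > 0" if "c \<in> atlas" "x \<in> chart_range c" for c x
    using skew_det_pos hamiltonian_domain.skew[OF hamiltonian_chart[OF H that(1)] that(2)]
      hamiltonian_domain.nondegenerate[OF hamiltonian_chart[OF H that(1)] that(2)] by blast
  then show "sqrt (det (\<omega> c x)) > 0" if "c \<in> atlas" "x \<in> chart_range c" for c x using that by simp
  have flow: "hamiltonian_flow atlas \<omega> H \<gamma>" and at: "smooth_atlas atlas" using H by (auto simp: hamiltonian_system_def)
  show "liouville_flow atlas (\<lambda>c. hamiltonian_domain.X (\<omega> c) (H \<circ> chart_inv c))
     (\<lambda>c. hamiltonian_domain.J (\<omega> c) (H \<circ> chart_inv c)) \<gamma> vol (\<lambda>c x. sqrt (det (\<omega> c x)))"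
  proof
    show "smooth_atlas atlas" by (rule at)
    show "\<gamma> m 0 = m" "continuous_on UNIV (\<gamma> m)" for m using flow by (auto simp: hamiltonian_flow_def)
    show "sets vol = sets borel" using vol by (simp add: liouville_measure_def)
    fix c assume c: "c \<in> atlas"
    interpret d: hamiltonian_domain "chart_range c" "\<omega> c" "H \<circ> chart_inv c" by (rule hamiltonian_chart[OF H c])
    show "(d.X has_derivative blinfun_apply (d.J x)) (at x)" if "x \<in> chart_range c" for x
      using d.X_has_derivative[OF that] d.J_apply[OF that] by simp
    show "continuous_on (chart_range c) d.J" by (rule d.J_continuous)
    show "((\<lambda>s. snd c (\<gamma> m s)) has_vector_derivative d.X (snd c (\<gamma> m t))) (at t)" if m: "\<gamma> m t \<in> fst c" for m t
    proof -
      obtain X where X: "((\<lambda>s. snd c (\<gamma> m s)) has_vector_derivative X) (at t)"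
        "\<And>j. (\<Sum>i\<in>UNIV. X $ i * \<omega> c (snd c (\<gamma> m t)) $ i $ j) = partial_deriv j (H \<circ> chart_inv c) (snd c (\<gamma> m t))"
        using flow c m unfolding hamiltonian_flow_def by blast
      have "snd c (\<gamma> m t) \<in> chart_range c" using m by (simp add: chart_range_def)
      from d.X_unique[OF this X(2)] show ?thesis using X(1) by simp
    qed
    show "emeasure vol E = (\<integral>\<^sup>+x\<in>snd c ` E. ennreal (sqrt (det (\<omega> c x))) \<partial>lborel)"
      if "E \<in> sets borel" "E \<subseteq> fst c" for E
      using vol c that unfolding liouville_measure_def by blast
    show "continuous_on (chart_range c) (\<lambda>x. sqrt (det (\<omega> c x)))"
      by (intro continuous_intros continuous_on_det) (use d.w_continuous in \<open>auto intro!: continuous_intros\<close>)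
    show "0 \<le> sqrt (det (\<omega> c x))" if "x \<in> chart_range c" for x using det_pos[OF c that] by simp
    show "\<bar>det (matrix (blinfun_apply (Y t)))\<bar> * sqrt (det (\<omega> c (y t))) = sqrt (det (\<omega> c (y 0)))"
      if "Y 0 = id_blinfun" "\<And>t. t \<in> {0..h} \<Longrightarrow> y t \<in> chart_range c"
        "\<And>t. t \<in> {0..h} \<Longrightarrow> (y has_vector_derivative d.X (y t)) (at t within {0..h})"
        "\<And>t. t \<in> {0..h} \<Longrightarrow> (Y has_vector_derivative (d.J (y t) o\<^sub>L Y t)) (at t within {0..h})"
        "t \<in> {0..h}" for Y h y t
      using that by (rule d.jacobian_density)
  qed
qed

section \<open>Time averages of stationary processes\<close>

text \<open>The variables \<open>a t\<close> need not be square integrable: \<open>a 0 * a t\<close> is integrable for almost every \<open>t\<close> only,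
  and the correlation \<open>c t\<close> below is 0 for the other \<open>t\<close>.\<close>

locale stationary_process = sigma_finite_measure M for M :: "'a measure" +
  fixes a :: "real \<Rightarrow> 'a \<Rightarrow> real"
  assumes a_measurable [measurable]: "(\<lambda>(t, x). a t x) \<in> borel_measurable (lborel \<Otimes>\<^sub>M M)"
    and stationary_abs: "0 \<le> s \<Longrightarrow> s \<le> t \<Longrightarrow>
      (\<integral>\<^sup>+x. ennreal \<bar>a s x * a t x\<bar> \<partial>M) = (\<integral>\<^sup>+x. ennreal \<bar>a 0 x * a (t - s) x\<bar> \<partial>M)"
    and stationary: "0 \<le> s \<Longrightarrow> s \<le> t \<Longrightarrow> (\<integral>x. a s x * a t x \<partial>M) = (\<integral>x. a 0 x * a (t - s) x \<partial>M)"
    and correlation_finite: "T > 0 \<Longrightarrow>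
      (\<integral>\<^sup>+t. indicator {0..T} t * (\<integral>\<^sup>+x. ennreal \<bar>a 0 x * a t x\<bar> \<partial>M) \<partial>lborel) < \<infinity>"
begin

text \<open>The mean correlation is \<open>u T / T\<close>, and
  \<open>\<parallel>S T\<parallel>\<^sup>2 = 2 * I T\<close>. The function \<open>C\<close> takes
  the correlation of absolute values in \<open>[0, \<infinity>]\<close>; its local integrability
  justifies every exchange of integrals.\<close>

definition c :: "real \<Rightarrow> real" where "c t = (\<integral>x. a 0 x * a t x \<partial>M)"
definition u :: "real \<Rightarrow> real" where "u T = integral {0..T} c"
definition I :: "real \<Rightarrow> real" where "I T = integral {0..T} u"
definition S :: "real \<Rightarrow> 'a \<Rightarrow> real" where "S T x = (LINT t:{0..T}|lborel. a t x)"
definition C :: "real \<Rightarrow> ennreal" where "C t = (\<integral>\<^sup>+x. ennreal \<bar>a 0 x * a t x\<bar> \<partial>M)"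

sublocale P: pair_sigma_finite lborel M
  by unfold_locales

lemma a_measurable1 [measurable]: "a t \<in> borel_measurable M"
  using measurable_compose[OF measurable_Pair1' a_measurable, of t] by simp

lemma C_measurable [measurable]: "C \<in> borel_measurable borel"
  unfolding C_def[abs_def] by measurable

lemma c_measurable [measurable]: "c \<in> borel_measurable borel"
  unfolding c_def[abs_def] by measurable

lemma S_measurable [measurable]: "S T \<in> borel_measurable M"
  unfolding S_def[abs_def] set_lebesgue_integral_def by measurable

lemma C_finite: "(\<integral>\<^sup>+t. indicator {0..T} t * C t \<partial>lborel) < \<infinity>"
proof -
  have "(\<integral>\<^sup>+t. indicator {0..T} t * C t \<partial>lborel) \<le> (\<integral>\<^sup>+t. indicator {0..max 1 T} t * C t \<partial>lborel)"
    by (intro nn_integral_mono) (auto simp: indicator_def)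
  also have "\<dots> < \<infinity>" unfolding C_def by (rule correlation_finite) simp
  finally show ?thesis .
qed

lemma correlation_abs:
  assumes "0 \<le> s" "0 \<le> t" shows "(\<integral>\<^sup>+x. ennreal \<bar>a s x * a t x\<bar> \<partial>M) = C \<bar>t - s\<bar>"
  using stationary_abs[of s t] stationary_abs[of t s] assms unfolding C_def
  by (cases "s \<le> t") (auto simp: mult.commute)

lemma correlation:
  assumes "0 \<le> s" "0 \<le> t" shows "(\<integral>x. a s x * a t x \<partial>M) = c \<bar>t - s\<bar>"
  using stationary[of s t] stationary[of t s] assms unfolding c_def
  by (cases "s \<le> t") (auto simp: mult.commute)

text \<open>Splitting at \<open>t = s\<close> gives a reflected and a translated copy of
  \<open>C\<close>. The translated one extends up to \<open>s + T\<close>, hence only an inequality,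
  which suffices for finiteness.\<close>

lemma C_shift:
  assumes "0 \<le> s"
  shows "(\<integral>\<^sup>+t. indicator {0..T} t * C \<bar>t - s\<bar> \<partial>lborel)
    \<le> (\<integral>\<^sup>+t. indicator {0..s} t * C t \<partial>lborel) + (\<integral>\<^sup>+t. indicator {0..T} t * C t \<partial>lborel)"
proof -
  have "(\<integral>\<^sup>+t. indicator {0..T} t * C \<bar>t - s\<bar> \<partial>lborel)
    \<le> (\<integral>\<^sup>+t. indicator {0..s} (s + (-1) * t) * C (s + (-1) * t) + indicator {0..T} (- s + 1 * t) * C (- s + 1 * t) \<partial>lborel)"
    by (rule nn_integral_mono) (use assms in \<open>auto simp: indicator_def abs_if add.commute\<close>)
  also have "\<dots> = (\<integral>\<^sup>+t. indicator {0..s} (s + (-1) * t) * C (s + (-1) * t) \<partial>lborel)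
     + (\<integral>\<^sup>+t. indicator {0..T} (- s + 1 * t) * C (- s + 1 * t) \<partial>lborel)"
    by (rule nn_integral_add) auto
  also have "(\<integral>\<^sup>+t. indicator {0..s} (s + (-1) * t) * C (s + (-1) * t) \<partial>lborel) = (\<integral>\<^sup>+t. indicator {0..s} t * C t \<partial>lborel)"
    using nn_integral_real_affine[of "\<lambda>t. indicator {0..s} t * C t" "-1" s] by simp
  also have "(\<integral>\<^sup>+t. indicator {0..T} (- s + 1 * t) * C (- s + 1 * t) \<partial>lborel) = (\<integral>\<^sup>+t. indicator {0..T} t * C t \<partial>lborel)"
    using nn_integral_real_affine[of "\<lambda>t. indicator {0..T} t * C t" 1 "- s"] by simp
  finally show ?thesis .
qed

lemma integrable_product_single:
  assumes s: "0 \<le> s"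
  shows "integrable (lborel \<Otimes>\<^sub>M M) (\<lambda>(t, x). indicator {0..T} t * (a s x * a t x))"
proof (rule integrableI_bounded)
  have "(\<integral>\<^sup>+p. ennreal (norm (case p of (t, x) \<Rightarrow> indicator {0..T} t * (a s x * a t x))) \<partial>(lborel \<Otimes>\<^sub>M M))
    = (\<integral>\<^sup>+t. \<integral>\<^sup>+x. ennreal (norm (indicator {0..T} t * (a s x * a t x))) \<partial>M \<partial>lborel)"
    by (subst nn_integral_fst[symmetric]) auto
  also have "\<dots> = (\<integral>\<^sup>+t. indicator {0..T} t * C \<bar>t - s\<bar> \<partial>lborel)"
  proof (rule nn_integral_cong)
    fix t :: real
    show "(\<integral>\<^sup>+x. ennreal (norm (indicator {0..T} t * (a s x * a t x))) \<partial>M) = indicator {0..T} t * C \<bar>t - s\<bar>"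
      using correlation_abs[OF s, of t] by (auto simp: indicator_def)
  qed
  also have "\<dots> < \<infinity>"
    using C_shift[OF s, of T] C_finite by (auto simp: order_le_less_trans)
  finally show "(\<integral>\<^sup>+p. ennreal (norm (case p of (t, x) \<Rightarrow> indicator {0..T} t * (a s x * a t x))) \<partial>(lborel \<Otimes>\<^sub>M M)) < \<infinity>" .
qed measurable

lemma c_integrable: "set_integrable lborel {0..T} c"
proof -
  have "integrable lborel (\<lambda>t. \<integral>x. indicator {0..T} t * (a 0 x * a t x) \<partial>M)"
    using P.integrable_fst[OF integrable_product_single[of 0 T]] by simp
  then show ?thesis by (simp add: set_integrable_def c_def)
qed

lemma c_integrable_on: "c integrable_on {0..T}"
  using set_borel_integral_eq_integral(1)[OF c_integrable] .

lemma u_eq: "(LINT t:{0..T}|lborel. c t) = u T"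
  unfolding u_def by (rule set_borel_integral_eq_integral(2)[OF c_integrable])

lemma c_shift:
  assumes s: "0 \<le> s" "s \<le> T"
  shows "(\<integral>t. indicator {0..T} t * c \<bar>t - s\<bar> \<partial>lborel) = u s + u (T - s)"
proof -
  \<comment> \<open>Half-open on one side, so that \<open>t = s\<close> is counted once after
    reflection and translation.\<close>
  let ?g1 = "\<lambda>v. indicator {0<..s} v * c v" and ?g2 = "\<lambda>v. indicator {0..T - s} v * c v"
  have "set_integrable lborel {0<..s} c" by (rule set_integrable_subset[OF c_integrable[of s]]) auto
  then have g1: "integrable lborel ?g1" by (simp add: set_integrable_def)
  have g2: "integrable lborel ?g2" using c_integrable[of "T - s"] by (simp add: set_integrable_def)
  have "(\<integral>t. indicator {0..T} t * c \<bar>t - s\<bar> \<partial>lborel) = (\<integral>t. ?g1 (s + (-1) * t) + ?g2 (- s + 1 * t) \<partial>lborel)"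
    by (rule Bochner_Integration.integral_cong) (use s in \<open>auto simp: indicator_def abs_if add.commute\<close>)
  also have "\<dots> = (\<integral>t. ?g1 (s + (-1) * t) \<partial>lborel) + (\<integral>t. ?g2 (- s + 1 * t) \<partial>lborel)"
    by (rule Bochner_Integration.integral_add) (rule lborel_integrable_real_affine[OF g1] lborel_integrable_real_affine[OF g2]; simp)+
  also have "(\<integral>t. ?g1 (s + (-1) * t) \<partial>lborel) = (\<integral>t. ?g1 t \<partial>lborel)"
    using lborel_integral_real_affine[of "-1" ?g1 s] by simp
  also have "(\<integral>t. ?g2 (- s + 1 * t) \<partial>lborel) = (\<integral>t. ?g2 t \<partial>lborel)"
    using lborel_integral_real_affine[of 1 ?g2 "- s"] by simp
  also have "(\<integral>t. ?g1 t \<partial>lborel) = (\<integral>t. indicator {0..s} t * c t \<partial>lborel)"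
  proof (rule integral_cong_AE)
    show "AE v in lborel. ?g1 v = indicator {0..s} v * c v"
      using AE_lborel_singleton[of 0] by eventually_elim (auto simp: indicator_def)
  qed auto
  also have "\<dots> = u s" using u_eq[of s] by (simp add: set_lebesgue_integral_def)
  also have "(\<integral>t. ?g2 t \<partial>lborel) = u (T - s)" using u_eq[of "T - s"] by (simp add: set_lebesgue_integral_def)
  finally show ?thesis .
qed

lemma integral_single_S:
  assumes s: "0 \<le> s" "s \<le> T"
  shows "integrable M (\<lambda>x. a s x * S T x)" "(\<integral>x. a s x * S T x \<partial>M) = u s + u (T - s)"
proof -
  note int = integrable_product_single[OF s(1), of T]
  have eq: "(\<integral>t. indicator {0..T} t * (a s x * a t x) \<partial>lborel) = a s x * S T x" for x
  proof -
    have "(\<integral>t. indicator {0..T} t * (a s x * a t x) \<partial>lborel) = (\<integral>t. a s x * (indicator {0..T} t * a t x) \<partial>lborel)"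
      by (simp add: mult.left_commute)
    then show ?thesis by (simp add: S_def set_lebesgue_integral_def)
  qed
  show "integrable M (\<lambda>x. a s x * S T x)" using P.integrable_snd[OF int] by (simp add: eq)
  have "(\<integral>x. a s x * S T x \<partial>M) = (\<integral>t. \<integral>x. indicator {0..T} t * (a s x * a t x) \<partial>M \<partial>lborel)"
    using P.Fubini_integral[OF int] by (simp add: eq)
  also have "\<dots> = (\<integral>t. indicator {0..T} t * c \<bar>t - s\<bar> \<partial>lborel)"
    by (rule Bochner_Integration.integral_cong) (use correlation[OF s(1)] in \<open>auto simp: indicator_def\<close>)
  finally show "(\<integral>x. a s x * S T x \<partial>M) = u s + u (T - s)" using c_shift[OF s] by simp
qed

lemma u_continuous: "continuous_on {0..T} u"
  unfolding u_def using indefinite_integral_continuous_1[OF c_integrable_on] by simp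

lemma I_derivative: "t \<in> {0..T} \<Longrightarrow> (I has_vector_derivative u t) (at t within {0..T})"
  unfolding I_def by (rule integral_has_vector_derivative[OF u_continuous])

lemma integral_u_reflect:
  assumes P: "0 \<le> P" "P \<le> T"
  shows "((\<lambda>s. u s + u (T - s)) has_integral (I P + I T - I (T - P))) {0..P}"
proof -
  have "((\<lambda>s. u (T - s)) has_integral ((\<lambda>s. - I (T - s)) P - (\<lambda>s. - I (T - s)) 0)) {0..P}"
  proof (rule fundamental_theorem_of_calculus)
    fix s assume s: "s \<in> {0..P}"
    have "((\<lambda>s. T - s) has_vector_derivative - 1) (at s within {0..P})" by (auto intro!: derivative_eq_intros)
    moreover have "(I has_vector_derivative u (T - s)) (at (T - s) within (\<lambda>s. T - s) ` {0..P})"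
      by (rule has_vector_derivative_within_subset[OF I_derivative[of _ T]]) (use s P in auto)
    ultimately have "(I \<circ> (\<lambda>s. T - s) has_vector_derivative - 1 *\<^sub>R u (T - s)) (at s within {0..P})"
      by (rule vector_diff_chain_within)
    then show "((\<lambda>s. - I (T - s)) has_vector_derivative u (T - s)) (at s within {0..P})"
      using has_vector_derivative_minus by (fastforce simp: o_def)
  qed (use P in auto)
  then have 2: "((\<lambda>s. u (T - s)) has_integral (I T - I (T - P))) {0..P}" by simp
  have "(u has_integral I P) {0..P}"
    unfolding I_def by (rule integrable_integral[OF integrable_continuous_real[OF u_continuous]])
  from has_integral_add[OF this 2] show ?thesis by (simp add: algebra_simps)
qed

text \<open>Where the path is not integrable on \<open>{0..T}\<close>, the Bochner integral is 0 and
  the bound is trivial.\<close>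

lemma abs_S_le: "ennreal \<bar>S T x\<bar> \<le> (\<integral>\<^sup>+t. indicator {0..T} t * ennreal \<bar>a t x\<bar> \<partial>lborel)"
proof (cases "integrable lborel (\<lambda>t. indicator {0..T} t * a t x)")
  case True
  have "ennreal \<bar>S T x\<bar> \<le> (\<integral>\<^sup>+t. ennreal (norm (indicator {0..T} t * a t x)) \<partial>lborel)"
    using integral_norm_bound_ennreal[OF True] by (simp add: S_def set_lebesgue_integral_def)
  also have "\<dots> = (\<integral>\<^sup>+t. indicator {0..T} t * ennreal \<bar>a t x\<bar> \<partial>lborel)"
    by (rule nn_integral_cong) (auto simp: indicator_def)
  finally show ?thesis .
next
  case False
  then show ?thesis by (simp add: S_def set_lebesgue_integral_def not_integrable_integral_eq)
qed

text \<open>By Tonelli's theorem, local integrability of \<open>C\<close> alone makes the time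
  integrals square integrable, even where \<open>a t\<close> itself is not. Integrating
  \<open>integral_single_S\<close> over \<open>{0..P}\<close> gives the value, in which only the
  numerical function \<open>I\<close> occurs.\<close>

lemma integral_S_S:
  assumes P: "0 \<le> P" "P \<le> T"
  shows "integrable M (\<lambda>x. S P x * S T x)" "(\<integral>x. S P x * S T x \<partial>M) = I P + I T - I (T - P)"
proof -
  let ?B = "(\<integral>\<^sup>+t. indicator {0..T} t * C t \<partial>lborel)"
  have bound: "(\<integral>\<^sup>+x. ennreal \<bar>a s x * S T x\<bar> \<partial>M) \<le> ?B + ?B" if s: "0 \<le> s" "s \<le> P" for s
  proof -
    have "(\<integral>\<^sup>+x. ennreal \<bar>a s x * S T x\<bar> \<partial>M)
      \<le> (\<integral>\<^sup>+x. ennreal \<bar>a s x\<bar> * (\<integral>\<^sup>+t. indicator {0..T} t * ennreal \<bar>a t x\<bar> \<partial>lborel) \<partial>M)"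
      by (rule nn_integral_mono) (use abs_S_le in \<open>auto simp: abs_mult ennreal_mult intro!: mult_left_mono\<close>)
    also have "\<dots> = (\<integral>\<^sup>+x. \<integral>\<^sup>+t. ennreal \<bar>a s x\<bar> * (indicator {0..T} t * ennreal \<bar>a t x\<bar>) \<partial>lborel \<partial>M)"
      by (intro nn_integral_cong nn_integral_cmult[symmetric]) auto
    also have "\<dots> = (\<integral>\<^sup>+t. \<integral>\<^sup>+x. ennreal \<bar>a s x\<bar> * (indicator {0..T} t * ennreal \<bar>a t x\<bar>) \<partial>M \<partial>lborel)"
      by (rule P.Fubini') measurable
    also have "\<dots> = (\<integral>\<^sup>+t. indicator {0..T} t * C \<bar>t - s\<bar> \<partial>lborel)"
    proof (rule nn_integral_cong)
      fix t
      show "(\<integral>\<^sup>+x. ennreal \<bar>a s x\<bar> * (indicator {0..T} t * ennreal \<bar>a t x\<bar>) \<partial>M) = indicator {0..T} t * C \<bar>t - s\<bar>"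
        using correlation_abs[OF s(1), of t] by (auto simp: indicator_def abs_mult ennreal_mult)
    qed
    also have "\<dots> \<le> (\<integral>\<^sup>+t. indicator {0..s} t * C t \<partial>lborel) + ?B" by (rule C_shift[OF s(1)])
    also have "\<dots> \<le> ?B + ?B"
      by (intro add_right_mono nn_integral_mono) (use s P in \<open>auto simp: indicator_def\<close>)
    finally show ?thesis .
  qed
  have int: "integrable (lborel \<Otimes>\<^sub>M M) (\<lambda>(s, x). indicator {0..P} s * (a s x * S T x))"
  proof (rule integrableI_bounded)
    have "(\<integral>\<^sup>+p. ennreal (norm (case p of (s, x) \<Rightarrow> indicator {0..P} s * (a s x * S T x))) \<partial>(lborel \<Otimes>\<^sub>M M))
      = (\<integral>\<^sup>+s. \<integral>\<^sup>+x. ennreal (norm (indicator {0..P} s * (a s x * S T x))) \<partial>M \<partial>lborel)"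
      by (subst nn_integral_fst[symmetric]) auto
    also have "\<dots> \<le> (\<integral>\<^sup>+s. (?B + ?B) * indicator {0..P} s \<partial>lborel)"
    proof (rule nn_integral_mono)
      fix s
      show "(\<integral>\<^sup>+x. ennreal (norm (indicator {0..P} s * (a s x * S T x))) \<partial>M) \<le> (?B + ?B) * indicator {0..P} s"
        using bound[of s] by (auto simp: indicator_def)
    qed
    also have "\<dots> = (?B + ?B) * ennreal P" using P by (subst nn_integral_cmult_indicator) auto
    also have "\<dots> < \<infinity>" using C_finite[of T] by (auto simp: ennreal_mult_less_top)
    finally show "(\<integral>\<^sup>+p. ennreal (norm (case p of (s, x) \<Rightarrow> indicator {0..P} s * (a s x * S T x))) \<partial>(lborel \<Otimes>\<^sub>M M)) < \<infinity>" .
  qed measurable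
  have eq: "(\<integral>s. indicator {0..P} s * (a s x * S T x) \<partial>lborel) = S P x * S T x" for x
  proof -
    have "(\<integral>s. indicator {0..P} s * (a s x * S T x) \<partial>lborel) = (\<integral>s. (indicator {0..P} s * a s x) * S T x \<partial>lborel)"
      by (simp add: mult.assoc)
    then show ?thesis by (simp add: S_def[of P] set_lebesgue_integral_def)
  qed
  show "integrable M (\<lambda>x. S P x * S T x)" using P.integrable_snd[OF int] by (simp add: eq)
  have "(\<integral>x. S P x * S T x \<partial>M) = (\<integral>s. \<integral>x. indicator {0..P} s * (a s x * S T x) \<partial>M \<partial>lborel)"
    using P.Fubini_integral[OF int] by (simp add: eq)
  also have "\<dots> = (\<integral>s. indicator {0..P} s * (u s + u (T - s)) \<partial>lborel)"
    by (rule Bochner_Integration.integral_cong) (use integral_single_S(2)[of _ T] P in \<open>auto simp: indicator_def\<close>)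
  also have "\<dots> = (LINT s:{0..P}|lborel. u s + u (T - s))" by (simp add: set_lebesgue_integral_def)
  also have "\<dots> = integral {0..P} (\<lambda>s. u s + u (T - s))"
  proof (rule set_borel_integral_eq_integral)
    have "continuous_on {0..P} (\<lambda>s. u s + u (T - s))"
      by (intro continuous_intros continuous_on_subset[OF u_continuous[of T]] continuous_on_compose2[OF u_continuous[of T]])
         (use P in auto)
    then show "set_integrable lborel {0..P} (\<lambda>s. u s + u (T - s))"
      by (rule borel_integrable_atLeastAtMost')
  qed
  also have "\<dots> = I P + I T - I (T - P)" using integral_u_reflect[OF P] by (rule integral_unique)
  finally show "(\<integral>x. S P x * S T x \<partial>M) = I P + I T - I (T - P)" .
qed


lemma I_0 [simp]: "I 0 = 0" and u_0 [simp]: "u 0 = 0"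
  by (simp_all add: I_def u_def)

lemma u_diff:
  assumes "0 \<le> p" "p \<le> q" shows "u q - u p = integral {p..q} c"
  unfolding u_def using Henstock_Kurzweil_Integration.integral_combine[OF assms c_integrable_on] by simp

lemma I_diff_bounds:
  assumes pq: "0 \<le> p" "p \<le> q" and b: "\<And>s. s \<in> {p..q} \<Longrightarrow> l \<le> u s \<and> u s \<le> r"
  shows "l * (q - p) \<le> I q - I p" "I q - I p \<le> r * (q - p)"
proof -
  have int: "u integrable_on {0..q}" by (rule integrable_continuous_real[OF u_continuous])
  have "I q - I p = integral {p..q} u"
    unfolding I_def using Henstock_Kurzweil_Integration.integral_combine[OF pq int] by simp
  then have "(u has_integral (I q - I p)) {p..q}"
    using integrable_subinterval_real[OF int, of p q] pq by (simp add: has_integral_integral)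
  moreover have "((\<lambda>_. l) has_integral (l * (q - p))) {p..q}" "((\<lambda>_. r) has_integral (r * (q - p))) {p..q}"
    using has_integral_const_real[of l p q] has_integral_const_real[of r p q] pq by (auto simp: mult.commute)
  ultimately show "l * (q - p) \<le> I q - I p" "I q - I p \<le> r * (q - p)"
    using b by (auto intro: has_integral_le)
qed

text \<open>Positive semidefiniteness of the Gram matrix of \<open>S p\<close>, \<open>S q\<close>,
  \<open>S r\<close>. This is the form in which Hilbert space geometry enters the limit
  theorem.\<close>

lemma quadratic_form_nonneg:
  assumes "0 \<le> p" "p \<le> q" "q \<le> r"
  shows "0 \<le> \<alpha>\<^sup>2 * (2 * I p) + \<beta>\<^sup>2 * (2 * I q) + \<delta>\<^sup>2 * (2 * I r) + 2 * \<alpha> * \<beta> * (I p + I q - I (q - p))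
    + 2 * \<alpha> * \<delta> * (I p + I r - I (r - p)) + 2 * \<beta> * \<delta> * (I q + I r - I (r - q))"
proof -
  note i = integral_S_S[of p p] integral_S_S[of q q] integral_S_S[of r r]
    integral_S_S[of p q] integral_S_S[of p r] integral_S_S[of q r]
  have "0 \<le> (\<integral>x. (\<alpha> * S p x + \<beta> * S q x + \<delta> * S r x)\<^sup>2 \<partial>M)" by simp
  also have "\<dots> = (\<integral>x. \<alpha>\<^sup>2 * (S p x * S p x) + \<beta>\<^sup>2 * (S q x * S q x) + \<delta>\<^sup>2 * (S r x * S r x)
     + 2 * \<alpha> * \<beta> * (S p x * S q x) + 2 * \<alpha> * \<delta> * (S p x * S r x) + 2 * \<beta> * \<delta> * (S q x * S r x) \<partial>M)"
    by (intro Bochner_Integration.integral_cong) (auto simp: power2_eq_square algebra_simps)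
  also have "\<dots> = \<alpha>\<^sup>2 * (2 * I p) + \<beta>\<^sup>2 * (2 * I q) + \<delta>\<^sup>2 * (2 * I r) + 2 * \<alpha> * \<beta> * (I p + I q - I (q - p))
    + 2 * \<alpha> * \<delta> * (I p + I r - I (r - p)) + 2 * \<beta> * \<delta> * (I q + I r - I (r - q))"
    using i assms by simp
  finally show ?thesis .
qed

lemma abs_process: "stationary_process M (\<lambda>t x. \<bar>a t x\<bar>)"
proof unfold_locales
  show "(\<lambda>(t, x). \<bar>a t x\<bar>) \<in> borel_measurable (lborel \<Otimes>\<^sub>M M)" by measurable
  show nn: "(\<integral>\<^sup>+x. ennreal \<bar>\<bar>a s x\<bar> * \<bar>a t x\<bar>\<bar> \<partial>M) = (\<integral>\<^sup>+x. ennreal \<bar>\<bar>a 0 x\<bar> * \<bar>a (t - s) x\<bar>\<bar> \<partial>M)"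
    if "0 \<le> s" "s \<le> t" for s t
    using stationary_abs[OF that] by (simp add: abs_mult)
  show "(\<integral>x. \<bar>a s x\<bar> * \<bar>a t x\<bar> \<partial>M) = (\<integral>x. \<bar>a 0 x\<bar> * \<bar>a (t - s) x\<bar> \<partial>M)" if "0 \<le> s" "s \<le> t" for s t
    using nn[OF that] by (simp add: integral_eq_nn_integral)
  show "(\<integral>\<^sup>+t. indicator {0..T} t * (\<integral>\<^sup>+x. ennreal \<bar>\<bar>a 0 x\<bar> * \<bar>a t x\<bar>\<bar> \<partial>M) \<partial>lborel) < \<infinity>" if "T > 0" for T
    using correlation_finite[OF that] by (simp add: abs_mult)
qed

text \<open>The correlation of the time integrals over \<open>[0, 1]\<close> and \<open>[t, t + 2]\<close> dominates \<open>u (t + 1) - u t\<close>. It is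
  bounded uniformly in \<open>t\<close>, since both are square integrable with norms that do not depend on \<open>t\<close>.\<close>

lemma nonneg_growth:
  assumes nonneg: "\<And>t x. a t x \<ge> 0"
  obtains K where "K \<ge> 0" "\<And>p q. 0 \<le> p \<Longrightarrow> p \<le> q \<Longrightarrow> u q - u p \<le> K * (q - p + 1)"
    "\<And>p q. 0 \<le> p \<Longrightarrow> p \<le> q \<Longrightarrow> u p \<le> u q"
proof -
  have c0: "c t \<ge> 0" for t unfolding c_def using nonneg by (intro integral_nonneg_AE) auto
  have mono: "u p \<le> u q" if "0 \<le> p" "p \<le> q" for p q
  proof -
    have "0 \<le> integral {p..q} c"
      using integrable_subinterval_real[OF c_integrable_on[of q], of p q] that c0
      by (intro Henstock_Kurzweil_Integration.integral_nonneg) auto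
    then show ?thesis using u_diff[OF that] by linarith
  qed
  have u0: "u p \<ge> 0" if "0 \<le> p" for p using mono[of 0 p] that by simp
  have I0: "I p \<ge> 0" if "0 \<le> p" for p using I_diff_bounds(1)[of 0 p 0 "u p"] that u0 mono by auto
  have far: "u (t + 1) - u t \<le> I 1 + I 2" if t: "t \<ge> 1" for t
  proof -
    note i = integral_S_S[of 1 1] integral_S_S[of 1 "t + 2"] integral_S_S[of 1 t] integral_S_S[of t t]
      integral_S_S[of "t + 2" "t + 2"] integral_S_S[of t "t + 2"]
    \<comment> \<open>The inequality \<open>2 * x * y \<le> x\<^sup>2 + y\<^sup>2\<close> for
      \<open>x = S 1\<close> and \<open>y = S (t + 2) - S t\<close>, whose squared norm is
      \<open>2 * I 2\<close> for every \<open>t\<close>.\<close>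
    have "(\<integral>x. 2 * (S 1 x * S (t + 2) x) - 2 * (S 1 x * S t x) \<partial>M)
      \<le> (\<integral>x. S 1 x * S 1 x + S (t + 2) x * S (t + 2) x + S t x * S t x - 2 * (S t x * S (t + 2) x) \<partial>M)"
    proof (rule integral_mono)
      fix x
      have "0 \<le> (S 1 x - S (t + 2) x + S t x)\<^sup>2" by simp
      then show "2 * (S 1 x * S (t + 2) x) - 2 * (S 1 x * S t x)
        \<le> S 1 x * S 1 x + S (t + 2) x * S (t + 2) x + S t x * S t x - 2 * (S t x * S (t + 2) x)"
        by (simp add: power2_eq_square algebra_simps)
    qed (use i t in auto)
    then have "2 * (I 1 + I (t + 2) - I (t + 1)) - 2 * (I 1 + I t - I (t - 1))
      \<le> 2 * I 1 + 2 * I (t + 2) + 2 * I t - 2 * (I t + I (t + 2) - I 2)"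
      using i t by (simp add: add.commute)
    moreover have "u (t + 1) * (t + 2 - (t + 1)) \<le> I (t + 2) - I (t + 1)"
      by (rule I_diff_bounds(1)[where r = "u (t + 2)"]) (use t mono in auto)
    moreover have "I t - I (t - 1) \<le> u t * (t - (t - 1))"
      by (rule I_diff_bounds(2)[where l = "u (t - 1)"]) (use t mono in auto)
    ultimately show ?thesis by simp
  qed
  \<comment> \<open>The estimate \<open>far\<close> starts at \<open>t = 1\<close>; for
    \<open>p < 1\<close> the increment is at most \<open>u 2\<close>, because then
    \<open>q \<le> 2\<close>.\<close>
  define K where "K = I 1 + I 2 + u 2"
  have K: "K \<ge> 0" using I0 u0 by (simp add: K_def)
  have step: "u q - u p \<le> K" if "0 \<le> p" "p \<le> q" "q \<le> p + 1" for p q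
  proof (cases "p \<ge> 1")
    case True
    then show ?thesis using far[of p] mono[of q "p + 1"] u0[of 2] that by (simp add: K_def)
  next
    case False
    then show ?thesis using mono[of q 2] u0[of p] I0[of 1] I0[of 2] that by (simp add: K_def)
  qed
  have steps: "u q - u p \<le> K * real n" if "0 \<le> p" "p \<le> q" "q \<le> p + real n" for p q n
    using that
  proof (induction n arbitrary: q)
    case 0
    then show ?case by simp
  next
    case (Suc n)
    show ?case
    proof (cases "q \<le> p + real n")
      case True
      then show ?thesis using Suc K by (smt (verit) mult_left_mono of_nat_le_iff le_SucI order_refl)
    next
      case False
      then have "u q - u (p + real n) \<le> K" using Suc.prems by (intro step) auto
      moreover have "u (p + real n) - u p \<le> K * real n" using Suc.prems by (intro Suc.IH) auto
      ultimately show ?thesis by (simp add: algebra_simps)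
    qed
  qed
  show ?thesis
  proof (rule that[OF K _ mono])
    fix p q :: real assume pq: "0 \<le> p" "p \<le> q"
    have "u q - u p \<le> K * real (nat \<lceil>q - p\<rceil>)" using pq by (intro steps) linarith+
    also have "\<dots> \<le> K * (q - p + 1)" using pq K by (intro mult_left_mono) linarith+
    finally show "u q - u p \<le> K * (q - p + 1)" .
  qed
qed

text \<open>\<open>\<bar>c\<bar>\<close> is dominated by the correlation of the absolute process, so
  the increments of \<open>u\<close> are dominated by those of its monotone counterpart
  \<open>h.u\<close>, to which \<open>nonneg_growth\<close> applies.\<close>

lemma growth:
  obtains K where "K \<ge> 0" "\<And>p q s. 0 \<le> p \<Longrightarrow> s \<in> {p..q} \<Longrightarrow> \<bar>u s - u p\<bar> \<le> K * (q - p + 1) \<and> \<bar>u q - u s\<bar> \<le> K * (q - p + 1)"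
proof -
  interpret h: stationary_process M "\<lambda>t x. \<bar>a t x\<bar>" by (rule abs_process)
  obtain K where K: "K \<ge> 0" "\<And>p q. 0 \<le> p \<Longrightarrow> p \<le> q \<Longrightarrow> h.u q - h.u p \<le> K * (q - p + 1)"
    "\<And>p q. 0 \<le> p \<Longrightarrow> p \<le> q \<Longrightarrow> h.u p \<le> h.u q"
    using h.nonneg_growth by auto
  have c_le: "\<bar>c t\<bar> \<le> h.c t" for t
    unfolding c_def h.c_def using integral_abs_bound[of M "\<lambda>x. a 0 x * a t x"] by (simp add: abs_mult)
  have inc: "\<bar>u q - u p\<bar> \<le> h.u q - h.u p" if "0 \<le> p" "p \<le> q" for p q
  proof -
    have "norm (integral {p..q} c) \<le> integral {p..q} h.c"
      by (rule integral_norm_bound_integral)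
         (use integrable_subinterval_real[OF c_integrable_on[of q], of p q]
            integrable_subinterval_real[OF h.c_integrable_on[of q], of p q] that c_le in auto)
    then show ?thesis using u_diff[OF that] h.u_diff[OF that] by simp
  qed
  show ?thesis
  proof (rule that[OF K(1)])
    fix p q s :: real assume "0 \<le> p" "s \<in> {p..q}"
    then show "\<bar>u s - u p\<bar> \<le> K * (q - p + 1) \<and> \<bar>u q - u s\<bar> \<le> K * (q - p + 1)"
      using inc[of p s] inc[of s q] K(2)[of p q] K(3)[of p s] K(3)[of s q] by auto
  qed
qed

text \<open>The expression \<open>I p + I q - I (q - p)\<close> is
  \<open>\<langle>S p, S q\<rangle>\<close>. Over an interval of length \<open>p\<close> the
  function \<open>u\<close> varies by at most \<open>K * (p + 1)\<close>, so
  \<open>I q - I (q - p)\<close> differs from \<open>p * u q\<close> by at most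
  \<open>K * (p + 1) * p\<close>, and \<open>I p\<close> has the same bound. For
  \<open>p \<ge> 1\<close> both together are at most \<open>4 * K * p\<^sup>2\<close>.\<close>

lemma mean_growth:
  obtains K where "K \<ge> 0" "\<And>T. 1 \<le> T \<Longrightarrow> \<bar>u T\<bar> \<le> K * T"
    "\<And>p q. 1 \<le> p \<Longrightarrow> p \<le> q \<Longrightarrow> \<bar>(I p + I q - I (q - p)) - p * u q\<bar> \<le> K * p\<^sup>2"
proof -
  obtain K where K: "K \<ge> 0" "\<And>p q s. 0 \<le> p \<Longrightarrow> s \<in> {p..q} \<Longrightarrow> \<bar>u s - u p\<bar> \<le> K * (q - p + 1) \<and> \<bar>u q - u s\<bar> \<le> K * (q - p + 1)"
    using growth by blast
  show ?thesis
  proof (rule that[of "4 * K"])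
    show "4 * K \<ge> 0" using K by simp
    show "\<bar>u T\<bar> \<le> 4 * K * T" if "1 \<le> T" for T
    proof -
      have "\<bar>u T\<bar> \<le> K * (T + 1)" using K(2)[of 0 T T] that by simp
      also have "\<dots> \<le> K * (4 * T)" using that K by (intro mult_left_mono) auto
      finally show ?thesis by simp
    qed
    show "\<bar>(I p + I q - I (q - p)) - p * u q\<bar> \<le> 4 * K * p\<^sup>2" if pq: "1 \<le> p" "p \<le> q" for p q
    proof -
      let ?e = "K * (p + 1)"
      have "- ?e \<le> u s \<and> u s \<le> ?e" if "s \<in> {0..p}" for s using K(2)[of 0 s p] that by auto
      from I_diff_bounds[of 0 p "- ?e" ?e, OF _ _ this]
      have 1: "\<bar>I p\<bar> \<le> ?e * p" using pq by auto
      have "u q - ?e \<le> u s \<and> u s \<le> u q + ?e" if "s \<in> {q - p..q}" for s using K(2)[of "q - p" s q] that pq by auto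
      from I_diff_bounds[of "q - p" q "u q - ?e" "u q + ?e", OF _ _ this]
      have "(u q - ?e) * p \<le> I q - I (q - p)" "I q - I (q - p) \<le> (u q + ?e) * p" using pq by auto
      then have 2: "\<bar>I q - I (q - p) - p * u q\<bar> \<le> ?e * p" by (auto simp: algebra_simps abs_le_iff)
      have "p * (p + 1) \<le> 2 * p\<^sup>2" using pq by (simp add: power2_eq_square algebra_simps)
      then have "K * (p * (p + 1)) \<le> K * (2 * p\<^sup>2)" using K by (intro mult_left_mono) auto
      then have "?e * p \<le> 2 * K * p\<^sup>2" by (simp add: algebra_simps)
      then show ?thesis using 1 2 by linarith
    qed
  qed
qed

text \<open>As \<open>u\<close> is the derivative of \<open>I\<close>, the difference
  \<open>I T - b * T\<^sup>2 / 2\<close> is nonincreasing from some \<open>T0\<close> on; its value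
  at \<open>T0\<close> is absorbed by \<open>e * T\<^sup>2\<close>.\<close>

lemma cesaro_bound:
  assumes b: "eventually (\<lambda>T. u T \<le> b * T) at_top" and e: "e > 0"
  shows "eventually (\<lambda>T. 2 * I T \<le> (b + e) * T\<^sup>2) at_top"
proof -
  obtain T0 where T0: "T0 \<ge> 1" "\<And>T. T \<ge> T0 \<Longrightarrow> u T \<le> b * T"
    using b unfolding eventually_at_top_linorder by (metis max.cobounded1 max.cobounded2 order_trans)
  have le: "I T - b * T\<^sup>2 / 2 \<le> I T0 - b * T0\<^sup>2 / 2" if "T \<ge> T0" for T
  proof (rule DERIV_nonpos_imp_nonincreasing[OF that])
    fix x assume x: "T0 \<le> x" "x \<le> T"
    have "(I has_vector_derivative u x) (at x within {0..x + 1})" using x T0 by (intro I_derivative) auto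
    then have "(I has_real_derivative u x) (at x)"
      using x T0 by (simp add: at_within_Icc_at has_real_derivative_iff_has_vector_derivative)
    then have "((\<lambda>T. I T - b * T\<^sup>2 / 2) has_real_derivative (u x - b * x)) (at x)"
      by (auto intro!: derivative_eq_intros)
    then show "\<exists>y. ((\<lambda>T. I T - b * T\<^sup>2 / 2) has_real_derivative y) (at x) \<and> y \<le> 0"
      using T0(2)[of x] x by auto
  qed
  define k where "k = 2 * (I T0 - b * T0\<^sup>2 / 2)"
  show ?thesis
    unfolding eventually_at_top_linorder
  proof (intro exI[of _ "max T0 (\<bar>k\<bar> / e)"] allI impI)
    fix T assume T: "T \<ge> max T0 (\<bar>k\<bar> / e)"
    then have "\<bar>k\<bar> \<le> e * T" using e by (simp add: field_simps)
    also have "e * T \<le> e * T\<^sup>2" using T T0 e by (simp add: power2_eq_square)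
    finally have "k \<le> e * T\<^sup>2" by simp
    then show "2 * I T \<le> (b + e) * T\<^sup>2" using le[of T] T by (simp add: k_def algebra_simps)
  qed
qed

text \<open>Let \<open>s\<close> be the infimum of \<open>q T = \<parallel>S T\<parallel>\<^sup>2 / T\<^sup>2\<close>. The mean \<open>u T / T\<close> is nearly \<open>\<langle>S p, S T\<rangle> / (p T)\<close>, hence at
  most \<open>(q p + q T) / 2\<close>, and \<open>q\<close> is a Cesaro mean of \<open>u T / T\<close>; therefore \<open>limsup q \<le> (s + limsup q) / 2\<close>,
  that is, \<open>q\<close> tends to \<open>s\<close>. The convergence of \<open>u T / T\<close> follows as in the proof that a minimizing sequence
  in a convex set is a Cauchy sequence.\<close>

theorem mean_correlation_limit:
  obtains s where "((\<lambda>T. u T / T) \<longlongrightarrow> s) at_top" "\<And>b. (\<And>T. T \<ge> 1 \<Longrightarrow> b \<le> 2 * I T / T\<^sup>2) \<Longrightarrow> b \<le> s"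
proof -
  obtain K where K: "K \<ge> 0" "\<And>T. 1 \<le> T \<Longrightarrow> \<bar>u T\<bar> \<le> K * T"
    "\<And>p q. 1 \<le> p \<Longrightarrow> p \<le> q \<Longrightarrow> \<bar>(I p + I q - I (q - p)) - p * u q\<bar> \<le> K * p\<^sup>2"
    using mean_growth by blast
  define W where "W p q = I p + I q - I (q - p)" for p q
  define q where "q T = 2 * I T / T\<^sup>2" for T
  define av where "av T = u T / T" for T
  define s where "s = Inf (q ` {1..})"
  have q0: "q T \<ge> 0" if "T \<ge> 1" for T
    using quadratic_form_nonneg[of T T T 1 0 0] that by (simp add: q_def)
  have bdd: "bdd_below (q ` {1..})" using q0 by (auto intro!: bdd_belowI[of _ 0])
  have s_le: "s \<le> q T" if "T \<ge> 1" for T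
    unfolding s_def using that bdd by (intro cInf_lower) auto
  have s_near: "\<exists>T\<ge>1. q T < s + e" if "e > 0" for e
    using cInf_lessD[of "q ` {1..}" "s + e"] that unfolding s_def by auto
  have W_av: "\<bar>W p T / (p * T) - av T\<bar> \<le> K * p / T" if "1 \<le> p" "p \<le> T" for p T
  proof -
    have "W p T / (p * T) - av T = (W p T - p * u T) / (p * T)" using that by (simp add: av_def field_simps)
    then have "\<bar>W p T / (p * T) - av T\<bar> = \<bar>W p T - p * u T\<bar> / (p * T)" using that by (simp add: abs_mult)
    also have "\<dots> \<le> (K * p\<^sup>2) / (p * T)" using K(3)[OF that] that by (intro divide_right_mono) (auto simp: W_def)
    also have "\<dots> = K * p / T" using that by (simp add: power2_eq_square)
    finally show ?thesis .
  qed
  \<comment> \<open>The squared norm of \<open>\<alpha> S 1 + S n / n - S N / N\<close>. The free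
    parameter \<open>\<alpha>\<close> will extract a bound on the product of \<open>S 1\<close> with
    the difference of the two time averages.\<close>
  have quad: "0 \<le> \<alpha>\<^sup>2 * (2 * I 1) + (q n + q N - 2 * W n N / (n * N)) + 2 * \<alpha> * (W 1 n / n - W 1 N / N)"
    if "1 \<le> n" "n \<le> N" for \<alpha> n N
    using quadratic_form_nonneg[of 1 n N \<alpha> "1 / n" "- 1 / N"] that
    by (simp add: q_def W_def power_divide right_diff_distrib diff_divide_distrib)
  have tend: "eventually (\<lambda>T. k / T \<le> e) at_top" if "e > 0" for k e :: real
  proof -
    have "((\<lambda>T. k / T) \<longlongrightarrow> 0) at_top" by (intro tendsto_divide_0[OF tendsto_const] filterlim_at_top_imp_at_infinity filterlim_ident)
    from order_tendstoD(2)[OF this that] show ?thesis by eventually_elim simp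
  qed
  have ge: "eventually (\<lambda>T. T \<ge> k) at_top" for k :: real by (rule eventually_ge_at_top)
  have stepA: "eventually (\<lambda>T. av T \<le> (q p + q T) / 2 + e) at_top" if "1 \<le> p" "e > 0" for p e
    using tend[OF that(2), of "K * p"] ge[of p]
  proof eventually_elim
    case (elim T)
    have "0 \<le> q p + q T - 2 * (W p T / (p * T))" using quad[OF that(1) elim(2), of 0] by simp
    moreover have "av T \<le> (q p + q T) / 2 + e" if "0 \<le> q p + q T - 2 * X" "- (X - av T) \<le> k" "k \<le> e" for X k
      using that by (simp add: field_simps)
    ultimately show ?case using abs_le_D2[OF W_av[OF that(1) elim(2)]] elim(1) by blast
  qed
  have ces: "eventually (\<lambda>T. q T \<le> b + e) at_top" if "eventually (\<lambda>T. av T \<le> b) at_top" "e > 0" for b e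
  proof -
    have "eventually (\<lambda>T. u T \<le> b * T) at_top"
      using that(1) ge[of 1] by eventually_elim (auto simp: av_def field_simps)
    from cesaro_bound[OF this that(2)] show ?thesis
      using ge[of 1] by eventually_elim (auto simp: q_def field_simps)
  qed
  \<comment> \<open>With \<open>p\<close> chosen so that \<open>q p\<close> is nearly
    \<open>s\<close>, \<open>stepA\<close> improves an eventual bound \<open>b\<close> for
    \<open>q\<close> to a bound near \<open>(s + b) / 2\<close> for \<open>av\<close>, and the
    Cesaro bound carries it back to \<open>q\<close>.\<close>
  have stepB: "eventually (\<lambda>T. q T \<le> (s + b) / 2 + e) at_top" if b: "eventually (\<lambda>T. q T \<le> b) at_top" and e: "e > 0" for b e
  proof -
    obtain p where p: "p \<ge> 1" "q p < s + e / 2" using s_near[of "e / 2"] e by auto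
    have e4: "e / 4 > 0" using e by simp
    have "eventually (\<lambda>T. av T \<le> (s + b) / 2 + e / 2) at_top"
      using stepA[OF p(1) e4] b by eventually_elim (use p in \<open>simp add: field_simps\<close>)
    from ces[OF this, of "e / 2"] e show ?thesis by (simp add: add.commute)
  qed
  have stepC: "eventually (\<lambda>T. q T \<le> s + e) at_top" if e: "e > 0" for e
  proof -
    \<comment> \<open>\<open>Inf E\<close> is the limit superior of \<open>q\<close>. By
      \<open>stepB\<close> it is at most the mean of \<open>s\<close> and itself up to multiples of
      \<open>e'\<close>, hence at most \<open>s\<close>.\<close>
    define E where "E = {b. eventually (\<lambda>T. q T \<le> b) at_top}"
    have "eventually (\<lambda>T. av T \<le> K) at_top"
      using ge[of 1]
    proof eventually_elim
      case (elim T)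
      then show ?case using K(2)[of T] by (simp add: av_def field_simps)
    qed
    from ces[OF this, of 1] have E_ne: "E \<noteq> {}" by (auto simp: E_def)
    have E_ge: "s \<le> b" if "b \<in> E" for b
    proof -
      have "eventually (\<lambda>T. q T \<le> b \<and> T \<ge> 1) at_top"
        using that ge[of 1] by (simp add: E_def eventually_conj_iff)
      then obtain T where "q T \<le> b" "T \<ge> 1"
        using eventually_happens'[OF trivial_limit_at_top_linorder] by blast
      then show ?thesis using s_le[of T] by simp
    qed
    then have bdd: "bdd_below E" by (auto intro!: bdd_belowI)
    define e' where "e' = e / 4"
    have e': "e' > 0" using e by (simp add: e'_def)
    obtain b where b: "b \<in> E" "b < Inf E + e'" using cInf_lessD[OF E_ne, of "Inf E + e'"] e' by auto
    have "(s + b) / 2 + e' \<in> E" using stepB[OF _ e'] b(1) by (simp add: E_def)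
    then have "Inf E \<le> (s + b) / 2 + e'" using bdd by (rule cInf_lower)
    then have "b \<le> s + e" using b(2) by (simp add: e'_def field_simps)
    then show ?thesis using b(1) by (auto simp: E_def elim!: eventually_mono)
  qed
  have stepD: "eventually (\<lambda>T. av T \<le> s + e) at_top" if e: "e > 0" for e
  proof -
    obtain p where p: "p \<ge> 1" "q p < s + e / 2" using s_near[of "e / 2"] e by auto
    have e2: "e / 2 > 0" using e by simp
    show ?thesis using stepA[OF p(1) e2] stepC[OF e2] by eventually_elim (use p in \<open>simp add: field_simps\<close>)
  qed
  \<comment> \<open>If \<open>av\<close> stayed below \<open>s - e\<close> from some time on, so
    would its Cesaro mean \<open>q\<close> up to \<open>e / 2\<close>, against
    \<open>s \<le> q T\<close>.\<close>
  have stepE: "\<exists>N\<ge>k. av N \<ge> s - e" if e: "e > 0" for e k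
  proof (rule ccontr)
    assume "\<not> ?thesis"
    then have "eventually (\<lambda>T. av T \<le> s - e) at_top"
      unfolding eventually_at_top_linorder by (metis linorder_linear)
    from ces[OF this, of "e / 2"] e have "eventually (\<lambda>T. q T \<le> s - e / 2) at_top" by simp
    then have "eventually (\<lambda>T. q T \<le> s - e / 2 \<and> T \<ge> 1) at_top"
      using ge[of 1] by (simp add: eventually_conj_iff)
    then obtain T where "q T \<le> s - e / 2" "T \<ge> 1"
      using eventually_happens'[OF trivial_limit_at_top_linorder] by blast
    then show False using s_le[of T] e by simp
  qed
  define G where "G = 2 * I 1"
  have G: "G \<ge> 0" using q0[of 1] by (simp add: q_def G_def)
  have near: "eventually (\<lambda>n. \<bar>av n - s\<bar> \<le> e * (G / 2 + 6)) at_top" if e: "0 < e" "e < 1" for e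
  proof -
    have e2: "e\<^sup>2 > 0" "e\<^sup>2 \<le> e" using e by (auto simp: power2_eq_square mult_left_le)
    have ev: "eventually (\<lambda>T. q T \<le> s + e\<^sup>2 \<and> av T \<le> s + e \<and> K / T \<le> e \<and> T \<ge> 1) at_top"
      using stepC[OF e2(1)] stepD[OF e(1)] tend[OF e(1), of K] ge[of 1] by eventually_elim auto
    then obtain n0 where n0: "\<And>T. T \<ge> n0 \<Longrightarrow> q T \<le> s + e\<^sup>2 \<and> av T \<le> s + e \<and> K / T \<le> e \<and> T \<ge> 1"
      unfolding eventually_at_top_linorder by blast
    show ?thesis unfolding eventually_at_top_linorder
    proof (intro exI[of _ n0] allI impI)
      fix n assume n: "n \<ge> n0"
      obtain N1 where N1: "\<And>T. T \<ge> N1 \<Longrightarrow> K * n / T \<le> e\<^sup>2"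
        using tend[OF e2(1), of "K * n"] unfolding eventually_at_top_linorder by blast
      obtain N where N: "N \<ge> max N1 n" "av N \<ge> s - e\<^sup>2" using stepE[OF e2(1)] by blast
      have n1: "1 \<le> n" "n \<le> N" "n0 \<le> N" using n0[OF n] N n by auto
      \<comment> \<open>Here \<open>q n + q N \<le> 2 * s + 2 * e\<^sup>2\<close>, while the
        normalized product is at least \<open>av N - e\<^sup>2 \<ge> s - 2 * e\<^sup>2\<close>; this
        adds up to \<open>6 * e\<^sup>2\<close>. Two near-minimizers of the norm are thus close to
        each other.\<close>
      have D: "q n + q N - 2 * W n N / (n * N) \<le> 6 * e\<^sup>2"
      proof -
        have "q n + q N - 2 * X \<le> 6 * e\<^sup>2" if "- (X - av N) \<le> k" "k \<le> e\<^sup>2" for X k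
          using n0[OF n] n0[OF n1(3)] that N by auto
        from this[OF abs_le_D2[OF W_av[OF n1(1,2)]]] have "q n + q N - 2 * (W n N / (n * N)) \<le> 6 * e\<^sup>2"
          using N1[of N] N by simp
        then show ?thesis by simp
      qed
      \<comment> \<open>The choices \<open>\<alpha> = e\<close> and \<open>\<alpha> = - e\<close> in
        \<open>quad\<close> replace the Cauchy-Schwarz inequality: a squared distance of order
        \<open>e\<^sup>2\<close> gives products with \<open>S 1\<close> that differ by order
        \<open>e\<close>.\<close>
      have "2 * e * \<bar>W 1 n / n - W 1 N / N\<bar> \<le> e\<^sup>2 * G + 6 * e\<^sup>2"
      proof -
        have "2 * e * \<bar>X\<bar> \<le> e\<^sup>2 * G + 6 * e\<^sup>2"
          if "0 \<le> e\<^sup>2 * G + Y + 2 * e * X" "0 \<le> e\<^sup>2 * G + Y + 2 * (- e) * X" "Y \<le> 6 * e\<^sup>2" for X Y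
          using that by (cases "X \<ge> 0") (simp_all add: abs_if)
        from this[OF _ _ D] show ?thesis
          using quad[OF n1(1,2), of e] quad[OF n1(1,2), of "- e"] by (simp add: G_def)
      qed
      also have "\<dots> = 2 * e * (e * (G / 2 + 3))" by (simp add: power2_eq_square algebra_simps)
      finally have A: "\<bar>W 1 n / n - W 1 N / N\<bar> \<le> e * (G / 2 + 3)" using e by simp
      have B: "\<bar>W 1 n / n - av n\<bar> \<le> e" "\<bar>W 1 N / N - av N\<bar> \<le> e"
        using W_av[of 1 n] W_av[of 1 N] n0[OF n] n0[OF n1(3)] n1 by auto
      have C: "\<bar>av N - s\<bar> \<le> e" using n0[OF n1(3)] N e2 by auto
      have "e * (G / 2 + 6) = e * (G / 2 + 3) + e + e + e" by (simp add: algebra_simps)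
      then show "\<bar>av n - s\<bar> \<le> e * (G / 2 + 6)" using A B C by linarith
    qed
  qed
  have "(av \<longlongrightarrow> s) at_top"
  proof (rule tendstoI)
    fix e :: real assume e: "e > 0"
    \<comment> \<open>The minimum with 1/2 gives \<open>e' < 1\<close>, required by
      \<open>near\<close>; the other term wins because \<open>G / 2 + 6 < G + 13\<close>.\<close>
    define e' where "e' = min (1/2) (e / (G + 13))"
    have e': "0 < e'" "e' < 1" using e G by (auto simp: e'_def)
    have "e' * (G / 2 + 6) \<le> e / (G + 13) * (G / 2 + 6)"
      using G by (intro mult_right_mono) (auto simp: e'_def)
    also have "\<dots> < e" using e G by (simp add: field_simps add_nonneg_pos)
    finally show "eventually (\<lambda>T. dist (av T) s < e) at_top"
      using near[OF e'] by (auto simp: dist_real_def elim!: eventually_mono)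
  qed
  moreover have "b \<le> s" if "\<And>T. T \<ge> 1 \<Longrightarrow> b \<le> 2 * I T / T\<^sup>2" for b
    unfolding s_def using that by (intro cInf_greatest) (auto simp: q_def)
  ultimately show ?thesis using that unfolding av_def[abs_def] by blast
qed

end

section \<open>Disintegration over level sets\<close>

text \<open>The Gibbs weight is a function \<open>w\<close> of the conserved quantities, as the
  Hamiltonian is one of them. On each level set the weighted measure is therefore a multiple of
  \<open>\<nu> \<alpha>\<close>, and the microcanonical average is also the conditional expectation
  for \<open>\<mu>\<close>.\<close>

locale disintegration =
  fixes vol :: "'m::topological_space measure" and Hs :: "'m \<Rightarrow> real^'k::finite" and D :: "(real^'k) set"
    and \<nu> :: "real^'k \<Rightarrow> 'm measure" and w :: "real^'k \<Rightarrow> real"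
  assumes micro: "microcanonical_measures vol Hs D \<nu>" and sets_vol [measurable_cong, simp]: "sets vol = sets borel"
    and Hs [measurable]: "Hs \<in> borel_measurable borel" and w [measurable]: "w \<in> borel_measurable borel"
    and w_nonneg: "w \<alpha> \<ge> 0"
begin

definition \<mu> :: "'m measure" where "\<mu> = density vol (\<lambda>m. ennreal (w (Hs m)))"

lemma sets_\<mu> [measurable_cong, simp]: "sets \<mu> = sets borel"
  by (simp add: \<mu>_def)

lemma level_set_borel [measurable, simp]: "level_set Hs \<alpha> \<in> sets borel"
  using measurable_sets[OF Hs, of "{\<alpha>}"] by (simp add: level_set_def)

lemma D_borel [measurable, simp]: "D \<in> sets borel" and range_Hs: "Hs m \<in> D"
  and sets_\<nu>: "\<alpha> \<in> D \<Longrightarrow> sets (\<nu> \<alpha>) = sets borel"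
  and \<nu>_finite: "\<alpha> \<in> D \<Longrightarrow> emeasure (\<nu> \<alpha>) (level_set Hs \<alpha>) < \<infinity>"
  using micro by (auto simp: microcanonical_measures_def)

lemma \<nu>_measurable:
  "E \<in> sets borel \<Longrightarrow> (\<lambda>\<alpha>. emeasure (\<nu> \<alpha>) (level_set Hs \<alpha> \<inter> E) * indicator D \<alpha>) \<in> borel_measurable borel"
  using micro by (subst borel_measurable_restrict_space_iff_ennreal[symmetric]) (auto simp: microcanonical_measures_def)

lemma disintegrate:
  assumes [measurable]: "F \<in> borel_measurable borel"
  shows "(\<integral>\<^sup>+m. F m \<partial>vol) = (\<integral>\<^sup>+\<alpha>. (\<integral>\<^sup>+m. F m * indicator (level_set Hs \<alpha>) m \<partial>\<nu> \<alpha>) * indicator D \<alpha> \<partial>lborel)"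
  using micro assms unfolding microcanonical_measures_def by blast

text \<open>The integral over the fibre \<open>level_set Hs \<alpha> \<inter> N\<close>. Outside
  \<open>D\<close> nothing is known about \<open>\<nu> \<alpha>\<close>, so the value is set to 0
  there; this also makes it measurable on the whole space.\<close>

definition k :: "'m set \<Rightarrow> ('m \<Rightarrow> ennreal) \<Rightarrow> real^'k \<Rightarrow> ennreal" where
  "k N F \<alpha> = (\<integral>\<^sup>+m. F m * indicator (level_set Hs \<alpha> \<inter> N) m \<partial>\<nu> \<alpha>) * indicator D \<alpha>"

lemma measurable_\<nu>: "\<alpha> \<in> D \<Longrightarrow> F \<in> borel_measurable borel \<Longrightarrow> F \<in> borel_measurable (\<nu> \<alpha>)"
  using measurable_cong_sets[OF sets_\<nu> refl] by blast

text \<open>Induction over nonnegative Borel functions; the indicator case is the assumed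
  measurability of fibre volumes, and monotone convergence gives the limits.\<close>

lemma k_measurable [measurable]:
  assumes N [measurable]: "N \<in> sets borel" and F: "F \<in> borel_measurable borel"
  shows "k N F \<in> borel_measurable borel"
  using F
proof (induction F rule: borel_measurable_induct)
  case (cong f g)
  then show ?case by (simp add: fun_eq_iff[symmetric])
next
  case (set E)
  have "k N (indicator E) \<alpha> = emeasure (\<nu> \<alpha>) (level_set Hs \<alpha> \<inter> (N \<inter> E)) * indicator D \<alpha>" for \<alpha>
  proof (cases "\<alpha> \<in> D")
    case True
    have "(\<integral>\<^sup>+m. indicator E m * indicator (level_set Hs \<alpha> \<inter> N) m \<partial>\<nu> \<alpha>) = (\<integral>\<^sup>+m. indicator (level_set Hs \<alpha> \<inter> (N \<inter> E)) m \<partial>\<nu> \<alpha>)"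
      by (intro nn_integral_cong) (auto simp: indicator_def)
    also have "\<dots> = emeasure (\<nu> \<alpha>) (level_set Hs \<alpha> \<inter> (N \<inter> E))"
      using set by (intro nn_integral_indicator) (simp add: sets_\<nu>[OF True])
    finally show ?thesis by (simp add: k_def)
  qed (simp add: k_def)
  then show ?case using \<nu>_measurable[of "N \<inter> E"] set by (simp add: fun_eq_iff[symmetric])
next
  case (mult u c)
  have "k N (\<lambda>x. c * u x) = (\<lambda>\<alpha>. c * k N u \<alpha>)"
  proof
    fix \<alpha> show "k N (\<lambda>x. c * u x) \<alpha> = c * k N u \<alpha>"
      using mult(2) by (cases "\<alpha> \<in> D") (simp_all add: k_def mult.assoc nn_integral_cmult measurable_\<nu>)
  qed
  then show ?case using mult by simp
next
  case (add u v)
  have "k N (\<lambda>x. v x + u x) = (\<lambda>\<alpha>. k N v \<alpha> + k N u \<alpha>)"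
  proof
    fix \<alpha> show "k N (\<lambda>x. v x + u x) \<alpha> = k N v \<alpha> + k N u \<alpha>"
      using add by (cases "\<alpha> \<in> D") (simp_all add: k_def distrib_right nn_integral_add measurable_\<nu>)
  qed
  then show ?case using add by simp
next
  case (seq U)
  have "k N (SUP i. U i) = (\<lambda>\<alpha>. SUP i. k N (U i) \<alpha>)"
  proof
    fix \<alpha> show "k N (SUP i. U i) \<alpha> = (SUP i. k N (U i) \<alpha>)"
    proof (cases "\<alpha> \<in> D")
      case True
      have "(\<integral>\<^sup>+m. (SUP i. U i) m * indicator (level_set Hs \<alpha> \<inter> N) m \<partial>\<nu> \<alpha>)
        = (\<integral>\<^sup>+m. (SUP i. U i m * indicator (level_set Hs \<alpha> \<inter> N) m) \<partial>\<nu> \<alpha>)"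
        by (intro nn_integral_cong) (simp add: image_comp SUP_mult_right_ennreal)
      also have "\<dots> = (SUP i. \<integral>\<^sup>+m. U i m * indicator (level_set Hs \<alpha> \<inter> N) m \<partial>\<nu> \<alpha>)"
        using seq by (intro nn_integral_monotone_convergence_SUP)
          (auto simp: incseq_def le_fun_def measurable_\<nu>[OF True] intro!: mult_right_mono)
      finally show ?thesis using True by (simp add: k_def)
    qed (simp add: k_def)
  qed
  moreover have "(\<lambda>\<alpha>. SUP i. k N (U i) \<alpha>) \<in> borel_measurable borel"
    using seq by (intro borel_measurable_SUP) auto
  ultimately show ?case by metis
qed

lemma integral_k:
  assumes N [measurable]: "N \<in> sets borel" and F [measurable]: "F \<in> borel_measurable borel" "g \<in> borel_measurable borel"
  shows "(\<integral>\<^sup>+m. indicator N m * F m * g (Hs m) \<partial>\<mu>) = (\<integral>\<^sup>+\<alpha>. g \<alpha> * ennreal (w \<alpha>) * k N F \<alpha> \<partial>lborel)"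
proof -
  have "(\<integral>\<^sup>+m. indicator N m * F m * g (Hs m) \<partial>\<mu>) = (\<integral>\<^sup>+m. ennreal (w (Hs m)) * (indicator N m * F m * g (Hs m)) \<partial>vol)"
    unfolding \<mu>_def by (rule nn_integral_density) measurable
  also have "\<dots> = (\<integral>\<^sup>+\<alpha>. (\<integral>\<^sup>+m. ennreal (w (Hs m)) * (indicator N m * F m * g (Hs m)) * indicator (level_set Hs \<alpha>) m \<partial>\<nu> \<alpha>) * indicator D \<alpha> \<partial>lborel)"
    by (rule disintegrate) measurable
  also have "\<dots> = (\<integral>\<^sup>+\<alpha>. g \<alpha> * ennreal (w \<alpha>) * k N F \<alpha> \<partial>lborel)"
  proof (rule nn_integral_cong)
    fix \<alpha>
    show "(\<integral>\<^sup>+m. ennreal (w (Hs m)) * (indicator N m * F m * g (Hs m)) * indicator (level_set Hs \<alpha>) m \<partial>\<nu> \<alpha>) * indicator D \<alpha>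
      = g \<alpha> * ennreal (w \<alpha>) * k N F \<alpha>"
    proof (cases "\<alpha> \<in> D")
      case True
      have "(\<integral>\<^sup>+m. ennreal (w (Hs m)) * (indicator N m * F m * g (Hs m)) * indicator (level_set Hs \<alpha>) m \<partial>\<nu> \<alpha>)
        = (\<integral>\<^sup>+m. g \<alpha> * ennreal (w \<alpha>) * (F m * indicator (level_set Hs \<alpha> \<inter> N) m) \<partial>\<nu> \<alpha>)"
        by (intro nn_integral_cong) (auto simp: indicator_def level_set_def mult_ac)
      also have "\<dots> = g \<alpha> * ennreal (w \<alpha>) * (\<integral>\<^sup>+m. F m * indicator (level_set Hs \<alpha> \<inter> N) m \<partial>\<nu> \<alpha>)"
        by (rule nn_integral_cmult) (rule measurable_\<nu>[OF True], measurable)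
      finally show ?thesis using True by (simp add: k_def)
    qed (simp add: k_def)
  qed
  finally show ?thesis .
qed

lemma k_const: "\<alpha> \<in> D \<Longrightarrow> N \<in> sets borel \<Longrightarrow> k N (\<lambda>_. 1) \<alpha> = emeasure (\<nu> \<alpha>) (level_set Hs \<alpha> \<inter> N)"
  unfolding k_def by (simp add: sets_\<nu>)

lemma k_const_finite: "N \<in> sets borel \<Longrightarrow> k N (\<lambda>_. 1) \<alpha> < \<infinity>"
proof (cases "\<alpha> \<in> D")
  case True
  assume N: "N \<in> sets borel"
  have "emeasure (\<nu> \<alpha>) (level_set Hs \<alpha> \<inter> N) \<le> emeasure (\<nu> \<alpha>) (level_set Hs \<alpha>)"
    by (rule emeasure_mono) (auto simp: sets_\<nu>[OF True])
  then show ?thesis using \<nu>_finite[OF True] k_const[OF True N] by (simp add: order_le_less_trans)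
qed (simp add: k_def)

lemma k_null:
  assumes N: "N \<in> sets borel" and F: "F \<in> borel_measurable borel" and z: "k N (\<lambda>_. 1) \<alpha> = 0"
  shows "k N F \<alpha> = 0"
proof (cases "\<alpha> \<in> D")
  case True
  then have "emeasure (\<nu> \<alpha>) (level_set Hs \<alpha> \<inter> N) = 0" using z k_const[OF True N] by simp
  then have "AE m in \<nu> \<alpha>. m \<notin> level_set Hs \<alpha> \<inter> N"
    using N by (intro AE_not_in) (auto simp: null_sets_def sets_\<nu>[OF True])
  then have "(\<integral>\<^sup>+m. F m * indicator (level_set Hs \<alpha> \<inter> N) m \<partial>\<nu> \<alpha>) = (\<integral>\<^sup>+m. 0 \<partial>\<nu> \<alpha>)"
    by (intro nn_integral_cong_AE) (auto elim!: eventually_mono)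
  then show ?thesis by (simp add: k_def)
qed (simp add: k_def)

definition \<phi> :: "'m set \<Rightarrow> ('m \<Rightarrow> ennreal) \<Rightarrow> real^'k \<Rightarrow> ennreal" where
  "\<phi> N F \<alpha> = k N F \<alpha> / k N (\<lambda>_. 1) \<alpha>"

lemma \<phi>_measurable [measurable]:
  assumes [measurable]: "N \<in> sets borel" "F \<in> borel_measurable borel"
  shows "\<phi> N F \<in> borel_measurable borel"
  unfolding \<phi>_def[abs_def] by measurable

text \<open>Fibre volumes are finite, and where a fibre is a null set its integral
  \<open>k N F \<alpha>\<close> is 0 as well, so dividing by the volume loses nothing.\<close>

lemma \<phi>_mult:
  assumes "N \<in> sets borel" "F \<in> borel_measurable borel"
  shows "\<phi> N F \<alpha> * k N (\<lambda>_. 1) \<alpha> = k N F \<alpha>"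
proof (cases "k N (\<lambda>_. 1) \<alpha> = 0")
  case True
  then show ?thesis using k_null[OF assms True] by simp
next
  case False
  then show ?thesis using k_const_finite[OF assms(1), of \<alpha>] unfolding \<phi>_def
    by (simp add: ennreal_divide_times ennreal_mult_divide_eq less_top)
qed

text \<open>On \<open>N\<close>, \<open>\<phi> N F\<close> composed with \<open>Hs\<close> is the
  conditional expectation of \<open>F\<close> given the conserved quantities, with values in
  \<open>[0, \<infinity>]\<close>.\<close>

lemma integral_\<phi>:
  assumes [measurable]: "N \<in> sets borel" "F \<in> borel_measurable borel" "g \<in> borel_measurable borel"
  shows "(\<integral>\<^sup>+m. indicator N m * \<phi> N F (Hs m) * g (Hs m) \<partial>\<mu>) = (\<integral>\<^sup>+m. indicator N m * F m * g (Hs m) \<partial>\<mu>)"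
proof -
  have "(\<integral>\<^sup>+m. indicator N m * \<phi> N F (Hs m) * g (Hs m) \<partial>\<mu>) = (\<integral>\<^sup>+m. indicator N m * 1 * (\<phi> N F (Hs m) * g (Hs m)) \<partial>\<mu>)"
    by (simp add: mult.assoc)
  also have "\<dots> = (\<integral>\<^sup>+\<alpha>. (\<phi> N F \<alpha> * g \<alpha>) * ennreal (w \<alpha>) * k N (\<lambda>_. 1) \<alpha> \<partial>lborel)"
    by (rule integral_k) measurable
  also have "\<dots> = (\<integral>\<^sup>+\<alpha>. g \<alpha> * ennreal (w \<alpha>) * k N F \<alpha> \<partial>lborel)"
    by (intro nn_integral_cong) (simp add: \<phi>_mult[OF assms(1,2), symmetric] mult_ac)
  also have "\<dots> = (\<integral>\<^sup>+m. indicator N m * F m * g (Hs m) \<partial>\<mu>)"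
    by (rule integral_k[symmetric]) measurable
  finally show ?thesis .
qed

text \<open>Where one of the integrals of the two parts of \<open>A\<close> over a level set is infinite, the Bochner
  integral, and hence the average, is 0.\<close>

definition level_mean :: "'m set \<Rightarrow> ('m \<Rightarrow> real) \<Rightarrow> real^'k \<Rightarrow> real" where
  "level_mean N A \<alpha> = (if k N (\<lambda>m. ennreal (A m)) \<alpha> = \<infinity> \<or> k N (\<lambda>m. ennreal (- A m)) \<alpha> = \<infinity> then 0
     else enn2real (\<phi> N (\<lambda>m. ennreal (A m)) \<alpha>) - enn2real (\<phi> N (\<lambda>m. ennreal (- A m)) \<alpha>))"

lemma level_mean_measurable [measurable]:
  assumes [measurable]: "N \<in> sets borel" "A \<in> borel_measurable borel"
  shows "level_mean N A \<in> borel_measurable borel"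
  unfolding level_mean_def[abs_def] by measurable

text \<open>Both sides agree also in the degenerate cases: on fibres of volume 0, where division by
  zero gives 0, and on fibres where \<open>A\<close> is not integrable, where the Bochner integral
  is 0.\<close>

lemma averaged_eq:
  assumes N: "N \<in> sets borel" and A [measurable]: "A \<in> borel_measurable borel"
  shows "averaged Hs \<nu> N A m = indicator N m * level_mean N A (Hs m)"
proof (cases "m \<in> N")
  case True
  define \<alpha> where "\<alpha> = Hs m"
  have \<alpha>: "\<alpha> \<in> D" using range_Hs by (simp add: \<alpha>_def)
  let ?L = "level_set Hs \<alpha> \<inter> N" and ?f = "\<lambda>x. indicator (level_set Hs \<alpha> \<inter> N) x * A x"
  have f: "?f \<in> borel_measurable (\<nu> \<alpha>)"
    by (rule measurable_cong_sets[OF sets_\<nu>[OF \<alpha>] refl, THEN equalityD2, THEN subsetD]) (use N in measurable)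
  have pos: "(\<integral>\<^sup>+x. ennreal (?f x) \<partial>\<nu> \<alpha>) = k N (\<lambda>m. ennreal (A m)) \<alpha>"
    and neg: "(\<integral>\<^sup>+x. ennreal (- ?f x) \<partial>\<nu> \<alpha>) = k N (\<lambda>m. ennreal (- A m)) \<alpha>"
    using \<alpha> by (auto simp: k_def indicator_def intro!: nn_integral_cong)
  have v: "measure (\<nu> \<alpha>) ?L = enn2real (k N (\<lambda>_. 1) \<alpha>)"
    using k_const[OF \<alpha> N] by (simp add: measure_def)
  have "(LINT x:?L|\<nu> \<alpha>. A x) = (\<integral>x. ?f x \<partial>\<nu> \<alpha>)" by (simp add: set_lebesgue_integral_def)
  also have "\<dots> = (if k N (\<lambda>m. ennreal (A m)) \<alpha> = \<infinity> \<or> k N (\<lambda>m. ennreal (- A m)) \<alpha> = \<infinity> then 0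
     else enn2real (k N (\<lambda>m. ennreal (A m)) \<alpha>) - enn2real (k N (\<lambda>m. ennreal (- A m)) \<alpha>))"
  proof (cases "integrable (\<nu> \<alpha>) ?f")
    case True
    then have "(\<integral>\<^sup>+x. ennreal (?f x) \<partial>\<nu> \<alpha>) < \<infinity>" "(\<integral>\<^sup>+x. ennreal (- ?f x) \<partial>\<nu> \<alpha>) < \<infinity>"
      using real_integrable_def[of "\<nu> \<alpha>" ?f] by (auto simp: less_top)
    then show ?thesis unfolding pos neg using real_lebesgue_integral_def[OF True] by (auto simp: pos neg)
  next
    case False
    then have "k N (\<lambda>m. ennreal (A m)) \<alpha> = \<infinity> \<or> k N (\<lambda>m. ennreal (- A m)) \<alpha> = \<infinity>"
      using f unfolding real_integrable_def pos neg by auto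
    then show ?thesis using False by (auto simp: not_integrable_integral_eq)
  qed
  finally have LINT: "(LINT x:?L|\<nu> \<alpha>. A x) = (if k N (\<lambda>m. ennreal (A m)) \<alpha> = \<infinity> \<or> k N (\<lambda>m. ennreal (- A m)) \<alpha> = \<infinity> then 0
     else enn2real (k N (\<lambda>m. ennreal (A m)) \<alpha>) - enn2real (k N (\<lambda>m. ennreal (- A m)) \<alpha>))" .
  have div: "enn2real (\<phi> N F \<alpha>) = enn2real (k N F \<alpha>) / measure (\<nu> \<alpha>) ?L" if "F \<in> borel_measurable borel" for F
  proof (cases "measure (\<nu> \<alpha>) ?L = 0")
    case True
    then have "k N (\<lambda>_. 1) \<alpha> = 0" using v k_const_finite[OF N, of \<alpha>] by (auto simp: enn2real_eq_0_iff)
    from k_null[OF N that this] show ?thesis by (simp add: \<phi>_def)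
  next
    case False
    have "enn2real (\<phi> N F \<alpha>) * measure (\<nu> \<alpha>) ?L = enn2real (k N F \<alpha>)"
      unfolding v by (simp add: enn2real_mult[symmetric] \<phi>_mult[OF N that])
    then show ?thesis using False by (simp add: field_simps)
  qed
  have "1 / measure (\<nu> \<alpha>) ?L * (LINT x:?L|\<nu> \<alpha>. A x) = level_mean N A \<alpha>"
    unfolding level_mean_def LINT by (simp add: div diff_divide_distrib)
  then show ?thesis using True by (simp add: averaged_def \<alpha>_def)
qed (simp add: averaged_def)

text \<open>The defining property of conditional expectation for an integrable \<open>A\<close>. The
  test functions \<open>g\<close> are bounded because \<open>A\<close> is only in L^1. The positive
  and negative parts of \<open>A\<close> are treated as \<open>ennreal\<close>-valued functions with
  nonnegative weights, and both are recombined, as are the two parts of \<open>g\<close>.\<close>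

lemma integral_level_mean:
  assumes N [measurable]: "N \<in> sets borel" and A [measurable]: "A \<in> borel_measurable borel" and int: "integrable \<mu> A"
    and g [measurable]: "g \<in> borel_measurable borel" and bound: "\<And>\<alpha>. \<bar>g \<alpha>\<bar> \<le> b"
  shows "integrable \<mu> (\<lambda>m. indicator N m * level_mean N A (Hs m) * g (Hs m))"
    "(\<integral>m. indicator N m * level_mean N A (Hs m) * g (Hs m) \<partial>\<mu>) = (\<integral>m. indicator N m * A m * g (Hs m) \<partial>\<mu>)"
proof -
  have b: "b \<ge> 0" using bound[of 0] by simp
  let ?R = "\<lambda>F m. indicator N m * enn2real (\<phi> N F (Hs m))"
  have fin: "(\<integral>\<^sup>+m. ennreal (A m) \<partial>\<mu>) < \<infinity>" "(\<integral>\<^sup>+m. ennreal (- A m) \<partial>\<mu>) < \<infinity>"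
    using int unfolding real_integrable_def by (auto simp: less_top)
  \<comment> \<open>A part \<open>F\<close> of \<open>A\<close> with finite integral has a finite
    conditional expectation almost everywhere on \<open>N\<close>; \<open>enn2real\<close> and the
    default value in \<open>level_mean\<close> change it only on a null set.\<close>
  have part: "(AE m in \<mu>. m \<in> N \<longrightarrow> \<phi> N F (Hs m) < \<infinity> \<and> k N F (Hs m) < \<infinity>) \<and>
      (\<forall>h\<in>borel_measurable borel. (\<forall>\<alpha>. 0 \<le> h \<alpha> \<and> h \<alpha> \<le> b) \<longrightarrow>
        integrable \<mu> (\<lambda>m. ?R F m * h (Hs m)) \<and>
        (\<integral>m. ?R F m * h (Hs m) \<partial>\<mu>) = enn2real (\<integral>\<^sup>+m. indicator N m * F m * ennreal (h (Hs m)) \<partial>\<mu>))"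
    if F [measurable]: "F \<in> borel_measurable borel" and fin: "(\<integral>\<^sup>+m. F m \<partial>\<mu>) < \<infinity>" for F
  proof -
    have "(\<integral>\<^sup>+m. indicator N m * \<phi> N F (Hs m) \<partial>\<mu>) = (\<integral>\<^sup>+m. indicator N m * F m \<partial>\<mu>)"
      using integral_\<phi>[OF N F, of "\<lambda>_. 1"] by simp
    also have "\<dots> \<le> (\<integral>\<^sup>+m. F m \<partial>\<mu>)" by (intro nn_integral_mono) (auto simp: indicator_def)
    finally have "(\<integral>\<^sup>+m. indicator N m * \<phi> N F (Hs m) \<partial>\<mu>) \<noteq> \<infinity>" using fin by (auto simp: less_top[symmetric] top_unique)
    then have "AE m in \<mu>. indicator N m * \<phi> N F (Hs m) \<noteq> \<infinity>"
      by (intro nn_integral_PInf_AE) measurable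
    then have AE: "AE m in \<mu>. m \<in> N \<longrightarrow> \<phi> N F (Hs m) < \<infinity> \<and> k N F (Hs m) < \<infinity>"
    proof eventually_elim
      case (elim m)
      then show ?case
        using \<phi>_mult[OF N F, of "Hs m"] k_const_finite[OF N, of "Hs m"]
        by (auto simp: indicator_def less_top[symmetric] ennreal_mult_less_top split: if_splits) (metis ennreal_mult_less_top less_top infinity_ennreal_def)
    qed
    have "integrable \<mu> (\<lambda>m. ?R F m * h (Hs m)) \<and>
        (\<integral>m. ?R F m * h (Hs m) \<partial>\<mu>) = enn2real (\<integral>\<^sup>+m. indicator N m * F m * ennreal (h (Hs m)) \<partial>\<mu>)"
      if h [measurable]: "h \<in> borel_measurable borel" and hb: "\<And>\<alpha>. 0 \<le> h \<alpha> \<and> h \<alpha> \<le> b" for h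
    proof -
      have "(\<integral>\<^sup>+m. ennreal (?R F m * h (Hs m)) \<partial>\<mu>) = (\<integral>\<^sup>+m. indicator N m * \<phi> N F (Hs m) * ennreal (h (Hs m)) \<partial>\<mu>)"
        using AE by (intro nn_integral_cong_AE, eventually_elim) (use hb in \<open>auto simp: indicator_def ennreal_mult\<close>)
      also have "\<dots> = (\<integral>\<^sup>+m. indicator N m * F m * ennreal (h (Hs m)) \<partial>\<mu>)"
        by (rule integral_\<phi>) measurable
      finally have eq: "(\<integral>\<^sup>+m. ennreal (?R F m * h (Hs m)) \<partial>\<mu>) = (\<integral>\<^sup>+m. indicator N m * F m * ennreal (h (Hs m)) \<partial>\<mu>)" .
      have "(\<integral>\<^sup>+m. indicator N m * F m * ennreal (h (Hs m)) \<partial>\<mu>) \<le> (\<integral>\<^sup>+m. ennreal b * F m \<partial>\<mu>)"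
      proof (rule nn_integral_mono)
        fix m
        have "F m * ennreal (h (Hs m)) \<le> F m * ennreal b"
          using hb by (intro mult_left_mono ennreal_leI) auto
        then show "indicator N m * F m * ennreal (h (Hs m)) \<le> ennreal b * F m"
          by (auto simp: indicator_def mult.commute)
      qed
      also have "\<dots> = ennreal b * (\<integral>\<^sup>+m. F m \<partial>\<mu>)" by (rule nn_integral_cmult) measurable
      also have "\<dots> < \<infinity>" using fin by (simp add: ennreal_mult_less_top)
      finally have "integrable \<mu> (\<lambda>m. ?R F m * h (Hs m))"
        using hb by (intro integrableI_nonneg) (auto simp: eq)
      moreover have "(\<integral>m. ?R F m * h (Hs m) \<partial>\<mu>) = enn2real (\<integral>\<^sup>+m. ennreal (?R F m * h (Hs m)) \<partial>\<mu>)"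
        by (rule integral_eq_nn_integral) (use hb in auto)
      ultimately show ?thesis unfolding eq by blast
    qed
    with AE show ?thesis by blast
  qed
  let ?Ap = "\<lambda>m. ennreal (A m)" and ?An = "\<lambda>m. ennreal (- A m)"
  have "?Ap \<in> borel_measurable borel" "?An \<in> borel_measurable borel" by measurable
  note pp = part[OF this(1) fin(1)] and pn = part[OF this(2) fin(2)]
  have AE: "AE m in \<mu>. indicator N m * level_mean N A (Hs m) = ?R ?Ap m - ?R ?An m"
    using pp[THEN conjunct1] pn[THEN conjunct1]
    by eventually_elim (auto simp: level_mean_def indicator_def)
  have hside: "integrable \<mu> (\<lambda>m. indicator N m * level_mean N A (Hs m) * h (Hs m)) \<and>
      (\<integral>m. indicator N m * level_mean N A (Hs m) * h (Hs m) \<partial>\<mu>) = (\<integral>m. indicator N m * A m * h (Hs m) \<partial>\<mu>)"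
    if h [measurable]: "h \<in> borel_measurable borel" and hb: "\<And>\<alpha>. 0 \<le> h \<alpha> \<and> h \<alpha> \<le> b" for h
  proof -
    have ip: "integrable \<mu> (\<lambda>m. ?R ?Ap m * h (Hs m))" "integrable \<mu> (\<lambda>m. ?R ?An m * h (Hs m))"
      and ep: "(\<integral>m. ?R ?Ap m * h (Hs m) \<partial>\<mu>) = enn2real (\<integral>\<^sup>+m. indicator N m * ?Ap m * ennreal (h (Hs m)) \<partial>\<mu>)"
      and en: "(\<integral>m. ?R ?An m * h (Hs m) \<partial>\<mu>) = enn2real (\<integral>\<^sup>+m. indicator N m * ?An m * ennreal (h (Hs m)) \<partial>\<mu>)"
      using pp[THEN conjunct2, rule_format, OF h hb] pn[THEN conjunct2, rule_format, OF h hb] by auto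
    have AE': "AE m in \<mu>. indicator N m * level_mean N A (Hs m) * h (Hs m) = ?R ?Ap m * h (Hs m) - ?R ?An m * h (Hs m)"
      using AE by eventually_elim (simp add: left_diff_distrib)
    have 1: "integrable \<mu> (\<lambda>m. indicator N m * level_mean N A (Hs m) * h (Hs m))"
      using Bochner_Integration.integrable_diff[OF ip] by (rule integrable_cong_AE_imp) (use AE' in \<open>auto elim: eventually_mono\<close>)
    have "(\<integral>m. indicator N m * level_mean N A (Hs m) * h (Hs m) \<partial>\<mu>) = (\<integral>m. ?R ?Ap m * h (Hs m) - ?R ?An m * h (Hs m) \<partial>\<mu>)"
      by (rule integral_cong_AE) (use AE' in auto)
    also have "\<dots> = enn2real (\<integral>\<^sup>+m. indicator N m * ?Ap m * ennreal (h (Hs m)) \<partial>\<mu>) - enn2real (\<integral>\<^sup>+m. indicator N m * ?An m * ennreal (h (Hs m)) \<partial>\<mu>)"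
      using ip by (simp add: ep en)
    also have "\<dots> = (\<integral>m. indicator N m * A m * h (Hs m) \<partial>\<mu>)"
    proof -
      have int': "integrable \<mu> (\<lambda>m. indicator N m * A m * h (Hs m))"
      proof (rule Bochner_Integration.integrable_bound[OF integrable_mult_right[OF integrable_abs[OF int], of b]])
        show "AE m in \<mu>. norm (indicator N m * A m * h (Hs m)) \<le> norm (b * \<bar>A m\<bar>)"
          using hb b by (intro AE_I2) (auto simp: indicator_def abs_mult mult.commute[of "\<bar>A _\<bar>"] intro!: mult_right_mono)
      qed measurable
      have factor: "ennreal (indicator N m * x * h (Hs m)) = indicator N m * ennreal x * ennreal (h (Hs m))" for x m
        using hb[of "Hs m"] by (cases "m \<in> N") (simp_all add: ennreal_mult'')
      have "(\<integral>\<^sup>+m. ennreal (indicator N m * A m * h (Hs m)) \<partial>\<mu>) = (\<integral>\<^sup>+m. indicator N m * ?Ap m * ennreal (h (Hs m)) \<partial>\<mu>)"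
        unfolding factor ..
      moreover have "- (indicator N m * A m * h (Hs m)) = indicator N m * (- A m) * h (Hs m)" for m by simp
      then have "(\<integral>\<^sup>+m. ennreal (- (indicator N m * A m * h (Hs m))) \<partial>\<mu>) = (\<integral>\<^sup>+m. indicator N m * ?An m * ennreal (h (Hs m)) \<partial>\<mu>)"
        by (simp only: factor)
      ultimately show ?thesis using real_lebesgue_integral_def[OF int'] by simp
    qed
    finally show ?thesis using 1 by blast
  qed
  have split: "X * g (Hs m) = X * max 0 (g (Hs m)) - X * max 0 (- g (Hs m))" for X m
    by (simp add: max_def right_diff_distrib[symmetric])
  have bb: "0 \<le> max 0 (g \<alpha>) \<and> max 0 (g \<alpha>) \<le> b" "0 \<le> max 0 (- g \<alpha>) \<and> max 0 (- g \<alpha>) \<le> b" for \<alpha>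
    using bound[of \<alpha>] b by auto
  have m: "(\<lambda>\<alpha>. max 0 (g \<alpha>)) \<in> borel_measurable borel" "(\<lambda>\<alpha>. max 0 (- g \<alpha>)) \<in> borel_measurable borel" by measurable
  note h1 = hside[OF m(1) bb(1)] and h2 = hside[OF m(2) bb(2)]
  show "integrable \<mu> (\<lambda>m. indicator N m * level_mean N A (Hs m) * g (Hs m))"
    unfolding split[of "indicator N _ * level_mean N A (Hs _)"]
    by (rule Bochner_Integration.integrable_diff) (use h1 h2 in auto)
  have iA: "integrable \<mu> (\<lambda>m. indicator N m * A m * h (Hs m))"
    if "h \<in> borel_measurable borel" "\<And>\<alpha>. 0 \<le> h \<alpha> \<and> h \<alpha> \<le> b" for h
  proof (rule Bochner_Integration.integrable_bound[OF integrable_mult_right[OF integrable_abs[OF int], of b]])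
    show "(\<lambda>m. indicator N m * A m * h (Hs m)) \<in> borel_measurable \<mu>" using that(1) by measurable
    show "AE m in \<mu>. norm (indicator N m * A m * h (Hs m)) \<le> norm (b * \<bar>A m\<bar>)"
      using that(2) b by (intro AE_I2) (auto simp: indicator_def abs_mult mult.commute[of "\<bar>A _\<bar>"] intro!: mult_right_mono)
  qed
  have "(\<integral>m. indicator N m * level_mean N A (Hs m) * g (Hs m) \<partial>\<mu>)
    = (\<integral>m. indicator N m * level_mean N A (Hs m) * max 0 (g (Hs m)) \<partial>\<mu>) - (\<integral>m. indicator N m * level_mean N A (Hs m) * max 0 (- g (Hs m)) \<partial>\<mu>)"
    using h1 h2 by (subst split) (intro Bochner_Integration.integral_diff, auto)
  also have "\<dots> = (\<integral>m. indicator N m * A m * max 0 (g (Hs m)) \<partial>\<mu>) - (\<integral>m. indicator N m * A m * max 0 (- g (Hs m)) \<partial>\<mu>)"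
    using h1 h2 by simp
  also have "\<dots> = (\<integral>m. indicator N m * A m * g (Hs m) \<partial>\<mu>)"
    using iA[OF m(1) bb(1)] iA[OF m(2) bb(2)] by (subst split) (intro Bochner_Integration.integral_diff[symmetric], auto)
  finally show "(\<integral>m. indicator N m * level_mean N A (Hs m) * g (Hs m) \<partial>\<mu>) = (\<integral>m. indicator N m * A m * g (Hs m) \<partial>\<mu>)" .
qed

end

section \<open>Polynomials, multi-indices and Gram matrices\<close>

lemma digits_unique:
  fixes f g :: "nat \<Rightarrow> nat"
  assumes "\<And>j. j < n \<Longrightarrow> f j < b" "\<And>j. j < n \<Longrightarrow> g j < b"
    and "(\<Sum>j<n. f j * b ^ j) = (\<Sum>j<n. g j * b ^ j)" and "j < n"
  shows "f j = g j"
  using assms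
proof (induction n arbitrary: f g j)
  case (Suc n)
  have shift: "(\<Sum>j<Suc n. f j * b ^ j) = f 0 + b * (\<Sum>j<n. f (Suc j) * b ^ j)" for f :: "nat \<Rightarrow> nat"
    by (subst sum.lessThan_Suc_shift) (simp add: sum_distrib_left mult_ac)
  have lt: "f 0 < b" "g 0 < b" using Suc.prems(1)[of 0] Suc.prems(2)[of 0] by auto
  have eq: "f 0 + b * (\<Sum>j<n. f (Suc j) * b ^ j) = g 0 + b * (\<Sum>j<n. g (Suc j) * b ^ j)"
    using Suc.prems(3) unfolding shift .
  from arg_cong[OF eq, of "\<lambda>x. x mod b"] lt have 0: "f 0 = g 0" by simp
  with eq lt have "(\<Sum>j<n. f (Suc j) * b ^ j) = (\<Sum>j<n. g (Suc j) * b ^ j)" by simp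
  from Suc.IH[OF _ _ this] Suc.prems(1,2) have "f (Suc i) = g (Suc i)" if "i < n" for i using that by auto
  then show ?case using 0 Suc.prems(4) by (cases j) auto
qed simp

text \<open>A polynomial vanishing on a nonempty open set vanishes identically, since it does so on lines.
  Kronecker's substitution \<open>x\<^sub>i = z^(b^i)\<close> with a large base \<open>b\<close> then separates the monomials.\<close>

lemma polynomial_zero_on_open:
  fixes a :: "('k::finite \<Rightarrow> nat) \<Rightarrow> real" and U :: "(real^'k) set"
  assumes L: "finite L" and U: "open U" "U \<noteq> {}"
    and zero: "\<And>x. x \<in> U \<Longrightarrow> (\<Sum>l\<in>L. a l * (\<Prod>i\<in>UNIV. (x $ i) ^ l i)) = 0" and l: "l \<in> L"
  shows "a l = 0"
proof -
  obtain x0 r where x0: "r > 0" "ball x0 r \<subseteq> U" using U open_contains_ball by blast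
  have everywhere: "(\<Sum>l\<in>L. a l * (\<Prod>i\<in>UNIV. (y $ i) ^ l i)) = 0" for y
  proof -
    \<comment> \<open>The polynomial on the line from \<open>x0\<close> to \<open>y\<close>. It
      vanishes for small positive parameters, hence identically, and its value at 1 is the value at
      \<open>y\<close>.\<close>
    define q where "q = (\<Sum>l\<in>L. smult (a l) (\<Prod>i\<in>UNIV. [:x0 $ i, y $ i - x0 $ i:] ^ l i))"
    have q: "poly q s = (\<Sum>l\<in>L. a l * (\<Prod>i\<in>UNIV. ((x0 + s *\<^sub>R (y - x0)) $ i) ^ l i))" for s
      by (simp add: q_def poly_sum poly_prod)
    define d where "d = r / (norm (y - x0) + 1)"
    have d: "d > 0" using x0 by (auto simp: d_def intro!: divide_pos_pos add_nonneg_pos)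
    have "poly q s = 0" if "s \<in> {0<..<d}" for s
    proof -
      have "norm (s *\<^sub>R (y - x0)) \<le> s * (norm (y - x0) + 1)" using that by (simp add: distrib_left)
      also have "\<dots> < d * (norm (y - x0) + 1)"
        using that by (intro mult_strict_right_mono add_nonneg_pos) auto
      also have "\<dots> = r" using add_nonneg_pos[of "norm (y - x0)" 1] by (simp add: d_def)
      finally have "x0 + s *\<^sub>R (y - x0) \<in> U" using x0(2) by (auto simp: dist_norm)
      then show ?thesis unfolding q by (rule zero)
    qed
    then have "{0<..<d} \<subseteq> {s. poly q s = 0}" by auto
    then have "infinite {s. poly q s = 0}" using d infinite_Ioo infinite_super by blast
    then have "q = 0" using poly_roots_finite by blast
    then show ?thesis using q[of 1] by simp
  qed
  \<comment> \<open>Larger than every exponent that occurs, so that the entries of \<open>l\<close>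
    are the base-\<open>b\<close> digits of \<open>e l\<close> below and can be recovered from
    it.\<close>
  define b where "b = Suc (\<Sum>l\<in>L. \<Sum>i\<in>UNIV. l i)"
  have small: "l i < b" if "l \<in> L" for l i
  proof -
    have "l i \<le> (\<Sum>i\<in>UNIV. l i)" by (rule member_le_sum) auto
    also have "\<dots> \<le> (\<Sum>l\<in>L. \<Sum>i\<in>UNIV. l i)" using that L by (intro member_le_sum[of l L "\<lambda>l. \<Sum>i\<in>UNIV. l i"]) auto
    finally show ?thesis by (simp add: b_def)
  qed
  obtain f :: "'k \<Rightarrow> nat" where f: "bij_betw f UNIV {..<CARD('k)}"
    using ex_bij_betw_finite_nat[of "UNIV :: 'k set"] by (auto simp: lessThan_atLeast0)
  define e where "e l = (\<Sum>i\<in>UNIV. l i * b ^ f i)" for l :: "'k \<Rightarrow> nat"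
  let ?g = "the_inv_into UNIV f"
  have g: "?g (f i) = i" for i using f by (simp add: bij_betw_def the_inv_into_f_f)
  have e_eq: "e l = (\<Sum>j<CARD('k). l (?g j) * b ^ j)" for l
    unfolding e_def using sum.reindex_bij_betw[OF f, of "\<lambda>j. l (?g j) * b ^ j"] by (simp add: g)
  have e_inj: "l = l'" if "l \<in> L" "l' \<in> L" "e l = e l'" for l l'
  proof
    fix i
    have "f i < CARD('k)" using f by (auto simp: bij_betw_def)
    from digits_unique[of "CARD('k)" "\<lambda>j. l (?g j)" b "\<lambda>j. l' (?g j)", OF _ _ _ this]
    show "l i = l' i" using small that by (simp add: e_eq g)
  qed
  define p where "p = (\<Sum>l\<in>L. monom (a l) (e l))"
  have "poly p z = 0" for z
  proof -
    have "(\<Prod>i\<in>UNIV. ((\<chi> i. z ^ (b ^ f i)) $ i) ^ l i) = z ^ e l" for l :: "'k \<Rightarrow> nat"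
      by (simp add: e_def power_sum power_mult[symmetric] mult.commute)
    then show ?thesis using everywhere[of "\<chi> i. z ^ (b ^ f i)"] by (simp add: p_def poly_sum poly_monom)
  qed
  then have "p = 0" using poly_all_0_iff_0 by blast
  then have "0 = coeff p (e l)" by simp
  also have "\<dots> = (\<Sum>l'\<in>L. if l' = l then a l else 0)"
    unfolding p_def coeff_sum by (rule sum.cong) (use e_inj l in auto)
  also have "\<dots> = a l" using L l by simp
  finally show ?thesis by simp
qed

section \<open>The graded lexicographic order and the enumeration of multi-indices\<close>

lemma finite_degree_le: "finite {l :: 'k::finite \<Rightarrow> nat. degree l \<le> d}"
proof (rule finite_subset)
  show "{l :: 'k \<Rightarrow> nat. degree l \<le> d} \<subseteq> PiE UNIV (\<lambda>_. {..d})"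
  proof
    fix l :: "'k \<Rightarrow> nat" assume "l \<in> {l. degree l \<le> d}"
    then have "(\<Sum>i\<in>UNIV. l i) \<le> d" by (simp add: degree_def)
    then have "l i \<le> d" for i using member_le_sum[of i UNIV l] by auto
    then show "l \<in> PiE UNIV (\<lambda>_. {..d})" by auto
  qed
qed (simp add: finite_PiE)

lemma multi_index_less_trans:
  assumes "multi_index_less l j" "multi_index_less j m" shows "multi_index_less l m"
proof (cases "degree l = degree j \<and> degree j = degree m")
  case True
  then obtain i i' where i: "l i < j i" "\<forall>x<i. l x = j x" and i': "j i' < m i'" "\<forall>x<i'. j x = m x"
    using assms by (auto simp: multi_index_less_def)
  have "l (min i i') < m (min i i') \<and> (\<forall>x<min i i'. l x = m x)"
    using i i' by (cases i i' rule: linorder_cases) (auto simp: min_def)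
  then show ?thesis using True by (auto simp: multi_index_less_def)
qed (use assms in \<open>auto simp: multi_index_less_def\<close>)

lemma multi_index_less_irrefl: "\<not> multi_index_less l l"
  by (auto simp: multi_index_less_def)

lemma multi_index_less_total:
  assumes "l \<noteq> j" shows "multi_index_less l j \<or> multi_index_less j l"
proof -
  let ?D = "{i. l i \<noteq> j i}"
  have "?D \<noteq> {}" using assms by auto
  then have m: "Min ?D \<in> ?D" by (intro Min_in) auto
  have same: "l i = j i" if "i < Min ?D" for i
  proof (rule ccontr)
    assume "l i \<noteq> j i"
    then have "Min ?D \<le> i" by (intro Min_le) auto
    then show False using that by simp
  qed
  have lex: "(\<exists>i. l i < j i \<and> (\<forall>i'<i. l i' = j i')) \<or> (\<exists>i. j i < l i \<and> (\<forall>i'<i. j i' = l i'))"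
  proof (cases "l (Min ?D) < j (Min ?D)")
    case True
    then show ?thesis using same by (intro disjI1 exI[of _ "Min ?D"] conjI allI impI)
  next
    case False
    moreover have "l (Min ?D) \<noteq> j (Min ?D)" using m by (rule CollectD)
    ultimately have "j (Min ?D) < l (Min ?D)" by linarith
    moreover have "\<forall>i'<Min ?D. j i' = l i'"
    proof (intro allI impI)
      fix i' assume "i' < Min ?D"
      then show "j i' = l i'" by (rule same[symmetric])
    qed
    ultimately show ?thesis by (intro disjI2 exI[of _ "Min ?D"] conjI)
  qed
  show ?thesis
    by (cases "degree l" "degree j" rule: linorder_cases) (use lex in \<open>auto simp only: multi_index_less_def\<close>)
qed

lemma finite_multi_index_less: "finite {j. multi_index_less j l}"
  by (rule finite_subset[OF _ finite_degree_le[of "degree l"]]) (auto simp: multi_index_less_def)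

lemma position_mono: "multi_index_less j l \<Longrightarrow> position j < position l"
  unfolding position_def
  by (rule psubset_card_mono[OF finite_multi_index_less])
     (use multi_index_less_trans multi_index_less_irrefl in blast)

lemma inj_position: "inj position"
  by (rule injI) (metis multi_index_less_total position_mono less_irrefl)

text \<open>The predecessors of \<open>l\<close> number \<open>position l\<close> and are mapped
  injectively below \<open>position l\<close>, hence onto all smaller numbers. Since there are
  infinitely many multi-indices, \<open>position\<close> is unbounded.\<close>

lemma surj_position: "surj (position :: ('k::{finite, linorder} \<Rightarrow> nat) \<Rightarrow> nat)"
proof -
  have down: "n \<in> range (position :: ('k \<Rightarrow> nat) \<Rightarrow> nat)" if "n < position l" for n and l :: "'k \<Rightarrow> nat"
  proof -
    let ?S = "{j. multi_index_less j l}"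
    have "position ` ?S \<subseteq> {..<position l}" using position_mono by auto
    moreover have "card (position ` ?S) = card {..<position l}"
      using card_image[OF inj_on_subset[OF inj_position subset_UNIV], of ?S] by (simp add: position_def)
    ultimately have "position ` ?S = {..<position l}" by (intro card_subset_eq) auto
    then have "n \<in> position ` ?S" using that by simp
    then obtain j :: "'k \<Rightarrow> nat" where "n = position j" by (elim imageE) blast
    then show ?thesis by simp
  qed
  have "infinite (UNIV :: ('k \<Rightarrow> nat) set)"
  proof
    assume "finite (UNIV :: ('k \<Rightarrow> nat) set)"
    then have "finite (range (\<lambda>n (_::'k). n :: nat))" by (rule rev_finite_subset) simp
    moreover have "inj (\<lambda>n (_::'k). n :: nat)" by (auto simp: inj_def fun_eq_iff)
    ultimately show False using finite_imageD infinite_UNIV_nat by blast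
  qed
  then have "infinite (range (position :: ('k \<Rightarrow> nat) \<Rightarrow> nat))" using finite_imageD[OF _ inj_position] by blast
  then have "\<exists>l. n < position (l :: 'k \<Rightarrow> nat)" for n
    using infinite_nat_iff_unbounded by (metis rangeE)
  then show ?thesis using down by blast
qed

lemma multi_index_position [simp]: "multi_index (position l) = l"
  unfolding multi_index_def by (rule inv_f_f[OF inj_position])

lemma bij_position: "bij position"
  using inj_position surj_position by (rule bijI)

text \<open>For the Gram matrix of vectors \<open>e\<^sub>a\<close> and \<open>v\<^sub>a = \<langle>F, e\<^sub>a\<rangle>\<close> the bound holds with \<open>s = \<parallel>F\<parallel>\<^sup>2\<close>.\<close>

locale gram_bound =
  fixes G :: "'i \<Rightarrow> 'i \<Rightarrow> real" and v :: "'i \<Rightarrow> real" and s :: real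
  assumes symmetric: "G a b = G b a"
    and nonneg: "finite I \<Longrightarrow> 0 \<le> (\<Sum>a\<in>I. \<Sum>b\<in>I. y a * G a b * y b)"
    and bound: "finite I \<Longrightarrow> 2 * (\<Sum>a\<in>I. y a * v a) - (\<Sum>a\<in>I. \<Sum>b\<in>I. y a * G a b * y b) \<le> s"
begin

text \<open>With \<open>x = K v\<close>: \<open>v\<^sup>T K v = 2 x\<^sup>T v - x\<^sup>T G x\<close>, and this is the maximum of \<open>2 y\<^sup>T v - y\<^sup>T G y\<close>.\<close>

lemma finite_inverse_form:
  assumes I: "finite I" and K: "inverse_matrix I G K"
  defines "Q \<equiv> (\<Sum>a\<in>I. \<Sum>b\<in>I. v a * K a b * v b)"
  shows "\<exists>x. Q = 2 * (\<Sum>a\<in>I. x a * v a) - (\<Sum>a\<in>I. \<Sum>b\<in>I. x a * G a b * x b)"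
    "2 * (\<Sum>a\<in>I. y a * v a) - (\<Sum>a\<in>I. \<Sum>b\<in>I. y a * G a b * y b) \<le> Q"
proof -
  define x where "x a = (\<Sum>b\<in>I. K a b * v b)" for a
  have Gx: "(\<Sum>b\<in>I. G a b * x b) = v a" if a: "a \<in> I" for a
  proof -
    have GK: "(\<Sum>c\<in>I. G a c * K c b) = (if a = b then 1 else 0)" if "b \<in> I" for b
    proof -
      have "((\<lambda>c. G a c * K c b) has_sum (if a = b then 1 else 0)) I"
        using K a that unfolding inverse_matrix_def by blast
      then show ?thesis unfolding has_sum_finite_iff[OF I] by (rule sym)
    qed
    have "(\<Sum>b\<in>I. G a b * x b) = (\<Sum>c\<in>I. \<Sum>b\<in>I. G a c * K c b * v b)"
      by (simp add: x_def sum_distrib_left mult.assoc)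
    also have "\<dots> = (\<Sum>b\<in>I. (\<Sum>c\<in>I. G a c * K c b) * v b)"
      by (subst sum.swap) (simp add: sum_distrib_right)
    also have "\<dots> = (\<Sum>b\<in>I. if a = b then v b else 0)" by (intro sum.cong) (simp_all add: GK)
    also have "\<dots> = v a" using a I by simp
    finally show ?thesis .
  qed
  have Qx: "Q = (\<Sum>a\<in>I. x a * v a)"
    unfolding Q_def x_def by (simp add: sum_distrib_left sum_distrib_right mult_ac)
  have xGz: "(\<Sum>a\<in>I. \<Sum>b\<in>I. z a * G a b * x b) = (\<Sum>a\<in>I. z a * v a)" for z
    by (intro sum.cong refl) (simp add: Gx[symmetric] sum_distrib_left mult.assoc)
  show "\<exists>x. Q = 2 * (\<Sum>a\<in>I. x a * v a) - (\<Sum>a\<in>I. \<Sum>b\<in>I. x a * G a b * x b)"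
    by (rule exI[of _ x]) (simp add: Qx xGz)
  have zGx: "(\<Sum>a\<in>I. \<Sum>b\<in>I. x a * G a b * y b) = (\<Sum>a\<in>I. y a * v a)"
    by (subst sum.swap) (use xGz[of y] in \<open>simp add: symmetric mult_ac\<close>)
  have "0 \<le> (\<Sum>a\<in>I. \<Sum>b\<in>I. (x a - y a) * G a b * (x b - y b))" by (rule nonneg[OF I])
  also have "\<dots> = (\<Sum>a\<in>I. \<Sum>b\<in>I. x a * G a b * x b) - (\<Sum>a\<in>I. \<Sum>b\<in>I. x a * G a b * y b)
     - (\<Sum>a\<in>I. \<Sum>b\<in>I. y a * G a b * x b) + (\<Sum>a\<in>I. \<Sum>b\<in>I. y a * G a b * y b)"
    by (simp add: left_diff_distrib right_diff_distrib sum_subtractf)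
  finally show "2 * (\<Sum>a\<in>I. y a * v a) - (\<Sum>a\<in>I. \<Sum>b\<in>I. y a * G a b * y b) \<le> Q"
    by (simp add: xGz zGx Qx)
qed

lemma finite_inverse_form_le:
  assumes "finite I" "inverse_matrix I G K"
  shows "(\<Sum>a\<in>I. \<Sum>b\<in>I. v a * K a b * v b) \<le> s"
proof -
  obtain x where "(\<Sum>a\<in>I. \<Sum>b\<in>I. v a * K a b * v b) = 2 * (\<Sum>a\<in>I. x a * v a) - (\<Sum>a\<in>I. \<Sum>b\<in>I. x a * G a b * x b)"
    using finite_inverse_form(1)[OF assms] by blast
  then show ?thesis using bound[OF assms(1), of x] by simp
qed

text \<open>A maximizer for the index set \<open>I\<close>, extended by zero, is a competitor for
  \<open>J\<close>. Monotonicity in the degree makes the finite bounds converge.\<close>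

lemma finite_inverse_form_mono:
  assumes J: "finite J" "I \<subseteq> J" and K: "inverse_matrix I G K" "inverse_matrix J G K'"
  shows "(\<Sum>a\<in>I. \<Sum>b\<in>I. v a * K a b * v b) \<le> (\<Sum>a\<in>J. \<Sum>b\<in>J. v a * K' a b * v b)"
proof -
  have I: "finite I" using J finite_subset by blast
  obtain x where x: "(\<Sum>a\<in>I. \<Sum>b\<in>I. v a * K a b * v b)
    = 2 * (\<Sum>a\<in>I. x a * v a) - (\<Sum>a\<in>I. \<Sum>b\<in>I. x a * G a b * x b)"
    using finite_inverse_form(1)[OF I K(1)] by blast
  define y where "y a = (if a \<in> I then x a else 0)" for a
  have "(\<Sum>a\<in>J. y a * v a) = (\<Sum>a\<in>I. x a * v a)"
    by (rule sum.mono_neutral_cong_right) (use J in \<open>auto simp: y_def\<close>)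
  moreover have "(\<Sum>a\<in>J. \<Sum>b\<in>J. y a * G a b * y b) = (\<Sum>a\<in>I. \<Sum>b\<in>I. x a * G a b * x b)"
  proof (rule sum.mono_neutral_cong_right)
    show "(\<Sum>b\<in>J. y a * G a b * y b) = (\<Sum>b\<in>I. x a * G a b * x b)" if "a \<in> I" for a
      by (rule sum.mono_neutral_cong_right) (use J that in \<open>auto simp: y_def\<close>)
  qed (use J in \<open>auto simp: y_def\<close>)
  ultimately show ?thesis using finite_inverse_form(2)[OF J(1) K(2), of y] x by simp
qed

end

text \<open>Elimination by the Schur complement: \<open>G\<close> maps the vector \<open>z\<close>,
  whose entry at the new index \<open>i\<close> is 1, to \<open>p\<close> times the unit vector of
  \<open>i\<close>. The form at \<open>z\<close> equals \<open>p\<close>, so \<open>p > 0\<close>,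
  and a multiple of \<open>z\<close> corrects row \<open>i\<close> without disturbing the
  others.\<close>

lemma positive_definite_solve:
  fixes G :: "'i \<Rightarrow> 'i \<Rightarrow> real"
  assumes sym: "\<And>a b. G a b = G b a" and I: "finite I"
    and pos: "\<And>y. \<exists>a\<in>I. y a \<noteq> 0 \<Longrightarrow> 0 < (\<Sum>a\<in>I. \<Sum>b\<in>I. y a * G a b * y b)"
  shows "\<exists>x. \<forall>a\<in>I. (\<Sum>b\<in>I. G a b * x b) = v a"
  using I pos
proof (induction I arbitrary: v)
  case (insert i I)
  have pos': "0 < (\<Sum>a\<in>I. \<Sum>b\<in>I. y a * G a b * y b)" if "\<exists>a\<in>I. y a \<noteq> 0" for y
  proof -
    define z where "z a = (if a = i then 0 else y a)" for a
    have "0 < (\<Sum>a\<in>insert i I. \<Sum>b\<in>insert i I. z a * G a b * z b)"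
      by (rule insert.prems) (use that insert.hyps in \<open>auto simp: z_def\<close>)
    also have "\<dots> = (\<Sum>a\<in>I. \<Sum>b\<in>I. z a * G a b * z b)" using insert.hyps by (simp add: z_def)
    also have "\<dots> = (\<Sum>a\<in>I. \<Sum>b\<in>I. y a * G a b * y b)"
      using insert.hyps by (intro sum.cong refl) (auto simp: z_def)
    finally show ?thesis .
  qed
  obtain x where x: "\<And>a. a \<in> I \<Longrightarrow> (\<Sum>b\<in>I. G a b * x b) = v a" using insert.IH[OF pos'] by blast
  obtain w where w: "\<And>a. a \<in> I \<Longrightarrow> (\<Sum>b\<in>I. G a b * w b) = - G a i"
    using insert.IH[OF pos', of "\<lambda>a. - G a i"] by blast
  define z where "z a = (if a = i then 1 else w a)" for a
  have zI: "z b = w b" if "b \<in> I" for b using that insert.hyps by (auto simp: z_def)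
  define p where "p = G i i + (\<Sum>b\<in>I. G i b * w b)"
  have Gz: "(\<Sum>b\<in>insert i I. G a b * z b) = (if a = i then p else 0)" if "a \<in> insert i I" for a
  proof -
    have "(\<Sum>b\<in>I. G a b * z b) = (\<Sum>b\<in>I. G a b * w b)" by (intro sum.cong) (auto simp: zI)
    then show ?thesis using that insert.hyps w[of a] by (auto simp: z_def p_def)
  qed
  have "0 < (\<Sum>a\<in>insert i I. \<Sum>b\<in>insert i I. z a * G a b * z b)"
    by (rule insert.prems) (auto simp: z_def)
  also have "\<dots> = (\<Sum>a\<in>insert i I. z a * (if a = i then p else 0))"
    by (intro sum.cong refl) (simp only: mult.assoc sum_distrib_left[symmetric] Gz)
  also have "\<dots> = (\<Sum>a\<in>insert i I. if a = i then p else 0)"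
    by (intro sum.cong refl) (simp add: z_def)
  also have "\<dots> = p" using insert.hyps by (subst sum.delta) auto
  finally have p: "p > 0" .
  define t where "t = (v i - (\<Sum>b\<in>I. G i b * x b)) / p"
  define x' where "x' a = (if a = i then 0 else x a)" for a
  have Gx': "(\<Sum>b\<in>insert i I. G a b * x' b) = (\<Sum>b\<in>I. G a b * x b)" for a
  proof -
    have "(\<Sum>b\<in>I. G a b * x' b) = (\<Sum>b\<in>I. G a b * x b)" using insert.hyps by (intro sum.cong) (auto simp: x'_def)
    then show ?thesis using insert.hyps by (simp add: x'_def)
  qed
  have "(\<Sum>b\<in>insert i I. G a b * (x' b + t * z b)) = v a" if "a \<in> insert i I" for a
  proof -
    have "(\<Sum>b\<in>insert i I. G a b * (x' b + t * z b)) = (\<Sum>b\<in>insert i I. G a b * x' b) + t * (\<Sum>b\<in>insert i I. G a b * z b)"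
      by (simp only: distrib_left sum.distrib sum_distrib_left mult.left_commute)
    also have "\<dots> = v a" unfolding Gx' Gz[OF that] using that x p by (auto simp: t_def)
    finally show ?thesis .
  qed
  then show ?case by (intro exI[of _ "\<lambda>b. x' b + t * z b"] ballI)
qed simp

text \<open>The solutions for the unit vectors form a right inverse. Evaluating
  \<open>K\<^sup>T G K\<close> in two ways shows that it is symmetric, and so it is a left inverse
  too.\<close>

lemma positive_definite_inverse:
  fixes G :: "'i \<Rightarrow> 'i \<Rightarrow> real"
  assumes sym: "\<And>a b. G a b = G b a" and I: "finite I"
    and pos: "\<And>y. \<exists>a\<in>I. y a \<noteq> 0 \<Longrightarrow> 0 < (\<Sum>a\<in>I. \<Sum>b\<in>I. y a * G a b * y b)"
  shows "\<exists>K. inverse_matrix I G K"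
proof -
  have "\<forall>b. \<exists>x. \<forall>a\<in>I. (\<Sum>c\<in>I. G a c * x c) = (if a = b then 1 else 0)"
    by (intro allI positive_definite_solve[OF sym I]) (rule pos)
  then obtain X where X: "\<And>a b. a \<in> I \<Longrightarrow> (\<Sum>c\<in>I. G a c * X b c) = (if a = b then 1 else 0)" by metis
  define K where "K c b = X b c" for c b
  have GK: "(\<Sum>c\<in>I. G a c * K c b) = (if a = b then 1 else 0)" if "a \<in> I" for a b
    using X[OF that] by (simp add: K_def)
  have Ksym: "K a b = K b a" if "a \<in> I" "b \<in> I" for a b
  proof -
    have "(\<Sum>c\<in>I. \<Sum>e\<in>I. K c a * G c e * K e b) = (\<Sum>c\<in>I. K c a * (if c = b then 1 else 0))"
      by (intro sum.cong refl) (simp add: mult.assoc sum_distrib_left[symmetric] GK)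
    also have "\<dots> = K b a" using I that by (simp add: if_distrib cong: if_cong)
    finally have 1: "(\<Sum>c\<in>I. \<Sum>e\<in>I. K c a * G c e * K e b) = K b a" .
    have "(\<Sum>c\<in>I. \<Sum>e\<in>I. K c a * G c e * K e b) = (\<Sum>e\<in>I. (\<Sum>c\<in>I. G e c * K c a) * K e b)"
      by (subst sum.swap) (simp add: sum_distrib_right sum_distrib_left sym mult_ac)
    also have "\<dots> = (\<Sum>e\<in>I. if e = a then K e b else 0)" by (intro sum.cong refl) (simp add: GK)
    also have "\<dots> = K a b" using I that by simp
    finally show ?thesis using 1 by simp
  qed
  have KG: "(\<Sum>c\<in>I. K a c * G c b) = (if a = b then 1 else 0)" if "a \<in> I" "b \<in> I" for a b
  proof -
    have "(\<Sum>c\<in>I. K a c * G c b) = (\<Sum>c\<in>I. G b c * K c a)"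
      by (intro sum.cong refl) (use Ksym[OF that(1)] sym[of b] in \<open>simp add: mult.commute\<close>)
    then show ?thesis using GK[OF that(2)] by (auto simp: eq_commute)
  qed
  show ?thesis unfolding inverse_matrix_def has_sum_finite_iff[OF I]
    by (intro exI[of _ K] ballI conjI) (simp_all only: GK KG)
qed

lemma infsum_iterate:
  fixes f :: "'x \<times> 'y \<Rightarrow> real"
  assumes "f summable_on UNIV"
  shows "(\<Sum>\<^sub>\<infinity>x. \<Sum>\<^sub>\<infinity>y. f (x, y)) = infsum f UNIV" "(\<lambda>x. \<Sum>\<^sub>\<infinity>y. f (x, y)) summable_on UNIV"
    "(\<lambda>y. f (x, y)) summable_on UNIV"
proof -
  have f: "(\<lambda>(x, y). f (x, y)) summable_on Sigma UNIV (\<lambda>_. UNIV)" using assms by simp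
  show "(\<Sum>\<^sub>\<infinity>x. \<Sum>\<^sub>\<infinity>y. f (x, y)) = infsum f UNIV" using infsum_Sigma'_banach[OF f] by simp
  show "(\<lambda>x. \<Sum>\<^sub>\<infinity>y. f (x, y)) summable_on UNIV" by (rule summable_on_Sigma_banach[OF f])
  show "(\<lambda>y. f (x, y)) summable_on UNIV" using summable_on_SigmaD1[OF f, of x] by simp
qed

context gram_bound
begin

text \<open>With \<open>x = K v\<close> and \<open>Q = v\<^sup>T K v\<close>, Fubini gives \<open>x\<^sup>T G x = Q\<close>, and the bound for the truncations of \<open>x\<close>
  to finite index sets becomes \<open>2 Q - Q \<le> s\<close> in the limit.\<close>

lemma infinite_inverse_form_le:
  assumes K: "inverse_matrix UNIV G K" and app: "inverse_applicable G K v"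
  shows "(\<Sum>\<^sub>\<infinity>(a, b)\<in>UNIV. v a * K a b * v b) \<le> s"
proof -
  define x where "x b = (\<Sum>\<^sub>\<infinity>a. K b a * v a)" for b
  define Q where "Q = (\<Sum>\<^sub>\<infinity>(a, b)\<in>UNIV. v a * K a b * v b)"
  define f where "f = (\<lambda>(a, b, c, e). (K b a * v a) * G b c * (K c e * v e))"
  have f: "f summable_on UNIV" and q: "(\<lambda>(a, b). v a * K a b * v b) summable_on UNIV"
    using app by (auto simp: inverse_applicable_def f_def)
  have vx: "(\<Sum>\<^sub>\<infinity>b. v a * K a b * v b) = x a * v a" for a
    using infsum_cmult_right'[of "v a" "\<lambda>b. K a b * v b" UNIV] by (simp add: x_def mult_ac)
  have Q_eq: "(\<Sum>\<^sub>\<infinity>a. x a * v a) = Q" and Q_sum: "(\<lambda>a. x a * v a) summable_on UNIV"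
    using infsum_iterate(1,2)[OF q] by (simp_all add: vx Q_def)
  \<comment> \<open>Grouping \<open>f\<close> by \<open>(b, c)\<close> and summing over
    \<open>(a, e)\<close> yields \<open>x\<^sup>T G x\<close>.\<close>
  have b1: "bij (\<lambda>((b, c), (a, e)). (a, b, c, e))"
    by (rule bij_betw_byWitness[where f' = "\<lambda>(a, b, c, e). ((b, c), (a, e))"]) auto
  define g where "g = (\<lambda>p. f ((\<lambda>((b, c), (a, e)). (a, b, c, e)) p))"
  have g: "g summable_on UNIV" "infsum g UNIV = infsum f UNIV"
    unfolding g_def using summable_on_reindex_bij_betw[OF b1, of f] infsum_reindex_bij_betw[OF b1, of f] f by auto
  have inner: "(\<Sum>\<^sub>\<infinity>y. g ((b, c), y)) = x b * G b c * x c" for b c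
  proof -
    have "(\<Sum>\<^sub>\<infinity>y. g ((b, c), y)) = (\<Sum>\<^sub>\<infinity>a. \<Sum>\<^sub>\<infinity>e. g ((b, c), (a, e)))"
      using infsum_iterate(1)[OF infsum_iterate(3)[OF g(1), of "(b, c)"]] by simp
    also have "\<dots> = (\<Sum>\<^sub>\<infinity>a. (K b a * v a) * (G b c * x c))"
      by (rule infsum_cong) (simp add: g_def f_def x_def infsum_cmult_right' mult.assoc)
    also have "\<dots> = x b * (G b c * x c)" by (simp add: infsum_cmult_left' x_def)
    finally show ?thesis by (simp add: mult.assoc)
  qed
  define r where "r = (\<lambda>(b, c). x b * G b c * x c)"
  have r_eq: "r = (\<lambda>p. \<Sum>\<^sub>\<infinity>y. g (p, y))" by (auto simp: r_def inner)
  have r: "r summable_on UNIV" "infsum r UNIV = infsum f UNIV"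
    unfolding r_eq using infsum_iterate(1,2)[OF g(1)] g(2) by auto
  \<comment> \<open>Summing over \<open>c\<close> innermost uses \<open>G K = 1\<close> instead and
    collapses the sum to \<open>Q\<close>. The groupings agree because \<open>f\<close> is
    absolutely summable.\<close>
  have b2: "bij (\<lambda>((a, b, e), c). (a, b, c, e))"
    by (rule bij_betw_byWitness[where f' = "\<lambda>(a, b, c, e). ((a, b, e), c)"]) auto
  define g2 where "g2 = (\<lambda>p. f ((\<lambda>((a, b, e), c). (a, b, c, e)) p))"
  have g2: "g2 summable_on UNIV" "infsum g2 UNIV = infsum f UNIV"
    unfolding g2_def using summable_on_reindex_bij_betw[OF b2, of f] infsum_reindex_bij_betw[OF b2, of f] f by auto
  have GK: "(\<Sum>\<^sub>\<infinity>c. G b c * K c e) = (if b = e then 1 else 0)" for b e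
    by (rule infsumI) (use K in \<open>auto simp: inverse_matrix_def\<close>)
  have inner2: "(\<Sum>\<^sub>\<infinity>c. g2 ((a, b, e), c)) = (if b = e then K b a * v a * v b else 0)" for a b e
  proof -
    have "(\<Sum>\<^sub>\<infinity>c. g2 ((a, b, e), c)) = (\<Sum>\<^sub>\<infinity>c. (K b a * v a * v e) * (G b c * K c e))"
      by (rule infsum_cong) (simp add: g2_def f_def mult_ac)
    also have "\<dots> = (K b a * v a * v e) * (\<Sum>\<^sub>\<infinity>c. G b c * K c e)" by (rule infsum_cmult_right')
    finally show ?thesis by (simp add: GK)
  qed
  have "infsum f UNIV = (\<Sum>\<^sub>\<infinity>p. \<Sum>\<^sub>\<infinity>c. g2 (p, c))" using infsum_iterate(1)[OF g2(1)] g2(2) by simp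
  also have "\<dots> = (\<Sum>\<^sub>\<infinity>(a, b, e)\<in>UNIV. if b = e then K b a * v a * v b else 0)"
    by (rule infsum_cong) (auto simp: inner2)
  also have "\<dots> = (\<Sum>\<^sub>\<infinity>(a, b, e)\<in>{(a, b, e). b = e}. v b * K b a * v a)"
    by (rule infsum_cong_neutral) (auto simp: mult_ac)
  also have "\<dots> = (\<Sum>\<^sub>\<infinity>(b, a)\<in>UNIV. v b * K b a * v a)"
  proof -
    have "bij_betw (\<lambda>(b, a). (a, b, b)) UNIV {(a, b, e). b = e}"
      by (rule bij_betw_byWitness[where f' = "\<lambda>(a, b, e). (b, a)"]) auto
    from infsum_reindex_bij_betw[OF this, of "\<lambda>(a, b, e). v b * K b a * v a"]
    show ?thesis by (simp add: case_prod_unfold)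
  qed
  finally have R: "infsum f UNIV = Q" by (simp add: Q_def)
  have lim1: "((\<lambda>I. \<Sum>a\<in>I. x a * v a) \<longlongrightarrow> Q) (finite_subsets_at_top UNIV)"
    using has_sum_infsum[OF Q_sum] Q_eq by (simp add: has_sum_def)
  \<comment> \<open>The bound concerns square truncations \<open>I \<times> I\<close> only; these
    are cofinal among the finite sets of pairs, so the double sum is also the limit along
    squares.\<close>
  have sq: "filterlim (\<lambda>I. I \<times> I) (finite_subsets_at_top UNIV) (finite_subsets_at_top (UNIV :: 'i set))"
    unfolding filterlim_finite_subsets_at_top
  proof (intro allI impI)
    fix X :: "('i \<times> 'i) set" assume "finite X \<and> X \<subseteq> UNIV"
    then have "finite (fst ` X \<union> snd ` X)" by auto
    then have "eventually (\<lambda>I. finite I \<and> fst ` X \<union> snd ` X \<subseteq> I \<and> I \<subseteq> UNIV) (finite_subsets_at_top (UNIV :: 'i set))"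
      unfolding eventually_finite_subsets_at_top by blast
    then show "eventually (\<lambda>I. finite (I \<times> I) \<and> X \<subseteq> I \<times> I \<and> I \<times> I \<subseteq> UNIV) (finite_subsets_at_top (UNIV :: 'i set))"
      by eventually_elim force
  qed
  have "(sum r \<longlongrightarrow> Q) (finite_subsets_at_top UNIV)"
    using has_sum_infsum[OF r(1)] r(2) R by (simp add: has_sum_def)
  from filterlim_compose[OF this sq]
  have lim2: "((\<lambda>I. \<Sum>p\<in>I \<times> I. r p) \<longlongrightarrow> Q) (finite_subsets_at_top UNIV)" .
  have "2 * Q - Q \<le> s"
  proof (rule tendsto_upperbound)
    show "((\<lambda>I. 2 * (\<Sum>a\<in>I. x a * v a) - (\<Sum>p\<in>I \<times> I. r p)) \<longlongrightarrow> 2 * Q - Q) (finite_subsets_at_top UNIV)"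
      by (intro tendsto_intros lim1 lim2)
    show "eventually (\<lambda>I. 2 * (\<Sum>a\<in>I. x a * v a) - (\<Sum>p\<in>I \<times> I. r p) \<le> s) (finite_subsets_at_top (UNIV :: 'i set))"
    proof (rule eventually_finite_subsets_at_top_weakI)
      fix I :: "'i set" assume "finite I"
      then show "2 * (\<Sum>a\<in>I. x a * v a) - (\<Sum>p\<in>I \<times> I. r p) \<le> s"
        using bound[of I x] by (simp add: r_def sum.cartesian_product)
    qed
  qed simp
  then show ?thesis by (simp add: Q_def)
qed

end

section \<open>The thermal system\<close>

text \<open>At a point where the differentials are independent, the derivative of \<open>Hs\<close>
  in a chart is onto, so the image of the chart contains a nonempty open set; a polynomial vanishing
  there has zero coefficients.\<close>

lemma conserved_monomials_independent:
  fixes atlas :: "('m::{second_countable_topology, t2_space}, 'n::finite) chart set"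
    and Hs :: "'m \<Rightarrow> real^'k::finite"
  assumes atlas: "smooth_atlas atlas" and smooth: "smooth_map atlas Hs"
    and indep: "functionally_independent atlas Hs"
    and L: "finite L" and zero: "\<And>m. (\<Sum>l\<in>L. a l * monomial Hs l m) = 0" and l: "l \<in> L"
  shows "a l = 0"
proof -
  have "{m. differentials_independent atlas Hs m} \<noteq> {}"
    using indep unfolding functionally_independent_def by (metis closure_empty empty_not_UNIV)
  then obtain m where m: "differentials_independent atlas Hs m" by blast
  obtain c where c: "c \<in> atlas" "m \<in> fst c" using atlas unfolding smooth_atlas_def by blast
  have op: "open (chart_range c)" using atlas c unfolding smooth_atlas_def by blast
  define x where "x = snd c m"
  have x: "x \<in> chart_range c" using c by (simp add: x_def chart_range_def)
  define f where "f = Hs \<circ> chart_inv c"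
  have sm: "smooth_on (chart_range c) f" using smooth c by (simp add: smooth_map_def f_def)
  have cont: "continuous_on (chart_range c) f"
    using sm unfolding smooth_on_def by (metis C_on.simps(1))
  have df: "f differentiable (at x)"
    using sm x unfolding smooth_on_def by (metis C_on.simps(2))
  have lin: "linear (fd f x)" by (rule linear_frechet_derivative[OF df])
  \<comment> \<open>A normal vector \<open>b\<close> of a proper range would be a linear relation
    between the differentials.\<close>
  have "span (range (fd f x)) = UNIV"
  proof (rule ccontr)
    assume "span (range (fd f x)) \<noteq> UNIV"
    then obtain b where b: "b \<noteq> 0" "span (range (fd f x)) \<subseteq> {y. b \<bullet> y = 0}"
      using span_not_univ_subset_hyperplane by blast
    have "(\<Sum>i\<in>UNIV. b $ i * frechet_derivative (\<lambda>x. Hs (chart_inv c x) $ i) (at x) v) = 0" for v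
    proof -
      have "fd f x v \<in> span (range (fd f x))" by (rule span_base) simp
      then have "b \<bullet> fd f x v = 0" using b by blast
      then show ?thesis
        using frechet_derivative_component[OF df, of _ v] by (simp add: inner_vec_def f_def o_def)
    qed
    then have "b = 0" using m c unfolding differentials_independent_def x_def by blast
    then show False using b by simp
  qed
  then have "surj (fd f x)" using lin by (metis linear_span_image span_UNIV)
  then obtain g where g: "linear g" "fd f x \<circ> g = id" using linear_surjective_right_inverse[OF lin] by blast
  have "f x \<in> interior (f ` chart_range c)"
    by (rule sussmann_open_mapping[OF op cont x frechet_derivative_works[THEN iffD1, OF df] _ g(2) order_refl])
       (use g op x in \<open>auto simp: linear_conv_bounded_linear interior_open\<close>)
  then have ne: "interior (f ` chart_range c) \<noteq> {}" by blast
  show ?thesis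
  proof (rule polynomial_zero_on_open[OF L open_interior ne _ l])
    fix \<alpha> assume "\<alpha> \<in> interior (f ` chart_range c)"
    then obtain m' where "\<alpha> = Hs m'" using interior_subset by (force simp: f_def)
    then show "(\<Sum>l\<in>L. a l * (\<Prod>i\<in>UNIV. (\<alpha> $ i) ^ l i)) = 0" using zero[of m'] by (simp add: monomial_def)
  qed
qed

text \<open>Positivity of the partition function is assumed here; in \<open>proposition2\<close> it
  is obtained from a cell of positive Gibbs measure.\<close>

locale thermal_system =
  fixes atlas :: "('m::{second_countable_topology, t2_space}, 'n::finite) chart set"
    and \<omega> :: "('m, 'n) chart \<Rightarrow> real^'n \<Rightarrow> real^'n^'n"
    and H :: "'m \<Rightarrow> real" and \<gamma> :: "'m \<Rightarrow> real \<Rightarrow> 'm" and vol :: "'m measure"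
    and Hs :: "'m \<Rightarrow> real^'k::{finite, linorder}" and D :: "(real^'k::{finite, linorder}) set"
    and \<nu> :: "real^'k::{finite, linorder} \<Rightarrow> 'm measure" and \<beta> :: real and A :: "'m \<Rightarrow> real"
  assumes hamiltonian: "hamiltonian_system atlas \<omega> H \<gamma>"
    and liouville: "liouville_measure atlas \<omega> vol"
    and partition_integrable: "integrable vol (\<lambda>m. exp (- \<beta> * H m))"
    and conserved: "conserved_quantities atlas H \<gamma> Hs"
    and monomial_L2: "\<And>l. monomial Hs l \<in> Lp_space 2 vol H \<beta>"
    and micro: "microcanonical_measures vol Hs D \<nu>"
    and A_L1: "A \<in> Lp_space 1 vol H \<beta>"
    and correlation: "correlation_converges vol H \<beta> \<gamma> A"
    and partition_pos: "partition_function vol H \<beta> > 0"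
begin

abbreviation "Z \<equiv> partition_function vol H \<beta>"

definition w :: "real^'k::{finite, linorder} \<Rightarrow> real" where "w \<alpha> = exp (- \<beta> * \<alpha> $ Min UNIV) / Z"

sublocale flow: liouville_flow atlas "\<lambda>c. hamiltonian_domain.X (\<omega> c) (H \<circ> chart_inv c)"
  "\<lambda>c. hamiltonian_domain.J (\<omega> c) (H \<circ> chart_inv c)" \<gamma> vol "\<lambda>c x. sqrt (det (\<omega> c x))"
  by (rule hamiltonian_liouville_flow(1)[OF hamiltonian liouville])

lemma sets_vol [measurable_cong, simp]: "sets vol = sets borel" by (rule flow.sets_vol)

lemma space_vol [simp]: "space vol = UNIV"
  using sets_eq_imp_space_eq[OF sets_vol] by simp

lemma Hs_continuous: "continuous_on UNIV Hs"
proof -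
  have "isCont Hs m" for m
  proof -
    obtain c where c: "c \<in> atlas" "m \<in> fst c" using flow.chart_exists by blast
    have "smooth_on (chart_range c) (Hs \<circ> chart_inv c)"
      using conserved c by (simp add: conserved_quantities_def smooth_map_def)
    then have "continuous_on (chart_range c) (Hs \<circ> chart_inv c)"
      unfolding smooth_on_def by (metis C_on.simps(1))
    then have "continuous_on (fst c) (\<lambda>m. (Hs \<circ> chart_inv c) (snd c m))"
      by (rule continuous_on_compose2[OF _ flow.chart_simps(5)[OF c(1)]]) (use flow.chart_simps[OF c(1)] in auto)
    then have "continuous_on (fst c) Hs"
      by (rule continuous_on_cong[THEN iffD1, rotated 2]) (use flow.chart_simps[OF c(1)] in auto)
    then show ?thesis using c flow.chart(1)[OF c(1)] by (simp add: continuous_on_eq_continuous_at)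
  qed
  then show ?thesis by (simp add: continuous_on_eq_continuous_at)
qed

lemma Hs_measurable [measurable]: "Hs \<in> borel_measurable borel"
  by (rule borel_measurable_continuous_onI[OF Hs_continuous])

lemma Hs_nth_measurable [measurable]: "(\<lambda>m. Hs m $ i) \<in> borel_measurable borel"
  by (rule borel_measurable_continuous_onI) (intro continuous_intros Hs_continuous)

lemma w_measurable [measurable]: "w \<in> borel_measurable borel"
  unfolding w_def[abs_def] by measurable

lemma H_eq: "H m = Hs m $ Min UNIV"
  using conserved by (simp add: conserved_quantities_def)

lemma w_pos: "w \<alpha> > 0" and w_Hs: "w (Hs m) = exp (- \<beta> * H m) / Z"
  using partition_pos by (simp_all add: w_def H_eq)

sublocale dis: disintegration vol Hs D \<nu> w
  by unfold_locales (use micro w_pos in \<open>auto simp: less_imp_le\<close>)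

abbreviation "\<mu> \<equiv> dis.\<mu>"

lemma gibbs_eq: "gibbs_measure vol H \<beta> = \<mu>"
  by (simp add: gibbs_measure_def dis.\<mu>_def w_Hs)

lemma space_\<mu> [simp]: "space \<mu> = UNIV" by (simp add: dis.\<mu>_def)

lemma integral_\<mu>:
  assumes [measurable]: "f \<in> borel_measurable borel"
  shows "(\<integral>m. f m \<partial>\<mu>) = 1 / Z * (\<integral>m. f m * exp (- \<beta> * H m) \<partial>vol)"
    "integrable \<mu> f \<longleftrightarrow> integrable vol (\<lambda>m. f m * exp (- \<beta> * H m))"
proof -
  have eq: "w (Hs m) * f m = 1 / Z * (f m * exp (- \<beta> * H m))" for m by (simp add: w_Hs)
  have "(\<integral>m. f m \<partial>\<mu>) = (\<integral>m. w (Hs m) * f m \<partial>vol)"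
    unfolding dis.\<mu>_def using w_pos by (subst integral_density) (auto simp: less_imp_le)
  then show "(\<integral>m. f m \<partial>\<mu>) = 1 / Z * (\<integral>m. f m * exp (- \<beta> * H m) \<partial>vol)" unfolding eq by simp
  have "integrable \<mu> f \<longleftrightarrow> integrable vol (\<lambda>m. w (Hs m) * f m)"
    unfolding dis.\<mu>_def using w_pos by (subst integrable_density) (auto simp: less_imp_le)
  then show "integrable \<mu> f \<longleftrightarrow> integrable vol (\<lambda>m. f m * exp (- \<beta> * H m))"
    unfolding eq using partition_pos by (subst (asm) integrable_mult_left_iff) auto
qed

lemma thermal_inner_eq:
  assumes [measurable]: "F \<in> borel_measurable borel" "G \<in> borel_measurable borel"
  shows "thermal_inner vol H \<beta> F G = (\<integral>m. F m * G m \<partial>\<mu>)"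
  unfolding thermal_inner_def by (subst integral_\<mu>(1)) auto

sublocale \<mu>: finite_measure \<mu>
proof
  have "integrable \<mu> (\<lambda>_. 1 :: real)" using partition_integrable by (simp add: integral_\<mu>(2))
  then show "emeasure \<mu> (space \<mu>) \<noteq> \<infinity>" by (simp add: integrable_iff_bounded less_top)
qed

text \<open>The volume has the density \<open>1 / w (Hs m)\<close> with respect to the finite
  measure \<open>\<mu>\<close>. This allows iterated integration over times and points.\<close>

lemma sigma_finite_vol: "sigma_finite_measure vol"
proof -
  have "density \<mu> (\<lambda>m. ennreal (1 / w (Hs m))) = density vol (\<lambda>m. ennreal (w (Hs m)) * ennreal (1 / w (Hs m)))"
    unfolding dis.\<mu>_def by (rule density_density_eq) measurable
  also have "(\<lambda>m. ennreal (w (Hs m)) * ennreal (1 / w (Hs m))) = (\<lambda>_. 1)"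
    using w_pos by (auto simp: ennreal_mult'[symmetric] less_imp_le less_imp_neq[symmetric])
  finally have "density \<mu> (\<lambda>m. ennreal (1 / w (Hs m))) = vol" by (simp add: density_1)
  moreover have "sigma_finite_measure (density \<mu> (\<lambda>m. ennreal (1 / w (Hs m))))"
    by (subst \<mu>.sigma_finite_iff_density_finite) auto
  ultimately show ?thesis by simp
qed

lemma flow_measurable [measurable]: "(\<lambda>(t, m). \<gamma> m t) \<in> borel_measurable (borel \<Otimes>\<^sub>M borel)"
  unfolding borel_prod by (rule borel_measurable_continuous_onI[OF flow.flow_jointly_continuous])

lemma flow_measurable1 [measurable]: "(\<lambda>m. \<gamma> m t) \<in> borel_measurable borel"
  by (rule borel_measurable_continuous_onI[OF flow.flow_continuous])

lemma Hs_flow [simp]: "Hs (\<gamma> m t) = Hs m"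
  using conserved by (simp add: conserved_quantities_def)

lemma distr_vol_flow: "t \<ge> 0 \<Longrightarrow> distr vol borel (\<lambda>m. \<gamma> m t) = vol"
  by (rule measure_eqI) (auto simp: emeasure_distr flow.emeasure_flow_vimage)

text \<open>The weight depends on \<open>Hs\<close> only and is constant along the flow, so
  invariance passes from the volume to \<open>\<mu>\<close>.\<close>

lemma distr_flow: assumes t: "t \<ge> 0" shows "distr \<mu> borel (\<lambda>m. \<gamma> m t) = \<mu>"
proof (rule measure_eqI)
  fix E assume "E \<in> sets (distr \<mu> borel (\<lambda>m. \<gamma> m t))"
  then have E [measurable]: "E \<in> sets borel" by simp
  have "emeasure (distr \<mu> borel (\<lambda>m. \<gamma> m t)) E = emeasure \<mu> ((\<lambda>m. \<gamma> m t) -` E)"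
    by (subst emeasure_distr) auto
  also have "\<dots> = (\<integral>\<^sup>+m. ennreal (w (Hs m)) * indicator ((\<lambda>m. \<gamma> m t) -` E) m \<partial>vol)"
    unfolding dis.\<mu>_def using measurable_sets[OF flow_measurable1 E, of t] by (subst emeasure_density) auto
  also have "\<dots> = (\<integral>\<^sup>+m. (\<lambda>m. ennreal (w (Hs m)) * indicator E m) (\<gamma> m t) \<partial>vol)"
    by (intro nn_integral_cong) (auto simp: indicator_def)
  also have "\<dots> = (\<integral>\<^sup>+m. ennreal (w (Hs m)) * indicator E m \<partial>distr vol borel (\<lambda>m. \<gamma> m t))"
    by (subst nn_integral_distr) auto
  also have "\<dots> = emeasure \<mu> E"
    unfolding distr_vol_flow[OF t] dis.\<mu>_def by (subst emeasure_density) auto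
  finally show "emeasure (distr \<mu> borel (\<lambda>m. \<gamma> m t)) E = emeasure \<mu> E" .
qed simp

lemma nn_integral_flow:
  assumes "t \<ge> 0" and [measurable]: "F \<in> borel_measurable borel"
  shows "(\<integral>\<^sup>+m. F (\<gamma> m t) \<partial>\<mu>) = (\<integral>\<^sup>+m. F m \<partial>\<mu>)"
  using nn_integral_distr[of "\<lambda>m. \<gamma> m t" \<mu> borel F] by (simp add: distr_flow[OF assms(1)])

lemma integral_flow:
  fixes F :: "'m \<Rightarrow> real"
  assumes "t \<ge> 0" and [measurable]: "F \<in> borel_measurable borel"
  shows "(\<integral>m. F (\<gamma> m t) \<partial>\<mu>) = (\<integral>m. F m \<partial>\<mu>)"
  using integral_distr[of "\<lambda>m. \<gamma> m t" \<mu> borel F] by (simp add: distr_flow[OF assms(1)])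

lemma A_measurable [measurable]: "A \<in> borel_measurable borel"
  using A_L1 measurable_cong_sets[OF sets_vol refl, where N = "borel :: real measure"] by (auto simp: Lp_space_def)

lemma A_integrable: "integrable \<mu> A"
proof -
  have "\<bar>A m\<bar> powr 1 = \<bar>A m\<bar>" for m by simp
  then have "integrable vol (\<lambda>m. \<bar>A m\<bar> * exp (- \<beta> * H m))" using A_L1 by (simp add: Lp_space_def)
  then have "integrable \<mu> (\<lambda>m. \<bar>A m\<bar>)" by (subst integral_\<mu>(2)) auto
  then show ?thesis by (simp add: integrable_abs_iff)
qed

sublocale process: stationary_process \<mu> "\<lambda>t m. A (\<gamma> m t)"
proof unfold_locales
  show am: "(\<lambda>(t, m). A (\<gamma> m t)) \<in> borel_measurable (lborel \<Otimes>\<^sub>M \<mu>)"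
    by measurable
  show "(\<integral>\<^sup>+m. ennreal \<bar>A (\<gamma> m s) * A (\<gamma> m t)\<bar> \<partial>\<mu>) = (\<integral>\<^sup>+m. ennreal \<bar>A (\<gamma> m 0) * A (\<gamma> m (t - s))\<bar> \<partial>\<mu>)"
    if "0 \<le> s" "s \<le> t" for s t
    using nn_integral_flow[OF that(1), of "\<lambda>m. ennreal \<bar>A (\<gamma> m 0) * A (\<gamma> m (t - s))\<bar>"] by (simp add: flow.flow_add)
  show "(\<integral>m. A (\<gamma> m s) * A (\<gamma> m t) \<partial>\<mu>) = (\<integral>m. A (\<gamma> m 0) * A (\<gamma> m (t - s)) \<partial>\<mu>)"
    if "0 \<le> s" "s \<le> t" for s t
    using integral_flow[OF that(1), of "\<lambda>m. A (\<gamma> m 0) * A (\<gamma> m (t - s))"] by (simp add: flow.flow_add)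
  show "(\<integral>\<^sup>+t. indicator {0..T} t * (\<integral>\<^sup>+m. ennreal \<bar>A (\<gamma> m 0) * A (\<gamma> m t)\<bar> \<partial>\<mu>) \<partial>lborel) < \<infinity>" if T: "T > 0" for T
  proof -
    interpret v: sigma_finite_measure vol by (rule sigma_finite_vol)
    let ?f = "\<lambda>(t, m). indicator {0..T} t * (A m * A (\<gamma> m t) * exp (- \<beta> * H m))"
    have f: "integrable (lborel \<Otimes>\<^sub>M vol) ?f"
      using correlation T unfolding correlation_converges_def set_integrable_def evolved_def
      by (auto simp: indicator_times split_def)
    have [measurable]: "H \<in> borel_measurable borel"
      unfolding H_eq[abs_def] by measurable
    have "(\<integral>\<^sup>+t. indicator {0..T} t * (\<integral>\<^sup>+m. ennreal \<bar>A (\<gamma> m 0) * A (\<gamma> m t)\<bar> \<partial>\<mu>) \<partial>lborel)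
      = (\<integral>\<^sup>+t. \<integral>\<^sup>+m. ennreal (1 / Z) * ennreal (norm (?f (t, m))) \<partial>vol \<partial>lborel)"
    proof (rule nn_integral_cong)
      fix t :: real
      have "(\<integral>\<^sup>+m. ennreal \<bar>A (\<gamma> m 0) * A (\<gamma> m t)\<bar> \<partial>\<mu>) = (\<integral>\<^sup>+m. ennreal (w (Hs m)) * ennreal \<bar>A m * A (\<gamma> m t)\<bar> \<partial>vol)"
        unfolding dis.\<mu>_def by (subst nn_integral_density) auto
      also have "\<dots> = (\<integral>\<^sup>+m. ennreal (1 / Z) * ennreal \<bar>A m * A (\<gamma> m t) * exp (- \<beta> * H m)\<bar> \<partial>vol)"
        using partition_pos
        by (intro nn_integral_cong) (simp add: w_Hs ennreal_mult'[symmetric] abs_mult)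
      finally show "indicator {0..T} t * (\<integral>\<^sup>+m. ennreal \<bar>A (\<gamma> m 0) * A (\<gamma> m t)\<bar> \<partial>\<mu>)
        = (\<integral>\<^sup>+m. ennreal (1 / Z) * ennreal (norm (?f (t, m))) \<partial>vol)"
        by (auto simp: indicator_def)
    qed
    also have "\<dots> = (\<integral>\<^sup>+p. ennreal (1 / Z) * ennreal (norm (?f p)) \<partial>(lborel \<Otimes>\<^sub>M vol))"
      by (rule v.nn_integral_fst[where f = "\<lambda>p. ennreal (1 / Z) * ennreal (norm (?f p))"]) measurable
    also have "\<dots> = ennreal (1 / Z) * (\<integral>\<^sup>+p. ennreal (norm (?f p)) \<partial>(lborel \<Otimes>\<^sub>M vol))"
      by (rule nn_integral_cmult) measurable
    also have "\<dots> < \<infinity>" using f unfolding integrable_iff_bounded by (auto simp: ennreal_mult_less_top)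
    finally show ?thesis .
  qed
qed

lemma mean_correlation_eq: "mean_correlation vol H \<beta> \<gamma> A T = process.u T / T"
proof -
  have "thermal_inner vol H \<beta> (evolved \<gamma> A 0) (evolved \<gamma> A t) = process.c t" for t
    unfolding process.c_def by (subst thermal_inner_eq) (auto simp: evolved_def[abs_def])
  then show ?thesis unfolding mean_correlation_def by (simp add: process.u_eq)
qed

text \<open>Moving \<open>m\<close> along the flow preserves \<open>\<mu>\<close> and
  \<open>\<psi>\<close>, so each instant contributes the integral of \<open>A * \<psi>\<close>.
  Boundedness of \<open>\<psi>\<close> makes Fubini's theorem applicable although \<open>A\<close>
  is only in L^1.\<close>

lemma integral_S_invariant:
  assumes [measurable]: "\<psi> \<in> borel_measurable borel" and bound: "\<And>m. \<bar>\<psi> m\<bar> \<le> b"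
    and inv: "\<And>m t. \<psi> (\<gamma> m t) = \<psi> m" and T: "T \<ge> 0"
  shows "(\<integral>m. process.S T m * \<psi> m \<partial>\<mu>) = T * (\<integral>m. A m * \<psi> m \<partial>\<mu>)"
proof -
  have b: "b \<ge> 0" using bound abs_ge_zero order_trans by blast
  let ?f = "\<lambda>t m. indicator {0..T} t * (A (\<gamma> m t) * \<psi> m)"
  have int: "integrable (lborel \<Otimes>\<^sub>M \<mu>) (\<lambda>(t, m). ?f t m)"
  proof (rule integrableI_bounded)
    have "(\<integral>\<^sup>+p. ennreal (norm (case p of (t, m) \<Rightarrow> ?f t m)) \<partial>(lborel \<Otimes>\<^sub>M \<mu>))
      = (\<integral>\<^sup>+t. \<integral>\<^sup>+m. ennreal (norm (?f t m)) \<partial>\<mu> \<partial>lborel)"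
      by (subst \<mu>.nn_integral_fst[symmetric]) auto
    also have "\<dots> \<le> (\<integral>\<^sup>+t. (ennreal b * (\<integral>\<^sup>+m. ennreal \<bar>A m\<bar> \<partial>\<mu>)) * indicator {0..T} t \<partial>lborel)"
    proof (rule nn_integral_mono)
      fix t
      show "(\<integral>\<^sup>+m. ennreal (norm (?f t m)) \<partial>\<mu>) \<le> (ennreal b * (\<integral>\<^sup>+m. ennreal \<bar>A m\<bar> \<partial>\<mu>)) * indicator {0..T} t"
      proof (cases "t \<in> {0..T}")
        case True
        have "(\<integral>\<^sup>+m. ennreal (norm (?f t m)) \<partial>\<mu>) \<le> (\<integral>\<^sup>+m. ennreal b * ennreal \<bar>A (\<gamma> m t)\<bar> \<partial>\<mu>)"
        proof (rule nn_integral_mono)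
          fix m
          have "\<bar>A (\<gamma> m t)\<bar> * \<bar>\<psi> m\<bar> \<le> \<bar>A (\<gamma> m t)\<bar> * b" using bound by (intro mult_left_mono) auto
          then show "ennreal (norm (?f t m)) \<le> ennreal b * ennreal \<bar>A (\<gamma> m t)\<bar>"
            using True b by (simp add: ennreal_mult'[symmetric] abs_mult mult.commute ennreal_leI)
        qed
        also have "\<dots> = ennreal b * (\<integral>\<^sup>+m. ennreal \<bar>A (\<gamma> m t)\<bar> \<partial>\<mu>)" by (rule nn_integral_cmult) measurable
        also have "(\<integral>\<^sup>+m. ennreal \<bar>A (\<gamma> m t)\<bar> \<partial>\<mu>) = (\<integral>\<^sup>+m. ennreal \<bar>A m\<bar> \<partial>\<mu>)"
          using nn_integral_flow[of t "\<lambda>m. ennreal \<bar>A m\<bar>"] True by simp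
        finally show ?thesis using True by simp
      qed simp
    qed
    also have "\<dots> = (ennreal b * (\<integral>\<^sup>+m. ennreal \<bar>A m\<bar> \<partial>\<mu>)) * ennreal T" using T by (subst nn_integral_cmult_indicator) auto
    also have "\<dots> < \<infinity>" using A_integrable unfolding integrable_iff_bounded by (auto simp: ennreal_mult_less_top)
    finally show "(\<integral>\<^sup>+p. ennreal (norm (case p of (t, m) \<Rightarrow> ?f t m)) \<partial>(lborel \<Otimes>\<^sub>M \<mu>)) < \<infinity>" .
  qed measurable
  have S: "(\<integral>t. ?f t m \<partial>lborel) = process.S T m * \<psi> m" for m
  proof -
    have "(\<integral>t. ?f t m \<partial>lborel) = (\<integral>t. (indicator {0..T} t * A (\<gamma> m t)) * \<psi> m \<partial>lborel)" by (simp add: mult.assoc)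
    then show ?thesis by (simp add: process.S_def set_lebesgue_integral_def)
  qed
  have inner: "(\<integral>m. ?f t m \<partial>\<mu>) = indicator {0..T} t * (\<integral>m. A m * \<psi> m \<partial>\<mu>)" for t
  proof (cases "t \<in> {0..T}")
    case True
    then have "(\<integral>m. A (\<gamma> m t) * \<psi> m \<partial>\<mu>) = (\<integral>m. A m * \<psi> m \<partial>\<mu>)"
      using integral_flow[of t "\<lambda>m. A m * \<psi> m"] by (simp add: inv)
    then show ?thesis by simp
  qed simp
  have "(\<integral>m. process.S T m * \<psi> m \<partial>\<mu>) = (\<integral>t. \<integral>m. ?f t m \<partial>\<mu> \<partial>lborel)"
    using process.P.Fubini_integral[OF int] by (simp add: S)
  also have "\<dots> = (\<integral>t. indicator {0..T} t * (\<integral>m. A m * \<psi> m \<partial>\<mu>) \<partial>lborel)" unfolding inner ..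
  also have "\<dots> = T * (\<integral>m. A m * \<psi> m \<partial>\<mu>)" using T by simp
  finally show ?thesis .
qed


lemma S_square_integrable:
  assumes T: "T \<ge> 0"
  shows "integrable \<mu> (\<lambda>m. (process.S T m)\<^sup>2)" "(\<integral>m. (process.S T m)\<^sup>2 \<partial>\<mu>) = 2 * process.I T"
  using process.integral_S_S[OF T order_refl] by (simp_all add: power2_eq_square)

text \<open>Truncating the level mean \<open>\<phi>\<close> at \<open>c\<close> gives \<open>\<integral> \<phi>\<^sub>c\<^sup>2 = \<integral> A \<phi>\<^sub>c = \<integral> x \<phi>\<^sub>c\<close> over \<open>N\<close>, with the time average
  \<open>x\<close>, because \<open>\<phi>\<^sub>c\<close> and \<open>N\<close> are invariant; hence \<open>\<parallel>\<phi>\<^sub>c\<parallel> \<le> \<parallel>x\<parallel>\<close>.\<close>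

lemma averaged_L2:
  assumes N [measurable]: "N \<in> sets borel" and inv: "flow_invariant \<gamma> N" and T: "T \<ge> 1"
  shows "integrable \<mu> (\<lambda>m. (averaged Hs \<nu> N A m)\<^sup>2)"
    "(\<integral>m. (averaged Hs \<nu> N A m)\<^sup>2 \<partial>\<mu>) \<le> (\<integral>m. indicator N m * (process.S T m / T)\<^sup>2 \<partial>\<mu>)"
proof -
  define \<phi> where "\<phi> = dis.level_mean N A"
  have \<phi> [measurable]: "\<phi> \<in> borel_measurable borel" unfolding \<phi>_def by measurable
  have inv_iff: "\<gamma> m t \<in> N \<longleftrightarrow> m \<in> N" for m t
    using inv flow.flow_inverse(1)[of m t] unfolding flow_invariant_def by metis
  let ?x = "\<lambda>m. process.S T m / T"
  have x2: "integrable \<mu> (\<lambda>m. (?x m)\<^sup>2)" using S_square_integrable(1)[of T] T by (simp add: power_divide)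
  have Nx2: "integrable \<mu> (\<lambda>m. indicator N m * (?x m)\<^sup>2)"
    by (rule Bochner_Integration.integrable_bound[OF x2]) (auto simp: indicator_def)
  have trunc: "(\<integral>\<^sup>+m. ennreal (indicator N m * (if \<bar>\<phi> (Hs m)\<bar> \<le> c then (\<phi> (Hs m))\<^sup>2 else 0)) \<partial>\<mu>)
      \<le> ennreal (\<integral>m. indicator N m * (?x m)\<^sup>2 \<partial>\<mu>)" if c: "c \<ge> 0" for c
  proof -
    define g where "g \<alpha> = (if \<bar>\<phi> \<alpha>\<bar> \<le> c then \<phi> \<alpha> else 0)" for \<alpha>
    have g [measurable]: "g \<in> borel_measurable borel" unfolding g_def[abs_def] by measurable
    have gb: "\<bar>g \<alpha>\<bar> \<le> c" for \<alpha> using c by (simp add: g_def)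
    let ?\<psi> = "\<lambda>m. indicator N m * g (Hs m)"
    have sq: "indicator N m * (if \<bar>\<phi> (Hs m)\<bar> \<le> c then (\<phi> (Hs m))\<^sup>2 else 0) = (?\<psi> m)\<^sup>2" for m
      by (simp add: g_def indicator_def)
    have sq': "(?\<psi> m)\<^sup>2 = indicator N m * \<phi> (Hs m) * g (Hs m)" for m
      by (simp add: g_def indicator_def power2_eq_square)
    have int\<psi>: "integrable \<mu> (\<lambda>m. (?\<psi> m)\<^sup>2)"
      unfolding sq' \<phi>_def by (rule dis.integral_level_mean(1)[OF N A_measurable A_integrable g gb])
    have "(\<integral>m. (?\<psi> m)\<^sup>2 \<partial>\<mu>) = (\<integral>m. indicator N m * A m * g (Hs m) \<partial>\<mu>)"
      unfolding sq' \<phi>_def by (rule dis.integral_level_mean(2)[OF N A_measurable A_integrable g gb])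
    also have "\<dots> = (\<integral>m. A m * ?\<psi> m \<partial>\<mu>)" by (simp add: mult_ac)
    also have "\<dots> = (\<integral>m. process.S T m * ?\<psi> m \<partial>\<mu>) / T"
    proof -
      have "(\<integral>m. process.S T m * ?\<psi> m \<partial>\<mu>) = T * (\<integral>m. A m * ?\<psi> m \<partial>\<mu>)"
      proof (rule integral_S_invariant[where b = c])
        show "\<bar>?\<psi> m\<bar> \<le> c" for m using gb c by (simp add: indicator_def)
        show "?\<psi> (\<gamma> m t) = ?\<psi> m" for m t by (simp add: indicator_def inv_iff)
      qed (use T in auto)
      then show ?thesis using T by simp
    qed
    also have "\<dots> = (\<integral>m. ?x m * ?\<psi> m \<partial>\<mu>)" by simp
    finally have eq: "(\<integral>m. (?\<psi> m)\<^sup>2 \<partial>\<mu>) = (\<integral>m. ?x m * ?\<psi> m \<partial>\<mu>)" .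
    \<comment> \<open>By \<open>eq\<close> the left-hand side is the integral of
      \<open>?\<psi>\<close> squared, which is finite thanks to the truncation; half of it is
      absorbed.\<close>
    have "(\<integral>m. ?x m * ?\<psi> m \<partial>\<mu>) \<le> (\<integral>m. (indicator N m * (?x m)\<^sup>2 + (?\<psi> m)\<^sup>2) / 2 \<partial>\<mu>)"
    proof (rule integral_mono)
      have le: "\<bar>?x m * ?\<psi> m\<bar> \<le> (indicator N m * (?x m)\<^sup>2 + (?\<psi> m)\<^sup>2) / 2" for m
      proof (cases "m \<in> N")
        case True
        have "0 \<le> (\<bar>?x m\<bar> - \<bar>g (Hs m)\<bar>)\<^sup>2" by simp
        then have "2 * (\<bar>?x m\<bar> * \<bar>g (Hs m)\<bar>) \<le> (?x m)\<^sup>2 + (g (Hs m))\<^sup>2" by (simp add: power2_diff del: abs_divide)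
        moreover have "\<bar>?x m * ?\<psi> m\<bar> = \<bar>?x m\<bar> * \<bar>g (Hs m)\<bar>" using True by (simp only: abs_mult) simp
        ultimately show ?thesis using True by (simp del: abs_divide)
      qed simp
      show i2: "integrable \<mu> (\<lambda>m. (indicator N m * (?x m)\<^sup>2 + (?\<psi> m)\<^sup>2) / 2)"
        using Nx2 int\<psi> by simp
      show "integrable \<mu> (\<lambda>m. ?x m * ?\<psi> m)"
        by (rule Bochner_Integration.integrable_bound[OF i2]) (use le in \<open>auto intro!: AE_I2 order_trans[OF le abs_ge_self] simp del: abs_divide\<close>)
      show "?x m * ?\<psi> m \<le> (indicator N m * (?x m)\<^sup>2 + (?\<psi> m)\<^sup>2) / 2" for m
        using le[of m] abs_ge_self order_trans by blast
    qed
    also have "\<dots> = ((\<integral>m. indicator N m * (?x m)\<^sup>2 \<partial>\<mu>) + (\<integral>m. (?\<psi> m)\<^sup>2 \<partial>\<mu>)) / 2"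
      using Nx2 int\<psi> by simp
    finally have "(\<integral>m. (?\<psi> m)\<^sup>2 \<partial>\<mu>) \<le> (\<integral>m. indicator N m * (?x m)\<^sup>2 \<partial>\<mu>)" unfolding eq[symmetric] by simp
    then show ?thesis unfolding sq using int\<psi> by (simp add: nn_integral_eq_integral ennreal_leI)
  qed
  have sq: "(averaged Hs \<nu> N A m)\<^sup>2 = indicator N m * (\<phi> (Hs m))\<^sup>2" for m
    by (simp add: dis.averaged_eq[OF N A_measurable] \<phi>_def power_mult_distrib indicator_def)
  \<comment> \<open>Fatou's lemma removes the truncation: at each point the integrands are constant
    from some \<open>c\<close> on.\<close>
  let ?f = "\<lambda>(c::nat) m. ennreal (indicator N m * (if \<bar>\<phi> (Hs m)\<bar> \<le> real c then (\<phi> (Hs m))\<^sup>2 else 0))"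
  have "(\<integral>\<^sup>+m. ennreal ((averaged Hs \<nu> N A m)\<^sup>2) \<partial>\<mu>) \<le> (\<integral>\<^sup>+m. liminf (\<lambda>c. ?f c m) \<partial>\<mu>)"
  proof (rule nn_integral_mono)
    fix m
    obtain c0 where c0: "\<bar>\<phi> (Hs m)\<bar> \<le> real c0" using real_arch_simple by blast
    have "ennreal ((averaged Hs \<nu> N A m)\<^sup>2) \<le> Liminf sequentially (\<lambda>c. ?f c m)"
    proof (rule Liminf_bounded)
      show "eventually (\<lambda>c. ennreal ((averaged Hs \<nu> N A m)\<^sup>2) \<le> ?f c m) sequentially"
        using eventually_ge_at_top[of c0] by eventually_elim (use c0 in \<open>simp add: sq\<close>)
    qed
    then show "ennreal ((averaged Hs \<nu> N A m)\<^sup>2) \<le> liminf (\<lambda>c. ?f c m)" .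
  qed
  also have "\<dots> \<le> liminf (\<lambda>c. \<integral>\<^sup>+m. ?f c m \<partial>\<mu>)"
    by (rule nn_integral_liminf) measurable
  also have "\<dots> \<le> ennreal (\<integral>m. indicator N m * (?x m)\<^sup>2 \<partial>\<mu>)"
    by (rule order_trans[OF Liminf_mono Liminf_const[THEN eq_refl]])
       (use trunc in \<open>auto intro!: always_eventually\<close>)
  finally have le: "(\<integral>\<^sup>+m. ennreal ((averaged Hs \<nu> N A m)\<^sup>2) \<partial>\<mu>) \<le> ennreal (\<integral>m. indicator N m * (?x m)\<^sup>2 \<partial>\<mu>)" .
  have meas: "(\<lambda>m. (averaged Hs \<nu> N A m)\<^sup>2) \<in> borel_measurable \<mu>" unfolding sq by measurable
  show int: "integrable \<mu> (\<lambda>m. (averaged Hs \<nu> N A m)\<^sup>2)"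
    by (rule integrableI_nonneg[OF meas]) (use le in \<open>auto simp: order_le_less_trans\<close>)
  show "(\<integral>m. (averaged Hs \<nu> N A m)\<^sup>2 \<partial>\<mu>) \<le> (\<integral>m. indicator N m * (?x m)\<^sup>2 \<partial>\<mu>)"
    using le by (subst (asm) nn_integral_eq_integral[OF int]) (auto simp: Bochner_Integration.integral_nonneg)
qed

lemma averaged_measurable [measurable]:
  assumes [measurable]: "N \<in> sets borel" shows "averaged Hs \<nu> N A \<in> borel_measurable borel"
  unfolding dis.averaged_eq[OF assms A_measurable, abs_def] by measurable

text \<open>The cells overlap in null sets only, so their indicators sum to at most 1 almost
  everywhere, and the cellwise bounds of \<open>averaged_L2\<close> add up to at most the squared
  norm of the time average.\<close>

lemma sum_averaged_le:
  fixes N :: "nat \<Rightarrow> 'm set"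
  assumes part: "invariant_partition \<gamma> \<mu> k N" and T: "T \<ge> 1"
  shows "(\<Sum>i=1..k. \<integral>m. (averaged Hs \<nu> (N i) A m)\<^sup>2 \<partial>\<mu>) \<le> 2 * process.I T / T\<^sup>2"
proof -
  let ?x = "\<lambda>m. process.S T m / T"
  have N: "N i \<in> sets borel" "flow_invariant \<gamma> (N i)" if "i \<in> {1..k}" for i
    using part that by (auto simp: invariant_partition_def)
  have x2: "integrable \<mu> (\<lambda>m. (?x m)\<^sup>2)" using S_square_integrable(1)[of T] T by (simp add: power_divide)
  have Nx2: "integrable \<mu> (\<lambda>m. indicator (N i) m * (?x m)\<^sup>2)" if "i \<in> {1..k}" for i
    by (rule Bochner_Integration.integrable_bound[OF x2]) (use N(1)[OF that] in \<open>auto simp: indicator_def\<close>)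
  have "AE m in \<mu>. \<forall>i\<in>{1..k}. \<forall>j\<in>{1..k}. i \<noteq> j \<longrightarrow> m \<notin> N i \<inter> N j"
  proof (intro AE_finite_allI AE_impI finite_atLeastAtMost)
    fix i j assume ij: "i \<in> {1..k}" "j \<in> {1..k}" "i \<noteq> j"
    then have "measure \<mu> (N i \<inter> N j) = 0" using part by (auto simp: invariant_partition_def)
    then have "emeasure \<mu> (N i \<inter> N j) = 0" by (simp add: \<mu>.emeasure_eq_measure)
    then show "AE m in \<mu>. m \<notin> N i \<inter> N j" using N(1)[OF ij(1)] N(1)[OF ij(2)] by (intro AE_not_in) (auto simp: null_sets_def)
  qed
  then have AE: "AE m in \<mu>. (\<Sum>i=1..k. indicator (N i) m * (?x m)\<^sup>2) \<le> (?x m)\<^sup>2"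
  proof eventually_elim
    case (elim m)
    show ?case
    proof (cases "\<exists>i\<in>{1..k}. m \<in> N i")
      case True
      then obtain i where i: "i \<in> {1..k}" "m \<in> N i" by blast
      have "(\<Sum>i=1..k. indicator (N i) m * (?x m)\<^sup>2) = (\<Sum>j=1..k. if j = i then (?x m)\<^sup>2 else 0)"
        by (intro sum.cong refl) (use elim i in \<open>auto simp: indicator_def\<close>)
      also have "\<dots> = (?x m)\<^sup>2" using i by (subst sum.delta) auto
      finally show ?thesis by (rule eq_refl)
    next
      case False
      then have "(\<Sum>i=1..k. indicator (N i) m * (?x m)\<^sup>2) = 0" by (intro sum.neutral) auto
      then show ?thesis by (rule ord_eq_le_trans[OF _ zero_le_power2])
    qed
  qed
  have "(\<Sum>i=1..k. \<integral>m. (averaged Hs \<nu> (N i) A m)\<^sup>2 \<partial>\<mu>) \<le> (\<Sum>i=1..k. \<integral>m. indicator (N i) m * (?x m)\<^sup>2 \<partial>\<mu>)"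
    by (intro sum_mono averaged_L2(2)[OF N T]) auto
  also have "\<dots> = (\<integral>m. (\<Sum>i=1..k. indicator (N i) m * (?x m)\<^sup>2) \<partial>\<mu>)"
    using Nx2 by (subst Bochner_Integration.integral_sum) auto
  also have "\<dots> \<le> (\<integral>m. (?x m)\<^sup>2 \<partial>\<mu>)"
    using Nx2 by (intro integral_mono_AE x2 AE Bochner_Integration.integrable_sum) auto
  also have "\<dots> = 2 * process.I T / T\<^sup>2" using S_square_integrable(2)[of T] T by (simp add: power_divide)
  finally show ?thesis .
qed

lemma monomial_measurable [measurable]: "monomial Hs l \<in> borel_measurable borel"
  unfolding monomial_def[abs_def] by measurable

lemma monomial_square_integrable: "integrable \<mu> (\<lambda>m. (monomial Hs l m)\<^sup>2)"
proof -
  have "\<bar>x\<bar> powr 2 = x\<^sup>2" for x :: real by (cases "x = 0") (simp_all add: powr_numeral)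
  then have "integrable vol (\<lambda>m. (monomial Hs l m)\<^sup>2 * exp (- \<beta> * H m))"
    using monomial_L2[of l] by (simp add: Lp_space_def)
  then show ?thesis by (subst integral_\<mu>(2)) auto
qed

lemma integrable_product:
  fixes F G :: "'m \<Rightarrow> real"
  assumes [measurable]: "F \<in> borel_measurable borel" "G \<in> borel_measurable borel"
    and "integrable \<mu> (\<lambda>m. (F m)\<^sup>2)" "integrable \<mu> (\<lambda>m. (G m)\<^sup>2)"
  shows "integrable \<mu> (\<lambda>m. F m * G m)"
proof (rule Bochner_Integration.integrable_bound[OF Bochner_Integration.integrable_add[OF assms(3,4)]])
  have "\<bar>a * b\<bar> \<le> \<bar>a\<^sup>2 + b\<^sup>2\<bar>" for a b :: real
  proof -
    have "0 \<le> (\<bar>a\<bar> - \<bar>b\<bar>)\<^sup>2" by simp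
    then have "2 * (\<bar>a\<bar> * \<bar>b\<bar>) \<le> a\<^sup>2 + b\<^sup>2" by (simp add: power2_diff)
    then show ?thesis unfolding abs_mult using mult_nonneg_nonneg[of "\<bar>a\<bar>" "\<bar>b\<bar>"] by linarith
  qed
  then show "AE m in \<mu>. norm (F m * G m) \<le> norm ((F m)\<^sup>2 + (G m)\<^sup>2)" by simp
qed measurable

definition e :: "nat \<Rightarrow> 'm \<Rightarrow> real" where "e a = monomial Hs (multi_index a)"

lemma e_measurable [measurable]: "e a \<in> borel_measurable borel"
  unfolding e_def by measurable

lemma integrable_e_e: "integrable \<mu> (\<lambda>m. e a m * e b m)"
  unfolding e_def by (rule integrable_product[OF _ _ monomial_square_integrable monomial_square_integrable]) measurable

lemma gram_eq: "gram vol H \<beta> Hs a b = (\<integral>m. e a m * e b m \<partial>\<mu>)"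
  unfolding gram_def e_def by (rule thermal_inner_eq) measurable

lemma integral_combination:
  assumes "finite I"
  shows "integrable \<mu> (\<lambda>m. (\<Sum>a\<in>I. y a * e a m)\<^sup>2)"
    "(\<integral>m. (\<Sum>a\<in>I. y a * e a m)\<^sup>2 \<partial>\<mu>) = (\<Sum>a\<in>I. \<Sum>b\<in>I. y a * gram vol H \<beta> Hs a b * y b)"
proof -
  have eq: "(\<Sum>a\<in>I. y a * e a m)\<^sup>2 = (\<Sum>a\<in>I. \<Sum>b\<in>I. (y a * y b) * (e a m * e b m))" for m
    by (simp add: power2_eq_square sum_product mult_ac)
  show "integrable \<mu> (\<lambda>m. (\<Sum>a\<in>I. y a * e a m)\<^sup>2)"
    unfolding eq by (intro Bochner_Integration.integrable_sum integrable_mult_right integrable_e_e)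
  have "(\<integral>m. (\<Sum>a\<in>I. y a * e a m)\<^sup>2 \<partial>\<mu>) = (\<Sum>a\<in>I. \<Sum>b\<in>I. (y a * y b) * (\<integral>m. e a m * e b m \<partial>\<mu>))"
    unfolding eq
    by (simp add: Bochner_Integration.integral_sum Bochner_Integration.integrable_sum integrable_e_e del: sum_distrib_left)
  then show "(\<integral>m. (\<Sum>a\<in>I. y a * e a m)\<^sup>2 \<partial>\<mu>) = (\<Sum>a\<in>I. \<Sum>b\<in>I. y a * gram vol H \<beta> Hs a b * y b)"
    by (simp add: gram_eq mult_ac)
qed

text \<open>A vanishing form means that the combination of monomials is zero almost everywhere,
  since the weight is positive; by continuity it is zero everywhere, and independence of the
  monomials kills the coefficients.\<close>

lemma gram_positive_definite:
  assumes I: "finite I" and y: "\<exists>a\<in>I. y a \<noteq> 0"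
  shows "0 < (\<Sum>a\<in>I. \<Sum>b\<in>I. y a * gram vol H \<beta> Hs a b * y b)"
proof (rule ccontr)
  let ?p = "\<lambda>m. \<Sum>a\<in>I. y a * e a m"
  note int = integral_combination[OF I, of y]
  assume "\<not> ?thesis"
  moreover have "0 \<le> (\<integral>m. (?p m)\<^sup>2 \<partial>\<mu>)" by simp
  ultimately have "(\<integral>m. (?p m)\<^sup>2 \<partial>\<mu>) = 0" unfolding int(2) by linarith
  then have "AE m in \<mu>. (?p m)\<^sup>2 = 0"
    using integral_nonneg_eq_0_iff_AE[OF int(1)] by simp
  then have "AE m in vol. ?p m = 0"
    unfolding dis.\<mu>_def by (subst (asm) AE_density) (auto simp: w_pos)
  moreover have op: "open {m. ?p m \<noteq> 0}"
  proof -
    have "continuous_on UNIV ?p"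
      unfolding e_def monomial_def by (intro continuous_intros Hs_continuous)
    then have "open (?p -` (- {0}))" by (intro open_vimage) auto
    then show ?thesis by (simp add: vimage_def)
  qed
  ultimately have "emeasure vol {m. ?p m \<noteq> 0} = 0"
    by (subst (asm) AE_iff_measurable[of "{m. ?p m \<noteq> 0}"]) auto
  then have "{m. ?p m \<noteq> 0} = {}"
    using flow.open_positive_volume[OF hamiltonian_liouville_flow(2)[OF hamiltonian liouville] op] by auto
  then have zero: "?p m = 0" for m by blast
  obtain a where a: "a \<in> I" "y a \<noteq> 0" using y by blast
  have inj: "inj_on multi_index I" unfolding multi_index_def
    using bij_imp_bij_inv[OF bij_position] by (meson bij_is_inj inj_on_subset subset_UNIV)
  have pos: "position (multi_index b :: 'k \<Rightarrow> nat) = b" for b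
    unfolding multi_index_def using surj_position by (rule surj_f_inv_f)
  have "y (position (multi_index a :: 'k \<Rightarrow> nat)) = 0"
  proof (rule conserved_monomials_independent[of atlas Hs "multi_index ` I" "\<lambda>l. y (position l)"])
    show "smooth_atlas atlas" "smooth_map atlas Hs" "functionally_independent atlas Hs"
      using flow.atlas conserved by (auto simp: conserved_quantities_def)
    show "(\<Sum>l\<in>multi_index ` I. y (position l) * monomial Hs l m) = 0" for m
      using zero[of m] by (simp add: sum.reindex[OF inj] pos e_def)
  qed (use I a in auto)
  then show False using a by (simp add: pos)
qed

lemma finite_gram_inverse:
  "inverse_matrix (position ` {l :: 'k \<Rightarrow> nat. degree l \<le> d}) (gram vol H \<beta> Hs) (finite_gram_inverse vol H \<beta> Hs d)"
proof -
  have "\<exists>K. inverse_matrix (position ` {l :: 'k \<Rightarrow> nat. degree l \<le> d}) (gram vol H \<beta> Hs) K"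
  proof (rule positive_definite_inverse)
    show "gram vol H \<beta> Hs a b = gram vol H \<beta> Hs b a" for a b by (simp add: gram_eq mult.commute)
    show fin: "finite (position ` {l :: 'k \<Rightarrow> nat. degree l \<le> d})" by (intro finite_imageI finite_degree_le)
    show "0 < (\<Sum>a\<in>position ` {l :: 'k \<Rightarrow> nat. degree l \<le> d}. \<Sum>b\<in>position ` {l :: 'k \<Rightarrow> nat. degree l \<le> d}.
        y a * gram vol H \<beta> Hs a b * y b)" if "\<exists>a\<in>position ` {l :: 'k \<Rightarrow> nat. degree l \<le> d}. y a \<noteq> 0" for y
      by (rule gram_positive_definite[OF fin that])
  qed
  then show ?thesis unfolding finite_gram_inverse_def by (rule someI_ex)
qed

text \<open>Bessel's inequality in variational form: expand the squared norm of \<open>F\<close>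
  minus a linear combination of monomials.\<close>

lemma gram_bound_moment:
  assumes [measurable]: "F \<in> borel_measurable borel" and F2: "integrable \<mu> (\<lambda>m. (F m)\<^sup>2)"
  shows "gram_bound (gram vol H \<beta> Hs) (\<lambda>a. moment vol H \<beta> Hs F (multi_index a)) (\<integral>m. (F m)\<^sup>2 \<partial>\<mu>)"
proof
  show "gram vol H \<beta> Hs a b = gram vol H \<beta> Hs b a" for a b by (simp add: gram_eq mult.commute)
  fix I :: "nat set" and y :: "nat \<Rightarrow> real" assume I: "finite I"
  note int = integral_combination[OF I, of y]
  show "0 \<le> (\<Sum>a\<in>I. \<Sum>b\<in>I. y a * gram vol H \<beta> Hs a b * y b)"
    unfolding int(2)[symmetric] by simp
  have mom: "moment vol H \<beta> Hs F (multi_index a) = (\<integral>m. F m * e a m \<partial>\<mu>)" for a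
    unfolding moment_def e_def by (rule thermal_inner_eq) measurable
  have iF: "integrable \<mu> (\<lambda>m. F m * e a m)" for a
    unfolding e_def by (rule integrable_product[OF _ _ F2 monomial_square_integrable]) measurable
  have "0 \<le> (\<integral>m. (F m - (\<Sum>a\<in>I. y a * e a m))\<^sup>2 \<partial>\<mu>)" by simp
  also have "\<dots> = (\<integral>m. (F m)\<^sup>2 - 2 * (\<Sum>a\<in>I. y a * (F m * e a m)) + (\<Sum>a\<in>I. y a * e a m)\<^sup>2 \<partial>\<mu>)"
    by (intro Bochner_Integration.integral_cong refl) (simp add: power2_diff sum_distrib_left mult_ac)
  also have "\<dots> = (\<integral>m. (F m)\<^sup>2 \<partial>\<mu>) - 2 * (\<Sum>a\<in>I. y a * (\<integral>m. F m * e a m \<partial>\<mu>)) + (\<integral>m. (\<Sum>a\<in>I. y a * e a m)\<^sup>2 \<partial>\<mu>)"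
    using F2 iF int(1) by (simp add: Bochner_Integration.integral_sum Bochner_Integration.integrable_sum)
  finally show "2 * (\<Sum>a\<in>I. y a * moment vol H \<beta> Hs F (multi_index a)) - (\<Sum>a\<in>I. \<Sum>b\<in>I. y a * gram vol H \<beta> Hs a b * y b)
    \<le> (\<integral>m. (F m)\<^sup>2 \<partial>\<mu>)"
    by (simp add: int(2) mom)
qed

lemma inverse_gram_form_eq:
  "inverse_gram_form vol H \<beta> Hs d F = (\<Sum>a\<in>position ` {l :: 'k \<Rightarrow> nat. degree l \<le> d}. \<Sum>b\<in>position ` {l :: 'k \<Rightarrow> nat. degree l \<le> d}.
     moment vol H \<beta> Hs F (multi_index a) * finite_gram_inverse vol H \<beta> Hs d a b * moment vol H \<beta> Hs F (multi_index b))"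
  unfolding inverse_gram_form_def
  by (simp add: sum.reindex[OF inj_on_subset[OF inj_position subset_UNIV]])

lemma inverse_gram_form_bounds:
  assumes "F \<in> borel_measurable borel" "integrable \<mu> (\<lambda>m. (F m)\<^sup>2)"
  shows "inverse_gram_form vol H \<beta> Hs d F \<le> (\<integral>m. (F m)\<^sup>2 \<partial>\<mu>)"
    "inverse_gram_form vol H \<beta> Hs d F \<le> inverse_gram_form vol H \<beta> Hs (Suc d) F"
proof -
  interpret gram_bound "gram vol H \<beta> Hs" "\<lambda>a. moment vol H \<beta> Hs F (multi_index a)" "\<integral>m. (F m)\<^sup>2 \<partial>\<mu>"
    by (rule gram_bound_moment[OF assms])
  have fin: "finite (position ` {l :: 'k \<Rightarrow> nat. degree l \<le> d})" for d using finite_degree_le by blast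
  show "inverse_gram_form vol H \<beta> Hs d F \<le> (\<integral>m. (F m)\<^sup>2 \<partial>\<mu>)"
    unfolding inverse_gram_form_eq by (rule finite_inverse_form_le[OF fin finite_gram_inverse])
  show "inverse_gram_form vol H \<beta> Hs d F \<le> inverse_gram_form vol H \<beta> Hs (Suc d) F"
    unfolding inverse_gram_form_eq
    by (rule finite_inverse_form_mono[OF fin _ finite_gram_inverse finite_gram_inverse]) auto
qed

lemma infinite_inverse_gram_form_le:
  assumes "F \<in> borel_measurable borel" "integrable \<mu> (\<lambda>m. (F m)\<^sup>2)"
    and "inverse_matrix UNIV (gram vol H \<beta> Hs) K"
    and "inverse_applicable (gram vol H \<beta> Hs) K (\<lambda>a. moment vol H \<beta> Hs F (multi_index a))"
  shows "infinite_inverse_gram_form vol H \<beta> Hs K F \<le> (\<integral>m. (F m)\<^sup>2 \<partial>\<mu>)"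
proof -
  interpret gram_bound "gram vol H \<beta> Hs" "\<lambda>a. moment vol H \<beta> Hs F (multi_index a)" "\<integral>m. (F m)\<^sup>2 \<partial>\<mu>"
    by (rule gram_bound_moment[OF assms(1,2)])
  have bij: "bij_betw (map_prod position position) (UNIV :: (('k \<Rightarrow> nat) \<times> ('k \<Rightarrow> nat)) set) UNIV"
    using bij_betw_map_prod[OF bij_position bij_position] by simp
  have "infinite_inverse_gram_form vol H \<beta> Hs K F = (\<Sum>\<^sub>\<infinity>(a, b)\<in>UNIV.
      moment vol H \<beta> Hs F (multi_index a) * K a b * moment vol H \<beta> Hs F (multi_index b))"
    unfolding infinite_inverse_gram_form_def
    using infsum_reindex_bij_betw[OF bij, of "\<lambda>(a, b). moment vol H \<beta> Hs F (multi_index a) * K a b * moment vol H \<beta> Hs F (multi_index b)"]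
    by (simp add: case_prod_unfold)
  then show ?thesis using infinite_inverse_form_le[OF assms(3,4)] by simp
qed

end

text \<open>\<open>Lim\<close> denotes some value even without convergence, so convergence to
  \<open>C\<close> is part of the conclusion. The case of infinite degree appears in two readings:
  as the limit of the bounds for finite degree, and with any two-sided inverse of the infinite Gram
  matrix that is applicable to the moments of all the averaged functions.\<close>

theorem proposition2:
  fixes atlas :: "('m::{second_countable_topology, t2_space}, 'n::finite) chart set"
    and \<omega> :: "('m, 'n) chart \<Rightarrow> real^'n \<Rightarrow> real^'n^'n"
    and H :: "'m \<Rightarrow> real"
    and \<gamma> :: "'m \<Rightarrow> real \<Rightarrow> 'm"
    and vol :: "'m measure"
    and Hs :: "'m \<Rightarrow> real^'k::{finite, linorder}"
    and D :: "(real^'k::{finite, linorder}) set"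
    and \<nu> :: "real^'k::{finite, linorder} \<Rightarrow> 'm measure"
    and \<beta> :: real
    and A :: "'m \<Rightarrow> real"
    and K :: "nat \<Rightarrow> nat"
    and N :: "nat \<Rightarrow> nat \<Rightarrow> 'm set"
    and n :: nat
  assumes "hamiltonian_system atlas \<omega> H \<gamma>"
    and "liouville_measure atlas \<omega> vol"
    and "\<forall>b>0. integrable vol (\<lambda>m. exp (- b * H m))"
    and "\<beta> > 0"
    and "conserved_quantities atlas H \<gamma> Hs"
    and "\<forall>l. monomial Hs l \<in> Lp_space 2 vol H \<beta>"
    and "microcanonical_measures vol Hs D \<nu>"
    and "ergodic_decomposition \<gamma> (gibbs_measure vol H \<beta>) K N"
    and "A \<in> Lp_space 1 vol H \<beta>"
    and "correlation_converges vol H \<beta> \<gamma> A"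
    and "n \<ge> 1"
  shows "let C = long_time_correlation vol H \<beta> \<gamma> A;
             B = (\<lambda>i. averaged Hs \<nu> (N n i) A)
         in (mean_correlation vol H \<beta> \<gamma> A \<longlongrightarrow> C) at_top \<and>
            (\<forall>d. C \<ge> (\<Sum>i=1..K n. inverse_gram_form vol H \<beta> Hs d (B i))) \<and>
            (\<exists>S. (\<lambda>d. \<Sum>i=1..K n. inverse_gram_form vol H \<beta> Hs d (B i)) \<longlonglongrightarrow> S \<and> C \<ge> S) \<and>
            (\<forall>G. inverse_matrix UNIV (gram vol H \<beta> Hs) G \<and>
                 (\<forall>i\<in>{1..K n}. inverse_applicable (gram vol H \<beta> Hs) G
                                 (\<lambda>a. moment vol H \<beta> Hs (B i) (multi_index a))) \<longrightarrow>
                 C \<ge> (\<Sum>i=1..K n. infinite_inverse_gram_form vol H \<beta> Hs G (B i)))"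
proof -
  have part: "invariant_partition \<gamma> (gibbs_measure vol H \<beta>) (K n) (N n)"
    using assms(8,11) unfolding ergodic_decomposition_def by blast
  \<comment> \<open>If the partition function were 0, division by it would make the Gibbs density
    zero; but there is a cell, since the cells cover the manifold, and its Gibbs measure is
    positive.\<close>
  have Z: "partition_function vol H \<beta> > 0"
  proof -
    have "K n \<ge> 1" using part by (cases "K n = 0") (auto simp: invariant_partition_def)
    then have one: "1 \<in> {1..K n}" by simp
    from part have "\<forall>i\<in>{1..K n}. measure (gibbs_measure vol H \<beta>) (N n i) > 0"
      unfolding invariant_partition_def by blast
    from bspec[OF this one] have "measure (gibbs_measure vol H \<beta>) (N n 1) \<noteq> 0" by simp
    then have "partition_function vol H \<beta> \<noteq> 0" by (auto simp: gibbs_measure_def null_measure_eq_density[symmetric])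
    moreover have "partition_function vol H \<beta> \<ge> 0" by (simp add: partition_function_def)
    ultimately show ?thesis by simp
  qed
  interpret thermal_system atlas \<omega> H \<gamma> vol Hs D \<nu> \<beta> A
    by unfold_locales (use assms Z in auto)
  let ?B = "\<lambda>i. averaged Hs \<nu> (N n i) A"
  let ?q = "\<lambda>i. \<integral>m. (?B i m)\<^sup>2 \<partial>\<mu>"
  note part = part[unfolded gibbs_eq]
  have N: "N n i \<in> sets borel" "flow_invariant \<gamma> (N n i)" if "i \<in> {1..K n}" for i
    using part that by (auto simp: invariant_partition_def)
  have B: "?B i \<in> borel_measurable borel" "integrable \<mu> (\<lambda>m. (?B i m)\<^sup>2)" if "i \<in> {1..K n}" for i
    using averaged_measurable averaged_L2(1)[OF N] N that by auto
  obtain s where s: "((\<lambda>T. process.u T / T) \<longlongrightarrow> s) at_top"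
    "\<And>b. (\<And>T. T \<ge> 1 \<Longrightarrow> b \<le> 2 * process.I T / T\<^sup>2) \<Longrightarrow> b \<le> s"
    using process.mean_correlation_limit by blast
  have lim: "(mean_correlation vol H \<beta> \<gamma> A \<longlongrightarrow> s) at_top"
    using s(1) by (simp add: mean_correlation_eq[abs_def])
  then have C: "long_time_correlation vol H \<beta> \<gamma> A = s"
    unfolding long_time_correlation_def by (intro tendsto_Lim) auto
  have q_le: "(\<Sum>i=1..K n. ?q i) \<le> s" by (rule s(2)) (rule sum_averaged_le[OF part])
  let ?Q = "\<lambda>d. \<Sum>i=1..K n. inverse_gram_form vol H \<beta> Hs d (?B i)"
  have Q_le: "?Q d \<le> s" for d
    by (rule order_trans[OF sum_mono q_le]) (use inverse_gram_form_bounds(1)[OF B] in auto)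
  have "incseq ?Q"
    by (intro incseq_SucI sum_mono) (use inverse_gram_form_bounds(2)[OF B] in auto)
  then obtain S where S: "?Q \<longlonglongrightarrow> S" using incseq_convergent[of ?Q s] Q_le by blast
  have S_le: "S \<le> s" by (rule LIMSEQ_le_const2[OF S]) (use Q_le in auto)
  have "(\<Sum>i=1..K n. infinite_inverse_gram_form vol H \<beta> Hs G (?B i)) \<le> s"
    if "inverse_matrix UNIV (gram vol H \<beta> Hs) G" "\<forall>i\<in>{1..K n}. inverse_applicable (gram vol H \<beta> Hs) G
       (\<lambda>a. moment vol H \<beta> Hs (?B i) (multi_index a))" for G
    by (rule order_trans[OF sum_mono q_le]) (use infinite_inverse_gram_form_le[OF B that(1)] that(2) in auto)
  then show ?thesis
    unfolding Let_def C using lim Q_le S S_le by blast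
qed

end
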